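(* Let $D\ge2$ be an integer and let $\vec p$ be a single-edge strategy. The following are equivalent: (i) $\sigma_{\vec p}$ is an extreme point of the convex set $\{\sigma_{\vec q}:\vec q\text{ a single-edge strategy}\}$. (ii) Any consistent single-edge strategy achieving $\sigma_{\vec p}$ (i.e. any consistent $\vec q$ with $\sigma_{\vec q}=\sigma_{\vec p}$) must be deterministic. (iii) $\sigma_{\vec p}$ has a density $f_{\vec p}$ with respect to $\Lambda$ which is not constant on sets of positive $\Lambda$-measure, and $\sigma_{\vec p}$ is given by the following single-edge strategy $\vec q$ (i.e. $\sigma_{\vec p}=\sigma_{\vec q}$): $$q_k(u_1,\dots,u_D)=\mathbf 1_{\{f_{\vec p}(u_k)\ge f_{\vec p}(u_i)\ \forall i\}}\quad\text{for }\Lambda^{\times D}\text{-a.a. }(u_1,\dots,u_D).$$ In other words, $\sigma_{\vec p}$ is achieved by the deterministic greedy single-edge strategy "choose whichever label yields a higher value when evaluating the density $f_{\vec p}$". (iv) $\sigma_{\vec p}$ has a density $f_{\vec p}$ with respect to $\Lambda$ such that $\frac1Df_{\vec p}(\text{Unif}[0,1])\sim\text{Beta}(1,D)$.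
   Context: $\Lambda$ is Lebesgue measure on $[0,1]$. A single-edge strategy is a vector $\vec p=(p_1,\dots,p_D)$ of measurable functions $p_k:[0,1]^D\to[0,1]$ with $\sum_{k=1}^Dp_k\equiv1$. If $U^1,\dots,U^D$ are i.i.d. Unif$[0,1]$ and, given $(U^1,\dots,U^D)=(u_1,\dots,u_D)$, the index $J$ equals $k$ with probability $p_k(u_1,\dots,u_D)$, then $\sigma_{\vec p}$ denotes the law of $U^J$. The measure $\sigma_{\vec p}$ is always absolutely continuous with respect to $\Lambda$. In (iv), $f_{\vec p}(\text{Unif}[0,1])$ denotes the random variable $f_{\vec p}(U)$ with $U\sim\text{Unif}[0,1]$. $\vec p$ is deterministic if all $p_k$ are $\{0,1\}$-valued $\Lambda^{\times D}$-a.e. $\vec p$ is consistent if $p_i(\vec u)=p_i(u_{\iota(1)},\dots,u_{\iota(D)})$ for all $i$, all $\vec u$ and all permutations $\iota\in S_D$ with $\iota(i)=i$, and $p_k(\vec u)=p_1(u_k,u_{k+1},\dots,u_D,u_1,\dots,u_{k-1})$ for all $k$ and $\vec u$.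
   Formalization: In (iv), Beta(1,D) is replaced by Beta(1/(D-1),1): a density gives f(Unif[0,1])/D mean 1/D, while Beta(1,D) has mean 1/(D+1), so the printed (iv) never holds, although (i) holds for "choose the largest label". *)

theory Defs
  imports "HOL-Probability.Probability"
begin

definition unif01 :: "real measure" where
  "unif01 = restrict_space lborel {0..1}"

text \<open>
  The indices \<open>1, \<dots>, D\<close> of the informal text are rendered as \<open>0, \<dots>, D - 1\<close>.
  Points of \<open>[0,1]\<^sup>D\<close> are the extensional functions in \<open>{..<D} \<rightarrow>\<^sub>E {0..1}\<close>.
\<close>

definition cube :: "nat \<Rightarrow> (nat \<Rightarrow> real) measure" where
  "cube D = (\<Pi>\<^sub>M i\<in>{..<D}. unif01)"

definition strategy :: "nat \<Rightarrow> (nat \<Rightarrow> (nat \<Rightarrow> real) \<Rightarrow> real) \<Rightarrow> bool" where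
  "strategy D p \<longleftrightarrow>
     (\<forall>k<D. p k \<in> borel_measurable (cube D)) \<and>
     (\<forall>k<D. \<forall>u\<in>space (cube D). p k u \<in> {0..1}) \<and>
     (\<forall>u\<in>space (cube D). (\<Sum>k<D. p k u) = 1)"

text \<open>
  The density below is that of the joint law of \<open>(U, J)\<close> with respect to the product of
  Lebesgue and counting measure; its image under \<open>(u, k) \<mapsto> u k\<close> is the law of \<open>U\<^sup>J\<close>.
\<close>

definition strategy_law :: "nat \<Rightarrow> (nat \<Rightarrow> (nat \<Rightarrow> real) \<Rightarrow> real) \<Rightarrow> real measure" where
  "strategy_law D p =
     distr (density (cube D \<Otimes>\<^sub>M count_space {..<D}) (\<lambda>(u, k). ennreal (p k u)))
       unif01 (\<lambda>(u, k). u k)"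

definition deterministic :: "nat \<Rightarrow> (nat \<Rightarrow> (nat \<Rightarrow> real) \<Rightarrow> real) \<Rightarrow> bool" where
  "deterministic D p \<longleftrightarrow> (\<forall>k<D. AE u in cube D. p k u \<in> {0, 1})"

definition consistent :: "nat \<Rightarrow> (nat \<Rightarrow> (nat \<Rightarrow> real) \<Rightarrow> real) \<Rightarrow> bool" where
  "consistent D p \<longleftrightarrow>
     (\<forall>i<D. \<forall>u\<in>space (cube D). \<forall>\<pi>. \<pi> permutes {..<D} \<and> \<pi> i = i \<longrightarrow>
        p i u = p i (\<lambda>j\<in>{..<D}. u (\<pi> j))) \<and>
     (\<forall>k<D. \<forall>u\<in>space (cube D).
        p k u = p 0 (\<lambda>j\<in>{..<D}. u ((k + j) mod D)))"

text \<open>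
  Measures do not form a vector space type, so \<open>extreme_point_of\<close> does not apply directly;
  convex combinations are taken setwise. All members of \<open>S\<close> are meant to be probability
  measures on the same measurable space.
\<close>

definition extreme_measure :: "'a measure \<Rightarrow> 'a measure set \<Rightarrow> bool" where
  "extreme_measure \<mu> S \<longleftrightarrow> \<mu> \<in> S \<and>
     (\<forall>\<alpha>\<in>S. \<forall>\<beta>\<in>S. \<forall>t. 0 < t \<and> t < 1 \<and>
        (\<forall>A\<in>sets \<mu>. measure \<mu> A = (1 - t) * measure \<alpha> A + t * measure \<beta> A) \<longrightarrow> \<alpha> = \<beta>)"

definition has_density :: "real measure \<Rightarrow> (real \<Rightarrow> real) \<Rightarrow> bool" where
  "has_density \<mu> f \<longleftrightarrow>
     f \<in> borel_measurable unif01 \<and> (\<forall>x\<in>space unif01. 0 \<le> f x) \<and>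
     \<mu> = density unif01 (\<lambda>x. ennreal (f x))"

definition beta_density :: "real \<Rightarrow> real \<Rightarrow> real \<Rightarrow> real" where
  "beta_density a b x =
     (if 0 < x \<and> x < 1 then x powr (a - 1) * (1 - x) powr (b - 1) / Beta a b else 0)"

text \<open>
  If the law of \<open>f\<close> under \<open>unif01\<close> has no atoms and the greedy strategy for \<open>f\<close> has a law
  with density \<open>f\<close>, then \<open>f x = D * F (f x) ^ (D - 1)\<close> with \<open>F\<close> the distribution function of \<open>f\<close> under \<open>unif01\<close>.
  So \<open>f / D\<close> is distributed as \<open>V ^ (D - 1)\<close> with \<open>V\<close> uniform, which in terms of the
  above density is \<open>Beta(1 / (D - 1), 1)\<close>. The source prints \<open>Beta(1, D)\<close>; its mean is
  \<open>1 / (D + 1)\<close> (or \<open>D / (D + 1)\<close> with the parameters swapped), whereas \<open>f / D\<close> always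
  has mean \<open>1 / D\<close>.
\<close>

end

theory Submission
  imports Defs
begin

text \<open>
  Extreme implies deterministic: if \<open>m u\<close> is the mean of \<open>U\<^sup>J\<close> given \<open>u\<close>, then \<open>\<sigma>\<^sub>q\<close> is the midpoint of the laws
  of \<open>q k u * (1 \<plusminus> (u k - m u))\<close>, and these have different means unless the conditional variance of
  \<open>U\<^sup>J\<close> vanishes. Conversely, a convex combination representing \<open>\<sigma>\<^sub>p\<close> can be symmetrised, and a
  deterministic strategy is no proper mixture of two different ones.

  Deterministic implies greedy: let \<open>f\<close> be the density of \<open>\<sigma>\<^sub>p\<close>, and suppose that \<open>x\<close> often beats \<open>y\<close>
  although \<open>f x < f y\<close>. Let \<open>x\<close> and \<open>y\<close> play each other's role with small probability, which moves
  mass from \<open>y\<close> to \<open>x\<close> as \<open>f y > f x\<close>, and let \<open>x\<close> sometimes pass its win on to \<open>y\<close>. The two effects can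
  be balanced, giving a nondeterministic strategy with the same law. So the winner maximises \<open>f\<close>. If \<open>f\<close> had
  an atom \<open>{f = c}\<close>, breaking the ties at \<open>c\<close> uniformly would again preserve the law.

  The greedy strategy for an atomless \<open>f\<close> has density \<open>D * F (f x) ^ (D - 1)\<close>, \<open>F\<close> the distribution
  function of \<open>f\<close>. Hence it reproduces \<open>f\<close> iff \<open>f / D\<close> is distributed as \<open>V ^ (D - 1)\<close> with \<open>V\<close> uniform.
\<close>

section \<open>Unif[0,1] and its powers\<close>

text \<open>The balance claimed in the overview is struck for each pair of values separately. Let
  \<open>r (x, y)\<close> be the density of pairs (winning value \<open>x\<close>, losing value
  \<open>y\<close>), and \<open>h x y\<close> the smaller of \<open>r (x, y)\<close> and the
  positive part of \<open>f y - f x\<close>. Handing over at rate \<open>h x y / r (x, y)\<close>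
  moves mass \<open>h x y\<close> from \<open>x\<close> to \<open>y\<close>; resampling at the
  symmetric rate \<open>(h x y + h y x) / \<bar>f x - f y\<bar>\<close> moves the same net mass
  back. The minimum keeps both rates at most 1. Both effects are added to the strategy as a small
  multiple of a linear correction, so the law is preserved exactly and not merely to first order.

  The obstacle is that a strategy is a function of \<open>D\<close> variables while its law
  remembers only one. Laws are therefore compared through expectations of bounded test functions of
  the winning value, which are linear in the strategy.

  Extremality makes every strategy with the given law deterministic, and the perturbations
  contradict this without having to be consistent. Consistency enters through averaging over
  permutations.\<close>

lemma space_unif01: "space unif01 = {0..1}"
  by (simp add: unif01_def space_restrict_space)

lemma prob_space_unif01: "prob_space unif01"
  by standard (simp add: unif01_def emeasure_restrict_space space_restrict_space)

interpretation unif01: prob_space unif01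
  by (rule prob_space_unif01)

interpretation unif01_seq: product_prob_space "\<lambda>_::nat. unif01" I for I
  by standard

interpretation cube: prob_space "cube D" for D
  unfolding cube_def by (rule prob_space_PiM) (rule prob_space_unif01)

interpretation unif01_pair: pair_prob_space unif01 unif01
  by standard

interpretation cube_pair: pair_prob_space "cube D" unif01 for D
  by standard

lemma space_cube: "space (cube D) = {..<D} \<rightarrow>\<^sub>E {0..1}"
  by (simp add: cube_def space_PiM space_unif01)

lemma in_unif01_measurable: "(\<lambda>x. x) \<in> borel_measurable unif01"
  by (simp add: unif01_def measurable_restrict_space1)

lemma cube_component_measurable [measurable (raw)]: "i < D \<Longrightarrow> (\<lambda>u. u i) \<in> measurable (cube D) unif01"
  unfolding cube_def by (rule measurable_component_singleton) simp

lemma cube_component_borel_measurable [measurable (raw)]: "i < D \<Longrightarrow> (\<lambda>u. u i) \<in> borel_measurable (cube D)"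
  using measurable_compose[OF cube_component_measurable in_unif01_measurable] .

lemma fst_component_measurable [measurable (raw)]:
  "i < D \<Longrightarrow> (\<lambda>z. fst z i) \<in> measurable (cube D \<Otimes>\<^sub>M N) unif01"
  using measurable_compose[OF measurable_fst cube_component_measurable] .

lemma cube_component_space [simp]: "u \<in> space (cube D) \<Longrightarrow> i < D \<Longrightarrow> u i \<in> {0..1}"
  by (auto simp: space_cube PiE_iff)

lemma singleton_null_unif01: "emeasure unif01 {x} = 0"
proof (cases "x \<in> {0..1}")
  case True
  then show ?thesis
    by (simp add: unif01_def emeasure_restrict_space)
next
  \<comment> \<open>Outside the interval, \<open>{x}\<close> is not measurable for
    \<open>unif01\<close>, and \<open>emeasure\<close> is 0 there by convention.\<close>
  case False
  then show ?thesis
    by (intro emeasure_notin_sets) (auto dest: sets.sets_into_space simp: space_unif01)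
qed

lemma distr_cube_component:
  assumes "i < D"
  shows "distr (cube D) unif01 (\<lambda>u. u i) = unif01"
  unfolding cube_def using distr_PiM_component[of "{..<D}" "\<lambda>_. unif01" i] assms prob_space_unif01
  by simp

lemma distr_cube_pair:
  assumes "i < D" "j < D" "i \<noteq> j"
  shows "distr (cube D) (unif01 \<Otimes>\<^sub>M unif01) (\<lambda>u. (u i, u j)) = unif01 \<Otimes>\<^sub>M unif01"
proof (rule pair_measure_eqI[symmetric])
  show "sigma_finite_measure unif01" "sigma_finite_measure unif01"
    by unfold_locales
next
  fix A B assume [measurable]: "A \<in> sets unif01" "B \<in> sets unif01"
  have [measurable]: "(\<lambda>u. u i) \<in> measurable (cube D) unif01" "(\<lambda>u. u j) \<in> measurable (cube D) unif01"
    using assms by simp_all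
  have "emeasure (distr (cube D) (unif01 \<Otimes>\<^sub>M unif01) (\<lambda>u. (u i, u j))) (A \<times> B)
      = emeasure (cube D) {u \<in> space (cube D). \<forall>l\<in>{i, j}. u l \<in> (if l = i then A else B)}"
    using assms by (subst emeasure_distr) (auto intro!: arg_cong[where f="emeasure (cube D)"])
  also have "\<dots> = (\<Prod>l\<in>{i, j}. emeasure unif01 (if l = i then A else B))"
    unfolding cube_def using assms by (intro unif01_seq.emeasure_PiM_Collect) auto
  finally show "emeasure unif01 A * emeasure unif01 B
      = emeasure (distr (cube D) (unif01 \<Otimes>\<^sub>M unif01) (\<lambda>u. (u i, u j))) (A \<times> B)"
    using assms by simp
qed simp

text \<open>Fubini: given one coordinate, an independent one hits the same level of \<open>g\<close>
  with probability 0. With \<open>g\<close> the identity this separates the coordinates themselves;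
  with \<open>g\<close> a density it excludes ties.\<close>

lemma AE_cube_distinct:
  assumes [measurable]: "g \<in> borel_measurable unif01"
    and null: "\<And>c. emeasure unif01 {x \<in> space unif01. g x = c} = 0"
  shows "AE u in cube D. \<forall>i<D. \<forall>j<D. i \<noteq> j \<longrightarrow> g (u i) \<noteq> (g (u j) :: real)"
proof -
  have "AE z in unif01 \<Otimes>\<^sub>M unif01. g (fst z) \<noteq> g (snd z)"
  proof (rule unif01_pair.AE_pair_measure)
    show "{z \<in> space (unif01 \<Otimes>\<^sub>M unif01). g (fst z) \<noteq> g (snd z)} \<in> sets (unif01 \<Otimes>\<^sub>M unif01)"
      by measurable
    have "AE y in unif01. g y \<noteq> g x" for x
      using null[of "g x"] by (intro AE_I[where N="{y \<in> space unif01. g y = g x}"]) (auto intro: null)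
    then show "AE x in unif01. AE y in unif01. g (fst (x, y)) \<noteq> g (snd (x, y))"
      by (auto simp: eq_commute)
  qed
  then have "AE u in cube D. g (u i) \<noteq> g (u j)" if "i < D" "j < D" "i \<noteq> j" for i j
  proof -
    have [measurable]: "(\<lambda>u. u i) \<in> measurable (cube D) unif01" "(\<lambda>u. u j) \<in> measurable (cube D) unif01"
      using that by simp_all
    have "AE z in distr (cube D) (unif01 \<Otimes>\<^sub>M unif01) (\<lambda>u. (u i, u j)). g (fst z) \<noteq> g (snd z)"
      using \<open>AE z in unif01 \<Otimes>\<^sub>M unif01. g (fst z) \<noteq> g (snd z)\<close> by (simp only: distr_cube_pair[OF that])
    then show ?thesis
      using that by (subst (asm) AE_distr_iff) simp_all
  qed
  then have "AE u in cube D. \<forall>i\<in>{..<D}. \<forall>j\<in>{..<D}. i \<noteq> j \<longrightarrow> g (u i) \<noteq> g (u j)"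
    by (intro AE_finite_allI) auto
  then show ?thesis by auto
qed

section \<open>Exchanging one coordinate with a fresh uniform\<close>

text \<open>The old value is kept in the spare slot instead of being overwritten. This makes the map
  an involution that can preserve the product measure, and lets rates depend on both the old and the
  new value.\<close>

definition resample :: "nat \<Rightarrow> (nat \<Rightarrow> real) \<times> real \<Rightarrow> (nat \<Rightarrow> real) \<times> real" where
  "resample i z = ((fst z)(i := snd z), fst z i)"

lemma cube_update_measurable [measurable]:
  assumes "i < D" 
  shows "(\<lambda>z. (fst z)(i := snd z)) \<in> measurable (cube D \<Otimes>\<^sub>M unif01) (cube D)"
proof -
  have "(\<lambda>z. (fst z)(i := snd z)) \<in> measurable (cube D \<Otimes>\<^sub>M unif01) (PiM (insert i {..<D}) (\<lambda>_. unif01))"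
    unfolding cube_def by measurable
  then show ?thesis
    using assms by (simp add: cube_def insert_absorb)
qed

lemma resample_measurable [measurable]:
  "i < D \<Longrightarrow> resample i \<in> measurable (cube D \<Otimes>\<^sub>M unif01) (cube D \<Otimes>\<^sub>M unif01)"
  unfolding resample_def [abs_def] by measurable

lemma nn_integral_cube_split:
  assumes "i < D" and f [measurable]: "f \<in> borel_measurable (cube D)"
  shows "(\<integral>\<^sup>+u. f u \<partial>cube D)
    = (\<integral>\<^sup>+x. \<integral>\<^sup>+v. f (v(i := x)) \<partial>(\<Pi>\<^sub>M j\<in>{..<D} - {i}. unif01) \<partial>unif01)"
proof -
  have *: "insert i ({..<D} - {i}) = {..<D}"
    using assms by auto
  show ?thesis
    using unif01_seq.product_nn_integral_insert_rev[of "{..<D} - {i}" i f] f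
    unfolding * cube_def by simp
qed

text \<open>Once coordinate \<open>i\<close> is split off, the old and the spare value are two
  independent uniforms beside an untouched block, and Fubini exchanges them.\<close>

lemma distr_resample:
  assumes [simp]: "i < D"
  shows "distr (cube D \<Otimes>\<^sub>M unif01) (cube D \<Otimes>\<^sub>M unif01) (resample i) = cube D \<Otimes>\<^sub>M unif01"
proof (rule measure_eqI)
  let ?R = "\<Pi>\<^sub>M j\<in>{..<D} - {i}. unif01"
  interpret RU: pair_prob_space ?R unif01
    by standard
  fix S assume "S \<in> sets (distr (cube D \<Otimes>\<^sub>M unif01) (cube D \<Otimes>\<^sub>M unif01) (resample i))"
  then have S [measurable]: "S \<in> sets (cube D \<Otimes>\<^sub>M unif01)"
    by simp
  have I [simp]: "insert i ({..<D} - {i}) = {..<D}"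
    by (auto simp: \<open>i < D\<close>)
  have upd [measurable]: "(\<lambda>z. (fst z)(i := snd z)) \<in> measurable (?R \<Otimes>\<^sub>M unif01) (cube D)"
    unfolding cube_def by (rule measurable_fun_upd[where J="{..<D} - {i}"]) (auto simp: \<open>i < D\<close>)
  have split: "(\<integral>\<^sup>+z. g z \<partial>(cube D \<Otimes>\<^sub>M unif01))
      = (\<integral>\<^sup>+x. \<integral>\<^sup>+y. \<integral>\<^sup>+v. g (v(i := x), y) \<partial>?R \<partial>unif01 \<partial>unif01)"
    if g [measurable]: "g \<in> borel_measurable (cube D \<Otimes>\<^sub>M unif01)" for g
  proof -
    have [measurable]: "(\<lambda>(v, y). g (v(i := x), y)) \<in> borel_measurable (?R \<Otimes>\<^sub>M unif01)"
      if "x \<in> space unif01" for x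
    proof -
      have "(\<lambda>z. (\<lambda>w. ((fst w)(i := snd w))) (fst z, x)) \<in> measurable (?R \<Otimes>\<^sub>M unif01) (cube D)"
        using that by (intro measurable_compose[OF _ upd]) measurable
      then show ?thesis
        by (simp add: split_beta')
    qed
    have "(\<integral>\<^sup>+z. g z \<partial>(cube D \<Otimes>\<^sub>M unif01)) = (\<integral>\<^sup>+u. \<integral>\<^sup>+y. g (u, y) \<partial>unif01 \<partial>cube D)"
      by (rule unif01.nn_integral_fst[symmetric]) measurable
    also have "\<dots> = (\<integral>\<^sup>+x. \<integral>\<^sup>+v. \<integral>\<^sup>+y. g (v(i := x), y) \<partial>unif01 \<partial>?R \<partial>unif01)"
      by (rule nn_integral_cube_split) measurable
    also have "\<dots> = (\<integral>\<^sup>+x. \<integral>\<^sup>+y. \<integral>\<^sup>+v. g (v(i := x), y) \<partial>?R \<partial>unif01 \<partial>unif01)"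
      by (intro nn_integral_cong RU.Fubini'[symmetric]) simp
    finally show ?thesis .
  qed
  have "emeasure (distr (cube D \<Otimes>\<^sub>M unif01) (cube D \<Otimes>\<^sub>M unif01) (resample i)) S
      = (\<integral>\<^sup>+z. indicator S (resample i z) \<partial>(cube D \<Otimes>\<^sub>M unif01))"
    by (subst nn_integral_indicator[symmetric], simp, subst nn_integral_distr) simp_all
  also have "\<dots> = (\<integral>\<^sup>+x. \<integral>\<^sup>+y. \<integral>\<^sup>+v. indicator S (v(i := y), x) \<partial>?R \<partial>unif01 \<partial>unif01)"
    by (subst split) (measurable, simp_all add: resample_def)
  also have "\<dots> = (\<integral>\<^sup>+y. \<integral>\<^sup>+x. \<integral>\<^sup>+v. indicator S (v(i := y), x) \<partial>?R \<partial>unif01 \<partial>unif01)"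
  proof (rule unif01_pair.Fubini'[symmetric])
    have "(\<lambda>z. (\<lambda>w. ((fst w)(i := snd w))) (snd z, snd (fst z))) 
        \<in> measurable ((unif01 \<Otimes>\<^sub>M unif01) \<Otimes>\<^sub>M ?R) (cube D)"
      by (intro measurable_compose[OF _ upd]) measurable
    then have [measurable]: "(\<lambda>z. (snd z)(i := snd (fst z))) \<in> measurable ((unif01 \<Otimes>\<^sub>M unif01) \<Otimes>\<^sub>M ?R) (cube D)"
      by simp
    have "(\<lambda>z. indicator S ((snd z)(i := snd (fst z)), fst (fst z)) :: ennreal)
      \<in> borel_measurable ((unif01 \<Otimes>\<^sub>M unif01) \<Otimes>\<^sub>M ?R)"
      by measurable
    have "sigma_finite_measure ?R"
      by unfold_locales
    from sigma_finite_measure.borel_measurable_nn_integral_fst[OF this \<open>_ \<in> borel_measurable ((unif01 \<Otimes>\<^sub>M unif01) \<Otimes>\<^sub>M ?R)\<close>]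
    show "(\<lambda>(x, y). \<integral>\<^sup>+v. indicator S (v(i := y), x) \<partial>?R) \<in> borel_measurable (unif01 \<Otimes>\<^sub>M unif01)"
      by (simp add: split_beta')
  qed
  also have "\<dots> = emeasure (cube D \<Otimes>\<^sub>M unif01) S"
    by (subst nn_integral_indicator[symmetric], simp, subst split) simp_all
  finally show "emeasure (distr (cube D \<Otimes>\<^sub>M unif01) (cube D \<Otimes>\<^sub>M unif01) (resample i)) S
      = emeasure (cube D \<Otimes>\<^sub>M unif01) S" .
qed simp

text \<open>The function \<open>r\<close> is the conditional expectation of \<open>w\<close> given \<open>X\<close>, factored through \<open>X\<close>.\<close>

lemma fibre_density:
  assumes "prob_space M" and [measurable]: "X \<in> measurable M N" and XN: "distr M N X = N"
    and [measurable]: "w \<in> borel_measurable M" and w: "\<And>x. x \<in> space M \<Longrightarrow> 0 \<le> w x \<and> w x \<le> (1::real)"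
  obtains r where "r \<in> borel_measurable N" "\<And>y. 0 \<le> r y" "\<And>y. r y \<le> (1::real)"
    "distr (density M w) N X = density N r"
    "\<And>\<psi>. \<psi> \<in> borel_measurable N \<Longrightarrow> (\<integral>x. w x * \<psi> (X x) \<partial>M) = (\<integral>y. r y * \<psi> y \<partial>N :: real)"
proof -
  interpret M: prob_space M by fact
  interpret N: prob_space N
    using M.prob_space_distr[of X N] by (simp add: XN)
  let ?N' = "distr (density M w) N X"
  \<comment> \<open>\<open>w \<le> 1\<close> makes the weighted image measure dominated by
    \<open>N\<close>. Both the existence of a density and its bound by 1 come from this.\<close>
  have le: "emeasure ?N' A \<le> emeasure N A" if [measurable]: "A \<in> sets N" for A
  proof -
    have "emeasure ?N' A = (\<integral>\<^sup>+x. ennreal (w x) * indicator (X -` A \<inter> space M) x \<partial>M)"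
      by (simp add: emeasure_distr emeasure_density)
    also have "\<dots> \<le> (\<integral>\<^sup>+x. indicator (X -` A \<inter> space M) x \<partial>M)"
      by (intro nn_integral_mono) (auto split: split_indicator simp: w)
    also have "\<dots> = emeasure (distr M N X) A"
      by (simp add: emeasure_distr)
    finally show ?thesis
      by (simp add: XN)
  qed
  have "absolutely_continuous N ?N'"
    unfolding absolutely_continuous_def using le by (fastforce simp: null_sets_def)
  then obtain g where [measurable]: "g \<in> borel_measurable N" and g: "density N g = ?N'"
    using N.Radon_Nikodym[of ?N'] by auto
  \<comment> \<open>On \<open>?A\<close> the weighted image has no more mass than \<open>N\<close>,
    so the excess \<open>g - 1\<close> integrates to 0 there. The mass cancelled is finite because
    \<open>N\<close> is a probability measure.\<close>
  have "AE y in N. g y \<le> 1"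
  proof -
    let ?A = "{y \<in> space N. 1 < g y}"
    have "(\<integral>\<^sup>+y. (g y - 1) * indicator ?A y \<partial>N) + emeasure N ?A
        = (\<integral>\<^sup>+y. (g y - 1) * indicator ?A y + indicator ?A y \<partial>N)"
      by (subst nn_integral_add) simp_all
    also have "\<dots> = (\<integral>\<^sup>+y. g y * indicator ?A y \<partial>N)"
      by (intro nn_integral_cong) (auto split: split_indicator simp: diff_add_cancel_ennreal)
    also have "\<dots> = emeasure ?N' ?A"
      by (simp flip: g add: emeasure_density)
    also have "\<dots> \<le> emeasure N ?A"
      by (rule le) measurable
    finally have "(\<integral>\<^sup>+y. (g y - 1) * indicator ?A y \<partial>N) + emeasure N ?A \<le> 0 + emeasure N ?A"
      by simp
    then have "(\<integral>\<^sup>+y. (g y - 1) * indicator ?A y \<partial>N) = 0"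
      unfolding add.commute[of _ "emeasure N ?A"] ennreal_add_left_cancel_le by simp
    then have "AE y in N. (g y - 1) * indicator ?A y = 0"
      by (subst (asm) nn_integral_0_iff_AE) simp_all
    then show ?thesis
      using AE_space
      by eventually_elim
        (auto split: split_indicator_asm simp: not_less diff_eq_0_iff_ennreal ennreal_minus_eq_0 intro: leI)
  qed
  \<comment> \<open>Truncation at 1 makes the bounds hold at every point, not just almost
    everywhere, and keeps \<open>enn2real\<close> away from infinity.\<close>
  define r where "r y = enn2real (min 1 (g y))" for y
  have [measurable]: "r \<in> borel_measurable N"
    unfolding r_def by measurable
  have r: "0 \<le> r y" "r y \<le> 1" for y
    unfolding r_def by (auto intro!: enn2real_leI simp: min_def)
  have "AE y in N. g y = ennreal (r y)"
    using \<open>AE y in N. g y \<le> 1\<close>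
  proof eventually_elim
    case (elim y)
    then have "g y < top"
      by (rule le_less_trans) simp
    with elim show ?case
      by (simp add: r_def min_absorb2)
  qed
  then have N': "?N' = density N r"
    unfolding g[symmetric] by (intro density_cong) simp_all
  have "(\<integral>x. w x * \<psi> (X x) \<partial>M) = (\<integral>y. r y * \<psi> y \<partial>N)" if [measurable]: "\<psi> \<in> borel_measurable N" for \<psi>
  proof -
    have "(\<integral>x. w x * \<psi> (X x) \<partial>M) = (\<integral>x. \<psi> (X x) \<partial>density M w)"
      by (subst integral_density) (simp_all add: w AE_I2)
    also have "\<dots> = (\<integral>y. \<psi> y \<partial>?N')"
      by (subst integral_distr) simp_all
    also have "\<dots> = (\<integral>y. r y * \<psi> y \<partial>N)"
      unfolding N' by (subst integral_density) (simp_all add: r)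
    finally show ?thesis .
  qed
  with \<open>r \<in> borel_measurable N\<close> r N' show ?thesis
    by (rule that)
qed

section \<open>Laws of strategies\<close>

text \<open>This is the expectation of a test function of the winning value \<open>U^J\<close>. It
  is written as an integral over the cube rather than against the law, so that it also applies to
  families \<open>q\<close> that are not strategies, such as signed corrections.\<close>

definition win_mean :: "nat \<Rightarrow> (nat \<Rightarrow> (nat \<Rightarrow> real) \<Rightarrow> real) \<Rightarrow> (real \<Rightarrow> real) \<Rightarrow> real" where
  "win_mean D q \<phi> = (\<integral>u. (\<Sum>k<D. q k u * \<phi> (u k)) \<partial>cube D)"

lemma strategy_measurable: "strategy D q \<Longrightarrow> k < D \<Longrightarrow> q k \<in> borel_measurable (cube D)"
  by (simp add: strategy_def)

lemma strategy_nonneg: "strategy D q \<Longrightarrow> k < D \<Longrightarrow> u \<in> space (cube D) \<Longrightarrow> 0 \<le> q k u"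
  and strategy_le_1: "strategy D q \<Longrightarrow> k < D \<Longrightarrow> u \<in> space (cube D) \<Longrightarrow> q k u \<le> 1"
  and strategy_sum: "strategy D q \<Longrightarrow> u \<in> space (cube D) \<Longrightarrow> (\<Sum>k<D. q k u) = 1"
  unfolding strategy_def atLeastAtMost_iff by blast+

lemma strategyI:
  assumes "\<And>k. k < D \<Longrightarrow> q k \<in> borel_measurable (cube D)"
    and nonneg: "\<And>k u. k < D \<Longrightarrow> u \<in> space (cube D) \<Longrightarrow> 0 \<le> q k u"
    and sum: "\<And>u. u \<in> space (cube D) \<Longrightarrow> (\<Sum>k<D. q k u) = 1"
  shows "strategy D q"
proof -
  have "q k u \<le> 1" if "k < D" "u \<in> space (cube D)" for k u
    using member_le_sum[of k "{..<D}" "\<lambda>k. q k u"] that nonneg sum[of u] by simp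
  with assms show ?thesis
    unfolding strategy_def atLeastAtMost_iff by blast
qed

lemma cube_component_in_space: "u \<in> space (cube D) \<Longrightarrow> k < D \<Longrightarrow> u k \<in> space unif01"
  using cube_component_space[of u D k] by (simp add: space_unif01)

lemma integrable_strategy_component:
  assumes q: "strategy D q" and k: "k < D" and [measurable]: "\<phi> \<in> borel_measurable unif01"
    and \<phi>: "\<And>x. x \<in> space unif01 \<Longrightarrow> \<bar>\<phi> x\<bar> \<le> C"
  shows "integrable (cube D) (\<lambda>u. q k u * \<phi> (u k))"
proof (rule cube.integrable_const_bound)
  have [measurable]: "q k \<in> borel_measurable (cube D)" "(\<lambda>u. u k) \<in> measurable (cube D) unif01"
    using strategy_measurable[OF q k] cube_component_measurable[OF k] by auto
  have "\<bar>q k u\<bar> * \<bar>\<phi> (u k)\<bar> \<le> 1 * C" if "u \<in> space (cube D)" for u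
    using \<phi>[of "u k"] that strategy_nonneg[OF q k that] strategy_le_1[OF q k that]
    by (intro mult_mono) (simp_all add: cube_component_in_space k)
  then show "AE u in cube D. norm (q k u * \<phi> (u k)) \<le> 1 * C"
    by (intro AE_I2) (simp add: abs_mult)
  show "(\<lambda>u. q k u * \<phi> (u k)) \<in> borel_measurable (cube D)"
    by measurable
qed

lemma integrable_win:
  assumes "strategy D q" "\<phi> \<in> borel_measurable unif01"
    and "\<And>x. x \<in> space unif01 \<Longrightarrow> \<bar>\<phi> x\<bar> \<le> C"
  shows "integrable (cube D) (\<lambda>u. \<Sum>k<D. q k u * \<phi> (u k))"
  using integrable_strategy_component[OF assms(1) _ assms(2,3)] by (intro Bochner_Integration.integrable_sum) auto

lemma sets_strategy_law [simp, measurable_cong]: "sets (strategy_law D q) = sets unif01"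
  by (simp add: strategy_law_def)

lemma emeasure_strategy_component:
  assumes q: "strategy D q" and k: "k < D" and A: "A \<in> sets unif01"
  shows "emeasure (distr (density (cube D) (q k)) unif01 (\<lambda>u. u k)) A
    = (\<integral>\<^sup>+u. ennreal (q k u) * indicator A (u k) \<partial>cube D)"
proof -
  note [measurable] = strategy_measurable[OF q k] cube_component_measurable[OF k] A
  show ?thesis
    by (subst nn_integral_indicator[symmetric], simp, subst nn_integral_distr, simp, simp)
      (subst nn_integral_density, simp_all)
qed

lemma emeasure_strategy_law:
  assumes q [simp]: "strategy D q" and A [measurable]: "A \<in> sets unif01"
  shows "emeasure (strategy_law D q) A
    = (\<Sum>k<D. \<integral>\<^sup>+u. ennreal (q k u) * indicator A (u k) \<partial>cube D)"
proof -
  note [measurable] = strategy_measurable[OF q]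
  let ?C = "count_space {..<D} :: nat measure"
  interpret C: sigma_finite_measure ?C
    by (rule sigma_finite_measure_count_space_finite) simp
  interpret cube_C: pair_sigma_finite "cube D" ?C
    by standard
  have swap: "(\<lambda>(u, k). g k u) \<in> measurable (cube D \<Otimes>\<^sub>M ?C) N"
    if "\<And>k. k < D \<Longrightarrow> g k \<in> measurable (cube D) N" for g and N :: "'b measure"
  proof -
    have "(\<lambda>(k, u). g k u) \<in> measurable (?C \<Otimes>\<^sub>M cube D) N"
      using that by (intro measurable_pair_measure_countable1) auto
    from measurable_compose[OF measurable_pair_swap' this] show ?thesis
      by (simp add: split_beta')
  qed
  have [measurable]: "(\<lambda>(u, k). q k u) \<in> borel_measurable (cube D \<Otimes>\<^sub>M ?C)"
    using swap[of q borel] strategy_measurable[OF q] by simp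
  have [measurable]: "(\<lambda>(u, k). u k) \<in> measurable (cube D \<Otimes>\<^sub>M ?C) unif01"
    using swap[of "\<lambda>k u. u k" unif01] by simp
  have "emeasure (strategy_law D q) A
      = (\<integral>\<^sup>+z. (\<lambda>(u, k). ennreal (q k u)) z * indicator A ((\<lambda>(u, k). u k) z) \<partial>(cube D \<Otimes>\<^sub>M ?C))"
    unfolding strategy_law_def
    by (subst nn_integral_indicator[symmetric], simp, subst nn_integral_distr, simp, simp)
      (subst nn_integral_density, simp_all add: split_beta')
  also have "\<dots> = (\<integral>\<^sup>+u. \<integral>\<^sup>+k. ennreal (q k u) * indicator A (u k) \<partial>?C \<partial>cube D)"
    by (subst C.nn_integral_fst[symmetric]) (simp_all add: split_beta')
  also have "\<dots> = (\<integral>\<^sup>+u. (\<Sum>k<D. ennreal (q k u) * indicator A (u k)) \<partial>cube D)"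
    by (simp add: nn_integral_count_space_finite)
  also have "\<dots> = (\<Sum>k<D. \<integral>\<^sup>+u. ennreal (q k u) * indicator A (u k) \<partial>cube D)"
    by (rule nn_integral_sum) measurable
  finally show ?thesis .
qed

text \<open>Each label contributes a density of at most 1, and \<open>f\<close> is the sum of the
  \<open>D\<close> contributions. The bound by \<open>D\<close> holds everywhere and is what makes
  later integrals of \<open>f\<close> against bounded functions finite.\<close>

lemma strategy_density:
  assumes q [simp]: "strategy D q"
  shows "\<exists>f. f \<in> borel_measurable unif01 \<and> (\<forall>x. 0 \<le> f x) \<and> (\<forall>x. f x \<le> real D) \<and>
    strategy_law D q = density unif01 f \<and>
    (\<forall>\<phi> C. \<phi> \<in> borel_measurable unif01 \<longrightarrow> (\<forall>x\<in>space unif01. \<bar>\<phi> x\<bar> \<le> C) \<longrightarrow>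
      win_mean D q \<phi> = (\<integral>x. f x * \<phi> x \<partial>unif01))"
proof -
  let ?P = "\<lambda>k r. r \<in> borel_measurable unif01 \<and> (\<forall>x. 0 \<le> r x \<and> r x \<le> 1) \<and>
     distr (density (cube D) (q k)) unif01 (\<lambda>u. u k) = density unif01 r \<and>
     (\<forall>\<phi>\<in>borel_measurable unif01. (\<integral>u. q k u * \<phi> (u k) \<partial>cube D) = (\<integral>x. r x * \<phi> x \<partial>unif01))"
  have "\<exists>r. ?P k r" if k: "k < D" for k
  proof -
    have X: "(\<lambda>u. u k) \<in> measurable (cube D) unif01" and w: "q k \<in> borel_measurable (cube D)"
      and b: "\<And>u. u \<in> space (cube D) \<Longrightarrow> 0 \<le> q k u \<and> q k u \<le> 1"
      using k strategy_measurable[OF q] by (auto simp: strategy_nonneg[OF q k] strategy_le_1[OF q k])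
    show ?thesis
      by (rule fibre_density[OF cube.prob_space_axioms X distr_cube_component[OF k] w b]) blast+
  qed
  then have "\<forall>k. \<exists>r. k < D \<longrightarrow> ?P k r"
    by blast
  from choice[OF this] obtain r where P: "\<forall>k. k < D \<longrightarrow> ?P k (r k)" ..
  have r: "r k \<in> borel_measurable unif01" "0 \<le> r k x" "r k x \<le> 1"
      "distr (density (cube D) (q k)) unif01 (\<lambda>u. u k) = density unif01 (r k)"
      "\<phi> \<in> borel_measurable unif01 \<Longrightarrow>
        (\<integral>u. q k u * \<phi> (u k) \<partial>cube D) = (\<integral>x. r k x * \<phi> x \<partial>unif01)"
    if "k < D" for k x \<phi>
    using P that by blast+
  define f where "f x = (\<Sum>k<D. r k x)" for x
  have f [measurable]: "f \<in> borel_measurable unif01"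
    unfolding f_def using r(1) by simp
  have "0 \<le> f x" for x
    unfolding f_def by (intro sum_nonneg) (simp add: r(2))
  have "f x \<le> real D" for x
    unfolding f_def using sum_bounded_above[of "{..<D}" "\<lambda>k. r k x" 1] r(3) by simp
  have f_sum: "(\<Sum>k<D. ennreal (r k x)) = ennreal (f x)" for x
    unfolding f_def by (rule sum_ennreal) (simp add: r(2))
  have "strategy_law D q = density unif01 f"
  proof (rule measure_eqI)
    fix A assume "A \<in> sets (strategy_law D q)"
    then have [measurable]: "A \<in> sets unif01"
      by simp
    have "emeasure (strategy_law D q) A = (\<Sum>k<D. emeasure (density unif01 (r k)) A)"
      by (simp add: emeasure_strategy_law flip: emeasure_strategy_component r(4))
    also have "\<dots> = (\<Sum>k<D. \<integral>\<^sup>+x. ennreal (r k x) * indicator A x \<partial>unif01)"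
      by (intro sum.cong refl emeasure_density) (use r(1) in auto)
    also have "\<dots> = (\<integral>\<^sup>+x. (\<Sum>k<D. ennreal (r k x) * indicator A x) \<partial>unif01)"
      using r(1) by (intro nn_integral_sum[symmetric]) simp
    also have "\<dots> = (\<integral>\<^sup>+x. ennreal (f x) * indicator A x \<partial>unif01)"
      by (simp only: sum_distrib_right[symmetric] f_sum)
    also have "\<dots> = emeasure (density unif01 f) A"
      by (simp add: emeasure_density)
    finally show "emeasure (strategy_law D q) A = emeasure (density unif01 f) A" .
  qed simp
  moreover have "win_mean D q \<phi> = (\<integral>x. f x * \<phi> x \<partial>unif01)"
    if [measurable]: "\<phi> \<in> borel_measurable unif01" and \<phi>: "\<And>x. x \<in> space unif01 \<Longrightarrow> \<bar>\<phi> x\<bar> \<le> C" for \<phi> C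
  proof -
    have "integrable unif01 (\<lambda>x. r k x * \<phi> x)" if k: "k < D" for k
    proof (rule unif01.integrable_const_bound)
      have "\<bar>r k x\<bar> * \<bar>\<phi> x\<bar> \<le> 1 * C" if "x \<in> space unif01" for x
        using \<phi>[OF that] r(2,3)[OF k] by (intro mult_mono) simp_all
      then show "AE x in unif01. norm (r k x * \<phi> x) \<le> 1 * C"
        by (intro AE_I2) (simp add: abs_mult)
    qed (use r(1)[OF k] in measurable)
    then have "(\<Sum>k<D. \<integral>x. r k x * \<phi> x \<partial>unif01) = (\<integral>x. f x * \<phi> x \<partial>unif01)"
      unfolding f_def sum_distrib_right by (intro Bochner_Integration.integral_sum[symmetric]) auto
    moreover have "win_mean D q \<phi> = (\<Sum>k<D. \<integral>u. q k u * \<phi> (u k) \<partial>cube D)"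
      unfolding win_mean_def using integrable_strategy_component[OF q _ that]
      by (intro Bochner_Integration.integral_sum) auto
    ultimately show ?thesis
      by (simp add: r(5))
  qed
  ultimately show ?thesis
    using \<open>\<And>x. 0 \<le> f x\<close> \<open>\<And>x. f x \<le> real D\<close> f by blast
qed

lemma win_mean_eq_integral_law:
  assumes "strategy D q" and [measurable]: "\<phi> \<in> borel_measurable unif01"
    and "\<And>x. x \<in> space unif01 \<Longrightarrow> \<bar>\<phi> x\<bar> \<le> C"
  shows "win_mean D q \<phi> = (\<integral>x. \<phi> x \<partial>strategy_law D q)"
proof -
  obtain f where [measurable]: "f \<in> borel_measurable unif01" and f: "\<And>x. 0 \<le> f x" "\<And>x. f x \<le> real D"
      "strategy_law D q = density unif01 f"
    and w: "\<And>\<phi> C. \<phi> \<in> borel_measurable unif01 \<Longrightarrow> (\<And>x. x \<in> space unif01 \<Longrightarrow> \<bar>\<phi> x\<bar> \<le> C) \<Longrightarrow>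
      win_mean D q \<phi> = (\<integral>x. f x * \<phi> x \<partial>unif01)"
    using strategy_density[OF assms(1)] by blast
  then show ?thesis
    using w[OF assms(2,3)] by (simp add: integral_density)
qed

text \<open>Indicators as test functions already determine the law, so equality of laws reduces to
  equality of expectations.\<close>

lemma emeasure_strategy_law_win_mean:
  assumes "strategy D q" and [measurable]: "A \<in> sets unif01"
  shows "emeasure (strategy_law D q) A = ennreal (win_mean D q (indicator A))"
proof -
  obtain f where [measurable]: "f \<in> borel_measurable unif01" and f: "\<And>x. 0 \<le> f x" "\<And>x. f x \<le> real D"
      "strategy_law D q = density unif01 f"
    and w: "\<And>\<phi> C. \<phi> \<in> borel_measurable unif01 \<Longrightarrow> (\<And>x. x \<in> space unif01 \<Longrightarrow> \<bar>\<phi> x\<bar> \<le> C) \<Longrightarrow>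
      win_mean D q \<phi> = (\<integral>x. f x * \<phi> x \<partial>unif01)"
    using strategy_density[OF assms(1)] by blast
  have "integrable unif01 (\<lambda>x. f x * indicator A x)"
    using f(1,2) by (intro unif01.integrable_const_bound[where B="real D"] AE_I2)
      (auto split: split_indicator intro: order_trans)
  then have "(\<integral>\<^sup>+x. ennreal (f x * indicator A x) \<partial>unif01) = ennreal (\<integral>x. f x * indicator A x \<partial>unif01)"
    using f(1) by (intro nn_integral_eq_integral) auto
  moreover have "emeasure (density unif01 f) A = (\<integral>\<^sup>+x. ennreal (f x * indicator A x) \<partial>unif01)"
    by (subst emeasure_density) (auto intro!: nn_integral_cong split: split_indicator)
  ultimately show ?thesis
    using w[of "indicator A" 1] by (simp add: f(3))
qed

lemma win_mean_nonneg:
  assumes "strategy D q" "\<And>x. x \<in> space unif01 \<Longrightarrow> 0 \<le> \<phi> x"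
  shows "0 \<le> win_mean D q \<phi>"
  unfolding win_mean_def using assms(2) strategy_nonneg[OF assms(1)]
  by (intro Bochner_Integration.integral_nonneg sum_nonneg mult_nonneg_nonneg)
    (auto simp: cube_component_in_space)

lemma measure_strategy_law:
  assumes "strategy D q" "A \<in> sets unif01"
  shows "measure (strategy_law D q) A = win_mean D q (indicator A)"
  unfolding measure_def using assms
  by (simp add: emeasure_strategy_law_win_mean win_mean_nonneg)

lemma strategy_law_eqI:
  assumes "strategy D p" "strategy D q"
    and "\<And>A. A \<in> sets unif01 \<Longrightarrow> win_mean D p (indicator A) = win_mean D q (indicator A)"
  shows "strategy_law D p = strategy_law D q"
  using assms by (intro measure_eqI) (simp_all add: emeasure_strategy_law_win_mean)

lemma win_mean_cong_law:
  assumes "strategy D p" "strategy D q" "strategy_law D p = strategy_law D q"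
    and "\<phi> \<in> borel_measurable unif01" "\<And>x. x \<in> space unif01 \<Longrightarrow> \<bar>\<phi> x\<bar> \<le> C"
  shows "win_mean D p \<phi> = win_mean D q \<phi>"
  using win_mean_eq_integral_law[OF assms(1,4,5)] win_mean_eq_integral_law[OF assms(2,4,5)] assms(3)
  by simp

lemma win_mean_convex:
  assumes "strategy D a" "strategy D b"
    and "\<phi> \<in> borel_measurable unif01" "\<And>x. x \<in> space unif01 \<Longrightarrow> \<bar>\<phi> x\<bar> \<le> C"
  shows "win_mean D (\<lambda>k u. (1 - t) * a k u + t * b k u) \<phi> = (1 - t) * win_mean D a \<phi> + t * win_mean D b \<phi>"
proof -
  have "win_mean D (\<lambda>k u. (1 - t) * a k u + t * b k u) \<phi>
      = (\<integral>u. (1 - t) * (\<Sum>k<D. a k u * \<phi> (u k)) + t * (\<Sum>k<D. b k u * \<phi> (u k)) \<partial>cube D)"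
    unfolding win_mean_def
    by (intro Bochner_Integration.integral_cong refl) (simp add: sum_distrib_left sum.distrib algebra_simps flip: sum.distrib)
  then show ?thesis
    using integrable_win[OF assms(1,3,4)] integrable_win[OF assms(2,3,4)] by (simp add: win_mean_def)
qed

section \<open>Extremality forces determinism\<close>

text \<open>Extremality is a property of the law alone, so the conclusion reaches every strategy
  representing it. This freedom is what later perturbations exploit.\<close>

lemma extreme_imp_deterministic:
  assumes ext: "extreme_measure (strategy_law D q) {strategy_law D q | q. strategy D q}"
    and q [simp]: "strategy D q"
  shows "deterministic D q"
proof -
  note [measurable] = strategy_measurable[OF q]
  define m where "m u = (\<Sum>j<D. q j u * u j)" for u
  \<comment> \<open>The tilts used are \<open>\<epsilon> = 1\<close> and
    \<open>\<epsilon> = -1\<close>. Weights stay nonnegative because a coordinate and the mean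
    \<open>m u\<close> differ by at most 1, and the total stays 1 because the deviations from
    \<open>m u\<close> have weighted sum 0.\<close>
  define w where "w \<epsilon> k u = q k u * (1 + \<epsilon> * (u k - m u))" for \<epsilon> k u
  have [measurable]: "m \<in> borel_measurable (cube D)"
    unfolding m_def by measurable
  have m: "\<bar>u k - m u\<bar> \<le> 1" if "u \<in> space (cube D)" "k < D" for u k
  proof -
    have "0 \<le> m u"
      unfolding m_def using that cube_component_space[OF that(1)]
      by (intro sum_nonneg mult_nonneg_nonneg) (auto simp: strategy_nonneg[OF q])
    moreover have "m u \<le> (\<Sum>j<D. q j u * 1)"
      unfolding m_def using that cube_component_space[OF that(1)]
      by (intro sum_mono mult_left_mono) (auto simp: strategy_nonneg[OF q])
    ultimately show ?thesis
      using that strategy_sum[OF q that(1)] cube_component_space[OF that] by auto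
  qed
  have centred: "(\<Sum>k<D. q k u * (u k - m u)) = 0" if "u \<in> space (cube D)" for u
  proof -
    have "(\<Sum>k<D. q k u * (u k - m u)) = m u - (\<Sum>k<D. q k u) * m u"
      unfolding m_def by (simp only: right_diff_distrib sum_subtractf sum_distrib_right)
    then show ?thesis
      using strategy_sum[OF q that] by simp
  qed
  have w: "strategy D (w \<epsilon>)" if "\<epsilon> \<in> {-1, 1}" for \<epsilon>
  proof (rule strategyI)
    show "w \<epsilon> k \<in> borel_measurable (cube D)" if "k < D" for k
      unfolding w_def using that by measurable
    show "0 \<le> w \<epsilon> k u" if "k < D" "u \<in> space (cube D)" for k u
      using m[OF that(2,1)] strategy_nonneg[OF q that] \<open>\<epsilon> \<in> _\<close> by (auto simp: w_def)
    show "(\<Sum>k<D. w \<epsilon> k u) = 1" if "u \<in> space (cube D)" for u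
      using centred[OF that] strategy_sum[OF q that]
      by (simp add: w_def distrib_left sum.distrib mult.left_commute flip: sum_distrib_left)
  qed
  have avg: "(\<lambda>k u. (1 - 1/2) * w 1 k u + (1/2) * w (-1) k u) = q"
    by (simp add: w_def fun_eq_iff algebra_simps)
  have "measure (strategy_law D q) A = (1 - 1/2) * measure (strategy_law D (w 1)) A
      + (1/2) * measure (strategy_law D (w (-1))) A" if "A \<in> sets (strategy_law D q)" for A
    using win_mean_convex[OF w w, of 1 "-1" "indicator A" 1 "1/2"] that
    unfolding avg by (simp add: measure_strategy_law w)
  moreover have "strategy_law D (w 1) \<in> {strategy_law D q | q. strategy D q}"
      "strategy_law D (w (-1)) \<in> {strategy_law D q | q. strategy D q}"
    using w by auto
  ultimately have "strategy_law D (w 1) = strategy_law D (w (-1))"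
    using ext unfolding extreme_measure_def by (elim conjE ballE allE[of _ "1/2"]) auto
  from win_mean_cong_law[OF w w this in_unif01_measurable, of 1]
  have "win_mean D (w 1) (\<lambda>x. x) = win_mean D (w (-1)) (\<lambda>x. x)"
    by (simp add: space_unif01)
  \<comment> \<open>The difference of the two means is twice the expected conditional variance of
    the winning value; centring removes the cross term.\<close>
  moreover have "win_mean D (w 1) (\<lambda>x. x) - win_mean D (w (-1)) (\<lambda>x. x)
      = (\<integral>u. 2 * (\<Sum>k<D. q k u * (u k - m u)\<^sup>2) \<partial>cube D)"
  proof -
    have "win_mean D (w 1) (\<lambda>x. x) - win_mean D (w (-1)) (\<lambda>x. x)
      = (\<integral>u. (\<Sum>k<D. w 1 k u * u k) - (\<Sum>k<D. w (-1) k u * u k) \<partial>cube D)"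
      unfolding win_mean_def using integrable_win[OF w, of 1 "\<lambda>x. x" 1] integrable_win[OF w, of "-1" "\<lambda>x. x" 1] in_unif01_measurable
      by (intro Bochner_Integration.integral_diff[symmetric]) (simp_all add: space_unif01)
    also have "\<dots> = (\<integral>u. 2 * (\<Sum>k<D. q k u * (u k - m u)\<^sup>2) \<partial>cube D)"
    proof (intro Bochner_Integration.integral_cong refl)
      fix u assume u: "u \<in> space (cube D)"
      have "(\<Sum>k<D. w 1 k u * u k) - (\<Sum>k<D. w (-1) k u * u k)
         = (\<Sum>k<D. 2 * (q k u * (u k - m u)\<^sup>2) + 2 * m u * (q k u * (u k - m u)))"
        by (simp add: w_def power2_eq_square algebra_simps flip: sum_subtractf)
      also have "\<dots> = 2 * (\<Sum>k<D. q k u * (u k - m u)\<^sup>2)"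
        using centred[OF u] by (simp add: sum.distrib flip: sum_distrib_left)
      finally show "(\<Sum>k<D. w 1 k u * u k) - (\<Sum>k<D. w (-1) k u * u k) = 2 * (\<Sum>k<D. q k u * (u k - m u)\<^sup>2)" .
    qed
    finally show ?thesis .
  qed
  ultimately have "(\<integral>u. (\<Sum>k<D. q k u * (u k - m u)\<^sup>2) \<partial>cube D) = 0"
    by simp
  moreover have "integrable (cube D) (\<lambda>u. (\<Sum>k<D. q k u * (u k - m u)\<^sup>2))"
  proof (intro Bochner_Integration.integrable_sum cube.integrable_const_bound[where B="1 * 1"] AE_I2)
    fix k u assume k: "k \<in> {..<D}" and u: "u \<in> space (cube D)"
    have "\<bar>u k - m u\<bar>\<^sup>2 \<le> 1"
      using m[OF u, of k] k by (intro power_le_one) auto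
    then show "norm (q k u * (u k - m u)\<^sup>2) \<le> 1 * 1"
      using k u unfolding norm_mult
      by (intro mult_mono) (auto simp: strategy_nonneg[OF q] strategy_le_1[OF q])
  qed simp
  ultimately have "AE u in cube D. (\<Sum>k<D. q k u * (u k - m u)\<^sup>2) = 0"
    by (subst (asm) integral_nonneg_eq_0_iff_AE) (auto intro!: AE_I2 sum_nonneg simp: strategy_nonneg[OF q])
  moreover have "AE u in cube D. \<forall>i<D. \<forall>j<D. i \<noteq> j \<longrightarrow> u i \<noteq> u j"
  proof (rule AE_cube_distinct[OF in_unif01_measurable])
    fix c
    have "{x \<in> space unif01. x = c} = {} \<or> {x \<in> space unif01. x = c} = {c}"
      by auto
    then show "emeasure unif01 {x \<in> space unif01. x = c} = 0"
      using singleton_null_unif01[of c] by (metis emeasure_empty)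
  qed
  ultimately have "AE u in cube D. \<forall>k<D. q k u \<in> {0, 1}"
    using AE_space
  proof eventually_elim
    case (elim u)
    have zero: "q k u * (u k - m u)\<^sup>2 = 0" if "k < D" for k
      using elim(1,3) that by (subst (asm) sum_nonneg_eq_0_iff) (auto simp: strategy_nonneg[OF q])
    show ?case
    proof (intro allI impI)
      fix k assume "k < D"
      have "q k u = 1" if "q k u \<noteq> 0"
      proof -
        \<comment> \<open>Zero variance puts \<open>u k\<close> at \<open>m u\<close>. A second
          label of positive weight would have the same value, contradicting distinctness of the
          coordinates.\<close>
        have "q j u = 0" if "j < D" "j \<noteq> k" for j
          using zero[OF \<open>k < D\<close>] zero[OF that(1)] \<open>q k u \<noteq> 0\<close>
            elim(2)[rule_format, of j k] that \<open>k < D\<close> by auto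
        then have "(\<Sum>j<D. q j u) = q k u"
          using \<open>k < D\<close> by (subst sum.remove[of _ k]) auto
        then show ?thesis
          using strategy_sum[OF q elim(3)] by simp
      qed
      then show "q k u \<in> {0, 1}"
        by auto
    qed
  qed
  then show ?thesis
    unfolding deterministic_def by auto
qed

section \<open>Symmetrisation\<close>

definition permute_cube :: "nat \<Rightarrow> (nat \<Rightarrow> nat) \<Rightarrow> (nat \<Rightarrow> real) \<Rightarrow> nat \<Rightarrow> real" where
  "permute_cube D \<pi> u = (\<lambda>j\<in>{..<D}. u (\<pi> j))"

lemma permutes_lessThan: "\<pi> permutes {..<D} \<Longrightarrow> j < D \<Longrightarrow> \<pi> j < D"
  using permutes_in_image[of \<pi> "{..<D}" j] by simp

lemma permute_cube_measurable:
  assumes "\<pi> permutes {..<D}"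
  shows "permute_cube D \<pi> \<in> measurable (cube D) (cube D)"
  unfolding permute_cube_def [abs_def] cube_def
  by (intro measurable_restrict measurable_component_singleton) (simp add: permutes_lessThan[OF assms])

lemma distr_permute_cube:
  assumes "\<pi> permutes {..<D}"
  shows "distr (cube D) (cube D) (permute_cube D \<pi>) = cube D"
  unfolding cube_def permute_cube_def [abs_def]
  using distr_PiM_reindex[of "{..<D}" "\<lambda>_. unif01" \<pi> "{..<D}"] permutes_inj_on[OF assms]
    permutes_lessThan[OF assms] prob_space_unif01
  by auto

lemma permute_cube_space:
  "\<pi> permutes {..<D} \<Longrightarrow> u \<in> space (cube D) \<Longrightarrow> permute_cube D \<pi> u \<in> space (cube D)"
  using measurable_space[OF permute_cube_measurable] .

text \<open>Permuting acts by precomposition, so the permutation applied last ends up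
  innermost.\<close>

lemma permute_cube_comp:
  assumes "\<rho> permutes {..<D}"
  shows "permute_cube D \<rho> (permute_cube D \<tau> u) = permute_cube D (\<tau> \<circ> \<rho>) u"
  using permutes_lessThan[OF assms] by (auto simp: permute_cube_def fun_eq_iff)

text \<open>The average of \<open>q\<close> over all relabellings of the coordinates. Coordinate
  \<open>k\<close> of \<open>u\<close> sits at position \<open>inv \<pi> k\<close> of
  \<open>permute_cube D \<pi> u\<close>, hence the inverse.\<close>

definition symmetrise :: "nat \<Rightarrow> (nat \<Rightarrow> (nat \<Rightarrow> real) \<Rightarrow> real) \<Rightarrow> nat \<Rightarrow> (nat \<Rightarrow> real) \<Rightarrow> real" where
  "symmetrise D q k u = (\<Sum>\<pi> | \<pi> permutes {..<D}. q (inv \<pi> k) (permute_cube D \<pi> u)) / fact D"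

lemma card_permutes_lessThan: "card {\<pi>. \<pi> permutes {..<D}} = fact D"
  by (rule card_permutations) simp_all

text \<open>Reindexing by \<open>\<pi>\<close>. With constant \<open>\<phi>\<close> it shows that
  relabelled weights still add up to 1, with general \<open>\<phi>\<close> that relabelling leaves
  the winning value unchanged.\<close>

lemma sum_permuted_strategy:
  assumes \<pi>: "\<pi> permutes {..<D}"
  shows "(\<Sum>k<D. q (inv \<pi> k) (permute_cube D \<pi> u) * \<phi> (u k))
    = (\<Sum>k<D. q k (permute_cube D \<pi> u) * \<phi> (permute_cube D \<pi> u k) :: real)"
proof -
  have "(\<Sum>k<D. q (inv \<pi> k) (permute_cube D \<pi> u) * \<phi> (u k))
      = (\<Sum>k<D. q (inv \<pi> (\<pi> k)) (permute_cube D \<pi> u) * \<phi> (u (\<pi> k)))"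
    using sum.permute[OF \<pi>, of "\<lambda>k. q (inv \<pi> k) (permute_cube D \<pi> u) * \<phi> (u k)"] by (simp add: comp_def)
  also have "\<dots> = (\<Sum>k<D. q k (permute_cube D \<pi> u) * \<phi> (permute_cube D \<pi> u k))"
    using permutes_inverses(2)[OF \<pi>] by (intro sum.cong refl) (simp add: permute_cube_def)
  finally show ?thesis .
qed

lemma strategy_symmetrise:
  assumes q: "strategy D q"
  shows "strategy D (symmetrise D q)"
proof (rule strategyI)
  fix k assume k: "k < D"
  have inv: "inv \<pi> k < D" if "\<pi> permutes {..<D}" for \<pi>
    using permutes_lessThan[OF permutes_inv[OF that] k] .
  show "symmetrise D q k \<in> borel_measurable (cube D)"
    unfolding symmetrise_def [abs_def]
    by (intro borel_measurable_divide borel_measurable_sum borel_measurable_const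
        measurable_compose[OF permute_cube_measurable strategy_measurable[OF q]]) (auto simp: inv)
  show "0 \<le> symmetrise D q k u" if "u \<in> space (cube D)" for u
    unfolding symmetrise_def
    by (intro divide_nonneg_nonneg sum_nonneg strategy_nonneg[OF q]) (auto simp: inv permute_cube_space that)
next
  fix u assume u: "u \<in> space (cube D)"
  have "(\<Sum>k<D. symmetrise D q k u)
      = (\<Sum>\<pi> | \<pi> permutes {..<D}. \<Sum>k<D. q (inv \<pi> k) (permute_cube D \<pi> u)) / fact D"
    unfolding symmetrise_def sum_divide_distrib[symmetric] by (subst sum.swap) simp
  also have "(\<Sum>\<pi> | \<pi> permutes {..<D}. \<Sum>k<D. q (inv \<pi> k) (permute_cube D \<pi> u))
      = (\<Sum>\<pi> | \<pi> permutes {..<D}. 1)"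
  proof (intro sum.cong refl)
    fix \<pi> assume "\<pi> \<in> {\<pi>. \<pi> permutes {..<D}}"
    then show "(\<Sum>k<D. q (inv \<pi> k) (permute_cube D \<pi> u)) = 1"
      using sum_permuted_strategy[of \<pi> D q u "\<lambda>_. 1"] strategy_sum[OF q permute_cube_space[OF _ u]] by simp
  qed
  finally show "(\<Sum>k<D. symmetrise D q k u) = 1"
    using card_permutes_lessThan[of D] by simp
qed

text \<open>Left multiplication by \<open>\<tau>\<close> is a bijection of the permutation group, so
  the average absorbs it.\<close>

lemma symmetrise_equivariant:
  assumes \<tau>: "\<tau> permutes {..<D}"
  shows "symmetrise D q k (permute_cube D \<tau> u) = symmetrise D q (\<tau> k) u"
proof -
  have "(\<Sum>\<pi> | \<pi> permutes {..<D}. q (inv \<pi> k) (permute_cube D \<pi> (permute_cube D \<tau> u)))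
      = (\<Sum>\<pi> | \<pi> permutes {..<D}. q (inv (\<tau> \<circ> \<pi>) (\<tau> k)) (permute_cube D (\<tau> \<circ> \<pi>) u))"
  proof (intro sum.cong refl)
    fix \<pi> assume "\<pi> \<in> {\<pi>. \<pi> permutes {..<D}}"
    then have \<pi>: "\<pi> permutes {..<D}"
      by simp
    have "inv (\<tau> \<circ> \<pi>) (\<tau> k) = inv \<pi> k"
      using o_inv_distrib[OF permutes_bij[OF \<tau>] permutes_bij[OF \<pi>]] permutes_inverses(2)[OF \<tau>] by simp
    then show "q (inv \<pi> k) (permute_cube D \<pi> (permute_cube D \<tau> u))
        = q (inv (\<tau> \<circ> \<pi>) (\<tau> k)) (permute_cube D (\<tau> \<circ> \<pi>) u)"
      by (simp add: permute_cube_comp[OF \<pi>])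
  qed
  also have "\<dots> = (\<Sum>\<pi> | \<pi> permutes {..<D}. q (inv \<pi> (\<tau> k)) (permute_cube D \<pi> u))"
    by (rule setum_permutations_compose_left[OF \<tau>, symmetric])
  finally show ?thesis
    by (simp add: symmetrise_def)
qed

text \<open>The cyclic shift that occurs in the second clause of consistency, continued by the
  identity outside \<open>{..<D}\<close> because \<open>permutes\<close> demands it.\<close>

definition rotation :: "nat \<Rightarrow> nat \<Rightarrow> nat \<Rightarrow> nat" where
  "rotation D k j = (if j < D then (k + j) mod D else j)"

lemma rotation_permutes: "rotation D k permutes {..<D}"
proof (rule bij_imp_permutes)
  \<comment> \<open>Ordering the indices keeps subtraction of natural numbers exact. The difference
    is a multiple of \<open>D\<close> smaller than \<open>D\<close>, hence 0.\<close>
  have eq: "i = j" if "i \<le> j" "j < D" "(k + i) mod D = (k + j) mod D" for i j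
  proof -
    have "D dvd (k + j) - (k + i)"
      using that by (subst mod_eq_dvd_iff_nat[symmetric]) auto
    then show ?thesis
      using that by (auto dest: dvd_imp_le)
  qed
  have "inj_on (rotation D k) {..<D}"
  proof (rule inj_onI)
    fix i j assume "i \<in> {..<D}" "j \<in> {..<D}" "rotation D k i = rotation D k j"
    then show "i = j"
      using eq[of i j] eq[of j i] by (cases "i \<le> j") (simp_all add: rotation_def)
  qed
  moreover have "rotation D k ` {..<D} \<subseteq> {..<D}"
    by (auto simp: rotation_def)
  ultimately show "bij_betw (rotation D k) {..<D} {..<D}"
    using endo_inj_surj[of "{..<D}" "rotation D k"] by (simp add: bij_betw_def)
qed (simp add: rotation_def)

text \<open>Equivariance under all permutations contains both clauses: permutations fixing
  \<open>i\<close> give the first, and the rotation that sends 0 to \<open>k\<close> gives the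
  second.\<close>

lemma consistentI:
  assumes "\<And>k u \<tau>. k < D \<Longrightarrow> u \<in> space (cube D) \<Longrightarrow> \<tau> permutes {..<D} \<Longrightarrow> q k (permute_cube D \<tau> u) = q (\<tau> k) u"
  shows "consistent D q"
  unfolding consistent_def
proof (intro conjI allI ballI impI)
  fix i u \<pi> assume "i < D" "u \<in> space (cube D)" "\<pi> permutes {..<D} \<and> \<pi> i = i"
  then show "q i u = q i (\<lambda>j\<in>{..<D}. u (\<pi> j))"
    using assms[of i u \<pi>] by (simp add: permute_cube_def)
next
  fix k u assume k: "k < D" and u: "u \<in> space (cube D)"
  have "permute_cube D (rotation D k) u = (\<lambda>j\<in>{..<D}. u ((k + j) mod D))"
    by (auto simp: permute_cube_def rotation_def)
  then show "q k u = q 0 (\<lambda>j\<in>{..<D}. u ((k + j) mod D))"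
    using assms[OF _ u rotation_permutes, of 0 k] k by (simp add: rotation_def)
qed

text \<open>The cube measure is invariant under permuting coordinates, so all terms of the average
  have the same expectation.\<close>

lemma win_mean_symmetrise:
  assumes q: "strategy D q" and \<phi>: "\<phi> \<in> borel_measurable unif01" "\<And>x. x \<in> space unif01 \<Longrightarrow> \<bar>\<phi> x\<bar> \<le> C"
  shows "win_mean D (symmetrise D q) \<phi> = win_mean D q \<phi>"
proof -
  let ?h = "\<lambda>u. \<Sum>k<D. q k u * \<phi> (u k)"
  have int: "integrable (cube D) ?h"
    by (rule integrable_win[OF q \<phi>])
  have int': "integrable (cube D) (\<lambda>u. ?h (permute_cube D \<pi> u))"
    and eq: "(\<integral>u. ?h (permute_cube D \<pi> u) \<partial>cube D) = (\<integral>u. ?h u \<partial>cube D)" if "\<pi> permutes {..<D}" for \<pi>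
  proof -
    show "integrable (cube D) (\<lambda>u. ?h (permute_cube D \<pi> u))"
      using integrable_distr[OF permute_cube_measurable[OF that], of ?h] distr_permute_cube[OF that] int by simp
    show "(\<integral>u. ?h (permute_cube D \<pi> u) \<partial>cube D) = (\<integral>u. ?h u \<partial>cube D)"
      using integral_distr[OF permute_cube_measurable[OF that], of ?h] distr_permute_cube[OF that] int by simp
  qed
  have "(\<Sum>k<D. symmetrise D q k u * \<phi> (u k))
      = (\<Sum>\<pi> | \<pi> permutes {..<D}. ?h (permute_cube D \<pi> u)) / fact D" for u
  proof -
    have "(\<Sum>k<D. symmetrise D q k u * \<phi> (u k))
        = (\<Sum>\<pi> | \<pi> permutes {..<D}. \<Sum>k<D. q (inv \<pi> k) (permute_cube D \<pi> u) * \<phi> (u k)) / fact D"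
      unfolding symmetrise_def sum_divide_distrib[symmetric] times_divide_eq_left sum_distrib_right
      by (subst sum.swap) simp
    then show ?thesis
      by (simp add: sum_permuted_strategy)
  qed
  then have "win_mean D (symmetrise D q) \<phi>
      = (\<integral>u. (\<Sum>\<pi> | \<pi> permutes {..<D}. ?h (permute_cube D \<pi> u)) / fact D \<partial>cube D)"
    by (simp add: win_mean_def)
  also have "\<dots> = (\<Sum>\<pi> | \<pi> permutes {..<D}. (\<integral>u. ?h (permute_cube D \<pi> u) \<partial>cube D)) / fact D"
    using int' by (subst Bochner_Integration.integral_sum[symmetric]) auto
  also have "\<dots> = win_mean D q \<phi>"
    by (simp add: eq card_permutes_lessThan win_mean_def)
  finally show ?thesis .
qed

section \<open>Determinism forces extremality\<close>

text \<open>The endpoints 0 and 1 are extreme in \<open>[0,1]\<close>: a proper mixture of two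
  weights can reach one of them only if both weights do.\<close>

lemma deterministic_convex_eq:
  assumes a: "strategy D a" and b: "strategy D b" and t: "0 < t" "t < 1"
    and det: "deterministic D (\<lambda>k u. (1 - t) * a k u + t * b k u)" and k: "k < D"
  shows "AE u in cube D. a k u = b k u"
proof -
  have "AE u in cube D. (1 - t) * a k u + t * b k u \<in> {0, 1}"
    using det k by (simp add: deterministic_def)
  then show ?thesis
    using AE_space
  proof eventually_elim
    case (elim u)
    note ab = strategy_nonneg[OF a k elim(2)] strategy_le_1[OF a k elim(2)]
      strategy_nonneg[OF b k elim(2)] strategy_le_1[OF b k elim(2)]
    have pos: "0 \<le> (1 - t) * a k u" "0 \<le> t * b k u" "0 \<le> (1 - t) * (1 - a k u)" "0 \<le> t * (1 - b k u)"
      using ab t by simp_all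
    consider "(1 - t) * a k u + t * b k u = 0" | "(1 - t) * (1 - a k u) + t * (1 - b k u) = 0"
      using elim(1) by (auto simp: algebra_simps)
    then show ?case
    proof cases
      case 1
      then have "(1 - t) * a k u = 0" "t * b k u = 0"
        using pos by linarith+
      then show ?thesis
        using t by simp
    next
      case 2
      then have "(1 - t) * (1 - a k u) = 0" "t * (1 - b k u) = 0"
        using pos by linarith+
      then show ?thesis
        using t by simp
    qed
  qed
qed

lemma win_mean_cong_AE:
  assumes a: "strategy D a" and b: "strategy D b" and \<phi>: "\<phi> \<in> borel_measurable unif01"
    and AE: "\<And>k. k < D \<Longrightarrow> AE u in cube D. a k u = b k u"
  shows "win_mean D a \<phi> = win_mean D b \<phi>"
proof -
  have "AE u in cube D. \<forall>k\<in>{..<D}. a k u = b k u"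
    using AE by (intro AE_finite_allI) auto
  moreover have "(\<lambda>u. \<Sum>k<D. q k u * \<phi> (u k)) \<in> borel_measurable (cube D)" if "strategy D q" for q
    using strategy_measurable[OF that] measurable_compose[OF cube_component_measurable \<phi>]
    by (intro borel_measurable_sum borel_measurable_times) auto
  ultimately show ?thesis
    unfolding win_mean_def using a b by (intro integral_cong_AE) (auto elim!: eventually_mono)
qed

lemma consistent_deterministic_imp_extreme:
  assumes p: "strategy D p"
    and det: "\<And>q. strategy D q \<Longrightarrow> consistent D q \<Longrightarrow> strategy_law D q = strategy_law D p \<Longrightarrow> deterministic D q"
  shows "extreme_measure (strategy_law D p) {strategy_law D q | q. strategy D q}"
  unfolding extreme_measure_def
proof (intro conjI ballI allI impI)
  show "strategy_law D p \<in> {strategy_law D q | q. strategy D q}"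
    using p by blast
next
  fix \<alpha> \<beta> t
  assume "\<alpha> \<in> {strategy_law D q | q. strategy D q}" "\<beta> \<in> {strategy_law D q | q. strategy D q}"
  then obtain a b where a: "strategy D a" "\<alpha> = strategy_law D a" and b: "strategy D b" "\<beta> = strategy_law D b"
    by blast
  assume t: "0 < t \<and> t < 1 \<and> (\<forall>A\<in>sets (strategy_law D p).
    measure (strategy_law D p) A = (1 - t) * measure \<alpha> A + t * measure \<beta> A)"
  \<comment> \<open>Symmetrising the two components before mixing makes \<open>?c\<close> consistent
    and, at the same time, an explicit mixture whose determinism can be split.\<close>
  let ?a = "symmetrise D a" and ?b = "symmetrise D b"
  let ?c = "\<lambda>k u. (1 - t) * ?a k u + t * ?b k u"
  note sa = strategy_symmetrise[OF a(1)] and sb = strategy_symmetrise[OF b(1)]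
  have c: "strategy D ?c"
  proof (rule strategyI)
    show "(\<lambda>u. ?c k u) \<in> borel_measurable (cube D)" if "k < D" for k
      using strategy_measurable[OF sa that] strategy_measurable[OF sb that] by simp
    show "0 \<le> ?c k u" if "k < D" "u \<in> space (cube D)" for k u
      using strategy_nonneg[OF sa that] strategy_nonneg[OF sb that] t by simp
    show "(\<Sum>k<D. ?c k u) = 1" if "u \<in> space (cube D)" for u
      using strategy_sum[OF sa that] strategy_sum[OF sb that] by (simp add: sum.distrib flip: sum_distrib_left)
  qed
  moreover have "consistent D ?c"
    by (rule consistentI) (simp add: symmetrise_equivariant)
  moreover have "strategy_law D ?c = strategy_law D p"
  proof (rule strategy_law_eqI[OF c p])
    fix A assume A: "A \<in> sets unif01"
    have ind: "(indicator A :: real \<Rightarrow> real) \<in> borel_measurable unif01" "\<And>x. \<bar>indicator A x :: real\<bar> \<le> 1"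
      using A by (auto split: split_indicator)
    have "win_mean D ?c (indicator A) = (1 - t) * win_mean D a (indicator A) + t * win_mean D b (indicator A)"
      using win_mean_convex[OF sa sb ind] win_mean_symmetrise[OF a(1) ind] win_mean_symmetrise[OF b(1) ind] by simp
    also have "\<dots> = win_mean D p (indicator A)"
      using t A by (simp add: measure_strategy_law a b p)
    finally show "win_mean D ?c (indicator A) = win_mean D p (indicator A)" .
  qed
  ultimately have "deterministic D ?c"
    by (rule det)
  then have AE: "AE u in cube D. ?a k u = ?b k u" if "k < D" for k
    using deterministic_convex_eq[OF sa sb _ _ _ that, of t] t by simp
  \<comment> \<open>The symmetrised strategies agree almost everywhere, and symmetrising changed
    neither law, so the original laws agree although \<open>a\<close> and \<open>b\<close>
    themselves may differ.\<close>
  have "win_mean D a (indicator A) = win_mean D b (indicator A)" if A: "A \<in> sets unif01" for A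
  proof -
    have ind: "(indicator A :: real \<Rightarrow> real) \<in> borel_measurable unif01" "\<And>x. \<bar>indicator A x :: real\<bar> \<le> 1"
      using A by (auto split: split_indicator)
    show ?thesis
      using win_mean_cong_AE[OF sa sb ind(1) AE] win_mean_symmetrise[OF a(1) ind] win_mean_symmetrise[OF b(1) ind]
      by simp
  qed
  then show "\<alpha> = \<beta>"
    unfolding a b by (rule strategy_law_eqI[OF a(1) b(1)])
qed

section \<open>Law-preserving perturbations\<close>

lemma cube_update_space:
  "u \<in> space (cube D) \<Longrightarrow> y \<in> space unif01 \<Longrightarrow> i < D \<Longrightarrow> u(i := y) \<in> space (cube D)"
  using measurable_space[OF cube_update_measurable, of i D "(u, y)"] by (simp add: space_pair_measure)

lemma integral_resample:
  fixes g :: "(nat \<Rightarrow> real) \<times> real \<Rightarrow> real"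
  assumes "i < D" "g \<in> borel_measurable (cube D \<Otimes>\<^sub>M unif01)"
  shows "(\<integral>z. g (resample i z) \<partial>(cube D \<Otimes>\<^sub>M unif01)) = (\<integral>z. g z \<partial>(cube D \<Otimes>\<^sub>M unif01))"
  using integral_distr[OF resample_measurable[OF assms(1)] assms(2)] distr_resample[OF assms(1)] by simp

text \<open>The rate \<open>\<kappa>\<close> is symmetric so that resampling is reversible with
  respect to the uniform measure. The rate \<open>s\<close> is directed, from the winner to the one
  who takes over.\<close>

locale perturbation =
  fixes D :: nat and q :: "nat \<Rightarrow> (nat \<Rightarrow> real) \<Rightarrow> real" and \<kappa> s :: "real \<Rightarrow> real \<Rightarrow> real"
  assumes D: "0 < D" and q: "strategy D q"
    and \<kappa>_measurable: "(\<lambda>z. \<kappa> (fst z) (snd z)) \<in> borel_measurable (unif01 \<Otimes>\<^sub>M unif01)"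
    and \<kappa>: "\<And>x y. 0 \<le> \<kappa> x y" "\<And>x y. \<kappa> x y \<le> 1" and \<kappa>_sym: "\<And>x y. \<kappa> x y = \<kappa> y x"
    and s_measurable: "(\<lambda>z. s (fst z) (snd z)) \<in> borel_measurable (unif01 \<Otimes>\<^sub>M unif01)"
    and s: "\<And>x y. 0 \<le> s x y" "\<And>x y. s x y \<le> 1"
begin

text \<open>
  \<open>mix\<close> is the first order effect of resampling each coordinate \<open>x\<close> to \<open>y\<close> at rate \<open>\<kappa> x y\<close>; \<open>pass\<close> is that of
  a winner with value \<open>x\<close> handing over to a coordinate with value \<open>y\<close> at rate \<open>s x y\<close>.
\<close>

definition mix :: "nat \<Rightarrow> (nat \<Rightarrow> real) \<Rightarrow> real" where
  "mix k u = (\<Sum>i<D. \<integral>y. \<kappa> (u i) y * (q k (u(i := y)) - q k u) \<partial>unif01)"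

definition pass :: "nat \<Rightarrow> (nat \<Rightarrow> real) \<Rightarrow> real" where
  "pass k u = (\<Sum>j<D. q j u * s (u j) (u k) - q k u * s (u k) (u j))"

text \<open>Both \<open>mix k u\<close> and \<open>pass k u\<close> are at least
  \<open>- (real D * q k u)\<close>. Dividing by \<open>4 * real D\<close> thus leaves at least half
  of \<open>q k u\<close>: weights stay nonnegative, and positive ones stay positive.\<close>

definition perturbed :: "nat \<Rightarrow> (nat \<Rightarrow> real) \<Rightarrow> real" where
  "perturbed k u = q k u + (mix k u + pass k u) / (4 * real D)"

lemma \<kappa>_pair_measurable:
  assumes "f \<in> measurable M unif01" "g \<in> measurable M unif01"
  shows "(\<lambda>z. \<kappa> (f z) (g z)) \<in> borel_measurable M"
  using measurable_compose[OF measurable_Pair[OF assms] \<kappa>_measurable] by simp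

lemma s_pair_measurable:
  assumes "f \<in> measurable M unif01" "g \<in> measurable M unif01"
  shows "(\<lambda>z. s (f z) (g z)) \<in> borel_measurable M"
  using measurable_compose[OF measurable_Pair[OF assms] s_measurable] by simp

lemma \<kappa>_coord_measurable:
  "i < D \<Longrightarrow> (\<lambda>z. \<kappa> (fst z i) (snd z)) \<in> borel_measurable (cube D \<Otimes>\<^sub>M unif01)"
  by (intro \<kappa>_pair_measurable fst_component_measurable measurable_snd)

lemma q_fst_measurable: "k < D \<Longrightarrow> (\<lambda>z. q k (fst z)) \<in> borel_measurable (cube D \<Otimes>\<^sub>M unif01)"
  using measurable_compose[OF measurable_fst strategy_measurable[OF q]] .

lemma q_update_measurable:
  "k < D \<Longrightarrow> i < D \<Longrightarrow> (\<lambda>z. q k ((fst z)(i := snd z))) \<in> borel_measurable (cube D \<Otimes>\<^sub>M unif01)"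
  using measurable_compose[OF cube_update_measurable strategy_measurable[OF q]] .

lemma mix_term_measurable:
  assumes "k < D" "i < D"
  shows "(\<lambda>z. \<kappa> (fst z i) (snd z) * (q k ((fst z)(i := snd z)) - q k (fst z))) \<in> borel_measurable (cube D \<Otimes>\<^sub>M unif01)"
  using assms by (intro borel_measurable_times borel_measurable_diff \<kappa>_coord_measurable q_fst_measurable q_update_measurable)

lemma mix_measurable: "k < D \<Longrightarrow> mix k \<in> borel_measurable (cube D)"
  unfolding mix_def [abs_def]
  by (intro borel_measurable_sum unif01.borel_measurable_lebesgue_integral)
    (use mix_term_measurable in \<open>simp add: split_beta'\<close>)

lemma pass_measurable: "k < D \<Longrightarrow> pass k \<in> borel_measurable (cube D)"
  unfolding pass_def [abs_def]
  by (intro borel_measurable_sum borel_measurable_diff borel_measurable_times s_pair_measurable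
      cube_component_measurable strategy_measurable[OF q]) auto

lemma integrable_mix_term:
  assumes u: "u \<in> space (cube D)" and "k < D" "i < D"
  shows "integrable unif01 (\<lambda>y. \<kappa> (u i) y * (q k (u(i := y)) - q k u))"
proof (rule unif01.integrable_const_bound)
  show "AE y in unif01. norm (\<kappa> (u i) y * (q k (u(i := y)) - q k u)) \<le> 1"
  proof (rule AE_I2)
    fix y assume "y \<in> space unif01"
    then have "\<bar>q k (u(i := y)) - q k u\<bar> \<le> 1"
      using strategy_nonneg[OF q \<open>k < D\<close>] strategy_le_1[OF q \<open>k < D\<close>] u cube_update_space[OF u _ \<open>i < D\<close>]
      by (smt (verit))
    then show "norm (\<kappa> (u i) y * (q k (u(i := y)) - q k u)) \<le> 1"
      using \<kappa>[of "u i" y] by (simp add: abs_mult mult_le_one)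
  qed
  show "(\<lambda>y. \<kappa> (u i) y * (q k (u(i := y)) - q k u)) \<in> borel_measurable unif01"
    using measurable_compose[OF measurable_Pair1'[OF u] mix_term_measurable[OF assms(2,3)]] by simp
qed

text \<open>A rate in \<open>[0,1]\<close> moves a weight only part of the way towards another
  weight in \<open>[0,1]\<close>. The bounds are relative to \<open>q k u\<close>, so a weight of 0
  cannot decrease and a weight of 1 cannot increase.\<close>

lemma mix_term_bounds:
  assumes u: "u \<in> space (cube D)" and k: "k < D" and i: "i < D"
  shows "- q k u \<le> (\<integral>y. \<kappa> (u i) y * (q k (u(i := y)) - q k u) \<partial>unif01)"
    and "(\<integral>y. \<kappa> (u i) y * (q k (u(i := y)) - q k u) \<partial>unif01) \<le> 1 - q k u"
proof -
  have "- q k u \<le> \<kappa> (u i) y * (q k (u(i := y)) - q k u)"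
      "\<kappa> (u i) y * (q k (u(i := y)) - q k u) \<le> 1 - q k u" if y: "y \<in> space unif01" for y
  proof -
    note b = strategy_nonneg[OF q k u] strategy_le_1[OF q k u]
      strategy_nonneg[OF q k cube_update_space[OF u y i]] strategy_le_1[OF q k cube_update_space[OF u y i]]
    have "\<kappa> (u i) y * q k u \<le> 1 * q k u" "\<kappa> (u i) y * (1 - q k u) \<le> 1 * (1 - q k u)"
        "0 \<le> \<kappa> (u i) y * q k (u(i := y))" "\<kappa> (u i) y * q k (u(i := y)) \<le> \<kappa> (u i) y * 1"
      using \<kappa>[of "u i" y] b by (intro mult_right_mono mult_left_mono mult_nonneg_nonneg; simp)+
    then show "- q k u \<le> \<kappa> (u i) y * (q k (u(i := y)) - q k u)"
        "\<kappa> (u i) y * (q k (u(i := y)) - q k u) \<le> 1 - q k u"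
      by (simp_all add: algebra_simps)
  qed
  then show "- q k u \<le> (\<integral>y. \<kappa> (u i) y * (q k (u(i := y)) - q k u) \<partial>unif01)"
      "(\<integral>y. \<kappa> (u i) y * (q k (u(i := y)) - q k u) \<partial>unif01) \<le> 1 - q k u"
    by (auto intro!: unif01.integral_ge_const unif01.integral_le_const integrable_mix_term assms AE_I2)
qed

lemma mix_bounds:
  assumes "u \<in> space (cube D)" "k < D"
  shows "- (real D * q k u) \<le> mix k u" "mix k u \<le> real D * (1 - q k u)"
  using sum_bounded_below[of "{..<D}" "- q k u" "\<lambda>i. \<integral>y. \<kappa> (u i) y * (q k (u(i := y)) - q k u) \<partial>unif01"]
    sum_bounded_above[of "{..<D}" "\<lambda>i. \<integral>y. \<kappa> (u i) y * (q k (u(i := y)) - q k u) \<partial>unif01" "1 - q k u"]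
    mix_term_bounds[OF assms]
  by (simp_all add: mix_def)

lemma pass_bounds:
  assumes u: "u \<in> space (cube D)" and k: "k < D"
  shows "- (real D * q k u) \<le> pass k u" "pass k u \<le> real D"
proof -
  have "- q k u \<le> q j u * s (u j) (u k) - q k u * s (u k) (u j)"
      "q j u * s (u j) (u k) - q k u * s (u k) (u j) \<le> 1" if j: "j < D" for j
  proof -
    have "0 \<le> q j u * s (u j) (u k)" "0 \<le> q k u * s (u k) (u j)"
      using strategy_nonneg[OF q _ u] k j s by simp_all
    moreover have "q j u * s (u j) (u k) \<le> 1 * 1" "q k u * s (u k) (u j) \<le> q k u * 1"
      using strategy_nonneg[OF q _ u] strategy_le_1[OF q _ u] k j s by (intro mult_mono mult_left_mono; simp)+
    ultimately show "- q k u \<le> q j u * s (u j) (u k) - q k u * s (u k) (u j)"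
        "q j u * s (u j) (u k) - q k u * s (u k) (u j) \<le> 1"
      by simp_all
  qed
  then show "- (real D * q k u) \<le> pass k u" "pass k u \<le> real D"
    using sum_bounded_below[of "{..<D}" "- q k u" "\<lambda>j. q j u * s (u j) (u k) - q k u * s (u k) (u j)"]
      sum_bounded_above[of "{..<D}" "\<lambda>j. q j u * s (u j) (u k) - q k u * s (u k) (u j)" 1]
    by (simp_all add: pass_def)
qed

lemma perturbed_ge:
  assumes "u \<in> space (cube D)" "k < D"
  shows "q k u / 2 \<le> perturbed k u"
  using mix_bounds[OF assms] pass_bounds[OF assms] D by (simp add: perturbed_def field_simps)

lemma sum_mix:
  assumes u: "u \<in> space (cube D)"
  shows "(\<Sum>k<D. mix k u) = 0"
proof -
  have "(\<Sum>k<D. mix k u) = (\<Sum>i<D. \<integral>y. (\<Sum>k<D. \<kappa> (u i) y * (q k (u(i := y)) - q k u)) \<partial>unif01)"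
    unfolding mix_def by (subst sum.swap) (simp add: Bochner_Integration.integral_sum integrable_mix_term[OF u])
  also have "\<dots> = (\<Sum>i<D. \<integral>y. 0 \<partial>unif01)"
    by (intro sum.cong refl Bochner_Integration.integral_cong)
      (simp add: strategy_sum[OF q] u cube_update_space sum_subtractf flip: sum_distrib_left)
  finally show ?thesis
    by simp
qed

lemma sum_pass: "(\<Sum>k<D. pass k u) = 0"
  unfolding pass_def sum_subtractf by (subst sum.swap) simp

lemma strategy_perturbed: "strategy D perturbed"
proof (rule strategyI)
  show "perturbed k \<in> borel_measurable (cube D)" if "k < D" for k
    unfolding perturbed_def [abs_def] using mix_measurable pass_measurable strategy_measurable[OF q] that
    by (intro borel_measurable_add borel_measurable_divide borel_measurable_const) auto
  show "0 \<le> perturbed k u" if "k < D" "u \<in> space (cube D)" for k u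
    using perturbed_ge[OF that(2,1)] strategy_nonneg[OF q that] by simp
  show "(\<Sum>k<D. perturbed k u) = 1" if "u \<in> space (cube D)" for u
    using sum_mix[OF that] sum_pass[of u] strategy_sum[OF q that]
    by (simp add: perturbed_def sum.distrib flip: sum_divide_distrib)
qed

text \<open>A sure winner can only lose: mixing cannot raise a weight of 1, and handing over to
  \<open>j\<close> costs \<open>s (u k) (u j)\<close>. As the perturbed weight is also at least 1/2,
  a positive rate \<open>s\<close> makes it properly random.\<close>

lemma perturbed_le:
  assumes u: "u \<in> space (cube D)" and k: "k < D" and j: "j < D" "j \<noteq> k" and "q k u = 1"
  shows "perturbed k u \<le> 1 - s (u k) (u j) / (4 * real D)"
proof -
  have zero: "q l u = 0" if l: "l < D" "l \<noteq> k" for l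
  proof -
    have "(\<Sum>l\<in>{..<D} - {k}. q l u) = 0"
      using strategy_sum[OF q u] k \<open>q k u = 1\<close> by (subst (asm) sum.remove[of _ k]) auto
    then show ?thesis
      using strategy_nonneg[OF q _ u] l by (subst (asm) sum_nonneg_eq_0_iff) auto
  qed
  have "pass k u = (\<Sum>l\<in>{..<D} - {k}. - s (u k) (u l))"
    unfolding pass_def using k zero \<open>q k u = 1\<close> by (subst sum.remove[of _ k]) (auto intro!: sum.cong)
  also have "\<dots> = - s (u k) (u j) + (\<Sum>l\<in>{..<D} - {k} - {j}. - s (u k) (u l))"
    using j by (subst sum.remove[of _ j]) auto
  also have "\<dots> \<le> - s (u k) (u j) + 0"
    using s by (intro add_left_mono sum_nonpos) auto
  finally have "pass k u \<le> - s (u k) (u j)"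
    by simp
  moreover have "mix k u \<le> 0"
    using mix_bounds(2)[OF u k] \<open>q k u = 1\<close> by simp
  ultimately have "(mix k u + pass k u) / (4 * real D) \<le> - s (u k) (u j) / (4 * real D)"
    by (intro divide_right_mono) auto
  then show ?thesis
    using \<open>q k u = 1\<close> by (simp add: perturbed_def)
qed

lemma bounded_times_integrable:
  fixes \<phi> :: "real \<Rightarrow> real"
  assumes "\<phi> \<in> borel_measurable unif01" "\<And>x. x \<in> space unif01 \<Longrightarrow> \<bar>\<phi> x\<bar> \<le> C" and k: "k < D"
    and "g \<in> borel_measurable (cube D)" "\<And>u. u \<in> space (cube D) \<Longrightarrow> \<bar>g u\<bar> \<le> B"
  shows "integrable (cube D) (\<lambda>u. g u * \<phi> (u k))"
proof (rule cube.integrable_const_bound)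
  show "AE u in cube D. norm (g u * \<phi> (u k)) \<le> B * C"
    using assms by (intro AE_I2) (auto simp: abs_mult cube_component_in_space
      intro!: mult_mono order_trans[OF abs_ge_zero])
  show "(\<lambda>u. g u * \<phi> (u k)) \<in> borel_measurable (cube D)"
    using assms measurable_compose[OF cube_component_measurable assms(1)] by (intro borel_measurable_times) auto
qed

text \<open>
  Resampling coordinate \<open>i\<close> is measure preserving, so by symmetry of \<open>\<kappa>\<close> it only
  affects the law of the winning value when \<open>i\<close> itself wins.
\<close>

lemma win_mean_mix:
  assumes \<phi>: "\<phi> \<in> borel_measurable unif01" "\<And>x. x \<in> space unif01 \<Longrightarrow> \<bar>\<phi> x\<bar> \<le> C"
  shows "win_mean D mix \<phi> = win_mean D q (\<lambda>x. \<integral>y. \<kappa> x y * (\<phi> y - \<phi> x) \<partial>unif01)"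
proof -
  let ?N = "cube D \<Otimes>\<^sub>M unif01"
  have C: "0 \<le> C"
    using \<phi>(2)[of 0] by (auto simp: space_unif01 intro: order_trans[OF abs_ge_zero])
  have \<phi>_meas: "(\<lambda>z. \<phi> (fst z k)) \<in> borel_measurable ?N"
      "(\<lambda>z. \<phi> (((fst z)(i := snd z)) k)) \<in> borel_measurable ?N" if "k < D" "i < D" for k i
    using measurable_compose[OF fst_component_measurable \<phi>(1)]
      measurable_compose[OF measurable_compose[OF cube_update_measurable cube_component_measurable] \<phi>(1)] that
    by auto
  have int: "integrable ?N (\<lambda>z. \<kappa> (fst z i) (snd z) * g z * h z)"
    if "i < D" "g \<in> borel_measurable ?N" "h \<in> borel_measurable ?N"
      "\<And>z. z \<in> space ?N \<Longrightarrow> 0 \<le> g z \<and> g z \<le> 1" "\<And>z. z \<in> space ?N \<Longrightarrow> \<bar>h z\<bar> \<le> C" for g h i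
  proof (rule cube_pair.P.integrable_const_bound)
    have "\<bar>\<kappa> (fst z i) (snd z) * g z\<bar> * \<bar>h z\<bar> \<le> 1 * C" if z: "z \<in> space ?N" for z
      using that(1) \<kappa>[of "fst z i" "snd z"] \<open>\<And>z. z \<in> space ?N \<Longrightarrow> 0 \<le> g z \<and> g z \<le> 1\<close>[OF z]
        \<open>\<And>z. z \<in> space ?N \<Longrightarrow> \<bar>h z\<bar> \<le> C\<close>[OF z] C
      by (intro mult_mono) (auto simp: abs_mult mult_le_one)
    then show "AE z in ?N. norm (\<kappa> (fst z i) (snd z) * g z * h z) \<le> C"
      by (intro AE_I2) (simp add: abs_mult)
    show "(\<lambda>z. \<kappa> (fst z i) (snd z) * g z * h z) \<in> borel_measurable ?N"
      using that by (intro borel_measurable_times \<kappa>_coord_measurable) auto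
  qed
  have sp: "fst z \<in> space (cube D)" "snd z \<in> space unif01" if "z \<in> space ?N" for z
    using that by (auto simp: space_pair_measure)
  have q_bd: "0 \<le> q k (fst z) \<and> q k (fst z) \<le> 1"
      "0 \<le> q k ((fst z)(i := snd z)) \<and> q k ((fst z)(i := snd z)) \<le> 1"
      "\<bar>\<phi> (fst z k)\<bar> \<le> C" "\<bar>\<phi> (((fst z)(i := snd z)) k)\<bar> \<le> C"
    if "k < D" "i < D" "z \<in> space ?N" for k i z
    using that strategy_nonneg[OF q that(1)] strategy_le_1[OF q that(1)] sp[OF that(3)]
      cube_update_space[OF sp[OF that(3)] that(2)] \<phi>(2) cube_component_in_space by blast+
  have a: "integrable ?N (\<lambda>z. \<kappa> (fst z i) (snd z) * q k ((fst z)(i := snd z)) * \<phi> (fst z k))"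
    and b: "integrable ?N (\<lambda>z. \<kappa> (fst z i) (snd z) * q k (fst z) * \<phi> (fst z k))"
    and c: "integrable ?N (\<lambda>z. \<kappa> (fst z i) (snd z) * q k (fst z) * \<phi> (((fst z)(i := snd z)) k))"
    if "k < D" "i < D" for k i
    using that by (intro int \<phi>_meas q_fst_measurable q_update_measurable q_bd; simp)+
  \<comment> \<open>Exchanging the old and the new value moves the update from the strategy to the
    test function; \<open>\<kappa>\<close> is unaffected by its symmetry.\<close>
  have resample_eq: "(\<integral>z. \<kappa> (fst z i) (snd z) * q k ((fst z)(i := snd z)) * \<phi> (fst z k) \<partial>?N)
      = (\<integral>z. \<kappa> (fst z i) (snd z) * q k (fst z) * \<phi> (((fst z)(i := snd z)) k) \<partial>?N)"
    if "k < D" "i < D" for k i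
    using integral_resample[OF that(2) borel_measurable_integrable[OF a[OF that]]] \<kappa>_sym
    by (simp add: resample_def)
  have "(\<integral>u. (\<integral>y. \<kappa> (u i) y * (q k (u(i := y)) - q k u) \<partial>unif01) * \<phi> (u k) \<partial>cube D)
      = (if i = k then \<integral>u. q k u * (\<integral>y. \<kappa> (u k) y * (\<phi> y - \<phi> (u k)) \<partial>unif01) \<partial>cube D else 0)"
    if k: "k < D" and i: "i < D" for k i
  proof -
    have "(\<integral>u. (\<integral>y. \<kappa> (u i) y * (q k (u(i := y)) - q k u) \<partial>unif01) * \<phi> (u k) \<partial>cube D)
        = (\<integral>u. \<integral>y. (\<kappa> (u i) y * q k (u(i := y)) * \<phi> (u k) - \<kappa> (u i) y * q k u * \<phi> (u k)) \<partial>unif01 \<partial>cube D)"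
      by (intro Bochner_Integration.integral_cong refl, subst integral_mult_left_zero[symmetric])
        (simp add: algebra_simps)
    also have "\<dots> = (\<integral>z. \<kappa> (fst z i) (snd z) * q k ((fst z)(i := snd z)) * \<phi> (fst z k)
        - \<kappa> (fst z i) (snd z) * q k (fst z) * \<phi> (fst z k) \<partial>?N)"
      using cube_pair.integral_fst'[OF Bochner_Integration.integrable_diff[OF a[OF that] b[OF that]]] by simp
    also have "\<dots> = (\<integral>z. \<kappa> (fst z i) (snd z) * q k (fst z) * \<phi> (((fst z)(i := snd z)) k)
        - \<kappa> (fst z i) (snd z) * q k (fst z) * \<phi> (fst z k) \<partial>?N)"
      using a[OF that] b[OF that] c[OF that] by (simp add: resample_eq[OF that])
    \<comment> \<open>For \<open>i \<noteq> k\<close> the update does not touch \<open>u k\<close>,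
      and the two integrands coincide.\<close>
    also have "\<dots> = (if i = k then \<integral>u. q k u * (\<integral>y. \<kappa> (u k) y * (\<phi> y - \<phi> (u k)) \<partial>unif01) \<partial>cube D else 0)"
    proof (cases "i = k")
      case True
      have "(\<integral>z. \<kappa> (fst z i) (snd z) * q k (fst z) * \<phi> (((fst z)(i := snd z)) k)
          - \<kappa> (fst z i) (snd z) * q k (fst z) * \<phi> (fst z k) \<partial>?N)
        = (\<integral>u. \<integral>y. (\<kappa> (u i) y * q k u * \<phi> ((u(i := y)) k) - \<kappa> (u i) y * q k u * \<phi> (u k)) \<partial>unif01 \<partial>cube D)"
        using cube_pair.integral_fst'[OF Bochner_Integration.integrable_diff[OF c[OF that] b[OF that]]] by simp
      also have "\<dots> = (\<integral>u. \<integral>y. q k u * (\<kappa> (u k) y * (\<phi> y - \<phi> (u k))) \<partial>unif01 \<partial>cube D)"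
        by (simp add: True algebra_simps)
      finally show ?thesis
        by (simp add: True)
    qed simp
    finally show ?thesis .
  qed
  note term_eq = this
  have int_term: "integrable (cube D) (\<lambda>u. (\<integral>y. \<kappa> (u i) y * (q k (u(i := y)) - q k u) \<partial>unif01) * \<phi> (u k))"
    if k: "k < D" and i: "i < D" for k i
  proof (rule bounded_times_integrable[OF \<phi> k, where B=1])
    show "(\<lambda>u. \<integral>y. \<kappa> (u i) y * (q k (u(i := y)) - q k u) \<partial>unif01) \<in> borel_measurable (cube D)"
      by (intro unif01.borel_measurable_lebesgue_integral) (use mix_term_measurable[OF that] in \<open>simp add: split_beta'\<close>)
    show "\<bar>\<integral>y. \<kappa> (u i) y * (q k (u(i := y)) - q k u) \<partial>unif01\<bar> \<le> 1" if "u \<in> space (cube D)" for u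
      using mix_term_bounds[OF that k i] strategy_nonneg[OF q k that] strategy_le_1[OF q k that] by linarith
  qed
  have int_q: "integrable (cube D) (\<lambda>u. q k u * (\<integral>y. \<kappa> (u k) y * (\<phi> y - \<phi> (u k)) \<partial>unif01))" if k: "k < D" for k
  proof -
    have "integrable ?N (\<lambda>z. \<kappa> (fst z k) (snd z) * q k (fst z) * \<phi> (((fst z)(k := snd z)) k)
        - \<kappa> (fst z k) (snd z) * q k (fst z) * \<phi> (fst z k))"
      by (rule Bochner_Integration.integrable_diff[OF c[OF k k] b[OF k k]])
    from cube_pair.integrable_fst'[OF this] show ?thesis
      by (simp add: algebra_simps flip: integral_mult_right_zero)
  qed
  have "win_mean D mix \<phi> = (\<Sum>k<D. \<Sum>i<D. \<integral>u. (\<integral>y. \<kappa> (u i) y * (q k (u(i := y)) - q k u) \<partial>unif01) * \<phi> (u k) \<partial>cube D)"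
    unfolding win_mean_def mix_def sum_distrib_right
    by (subst Bochner_Integration.integral_sum Bochner_Integration.integrable_sum,
        use int_term in \<open>auto intro!: Bochner_Integration.integrable_sum sum.cong Bochner_Integration.integral_sum\<close>)
  also have "\<dots> = (\<Sum>k<D. \<integral>u. q k u * (\<integral>y. \<kappa> (u k) y * (\<phi> y - \<phi> (u k)) \<partial>unif01) \<partial>cube D)"
    by (intro sum.cong refl) (simp add: term_eq)
  also have "\<dots> = win_mean D q (\<lambda>x. \<integral>y. \<kappa> x y * (\<phi> y - \<phi> x) \<partial>unif01)"
    unfolding win_mean_def using int_q by (intro Bochner_Integration.integral_sum[symmetric]) auto
  finally show ?thesis .
qed

lemma integrable_pass_term:
  assumes \<phi>: "\<phi> \<in> borel_measurable unif01" "\<And>x. x \<in> space unif01 \<Longrightarrow> \<bar>\<phi> x\<bar> \<le> C"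
    and "k < D" "j < D" "l < D"
  shows "integrable (cube D) (\<lambda>u. q k u * s (u k) (u j) * \<phi> (u l))"
proof (rule bounded_times_integrable[OF \<phi> \<open>l < D\<close>, where B=1])
  show "(\<lambda>u. q k u * s (u k) (u j)) \<in> borel_measurable (cube D)"
    using assms by (intro borel_measurable_times s_pair_measurable cube_component_measurable strategy_measurable[OF q])
  show "\<bar>q k u * s (u k) (u j)\<bar> \<le> 1" if "u \<in> space (cube D)" for u
    using strategy_nonneg[OF q \<open>k < D\<close> that] strategy_le_1[OF q \<open>k < D\<close> that] s[of "u k" "u j"]
    by (simp add: abs_mult mult_le_one)
qed

text \<open>Swapping the two summation indices in the gain terms turns each hand-over into a
  replacement of \<open>\<phi> (u k)\<close> by \<open>\<phi> (u j)\<close>. The diagonal terms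
  cancel, which leaves pairs of distinct coordinates, the ones that have a uniform joint law on the
  square.\<close>

lemma win_mean_pass:
  assumes \<phi>: "\<phi> \<in> borel_measurable unif01" "\<And>x. x \<in> space unif01 \<Longrightarrow> \<bar>\<phi> x\<bar> \<le> C"
  shows "win_mean D pass \<phi>
    = (\<Sum>k<D. \<Sum>j\<in>{..<D} - {k}. \<integral>u. q k u * (s (u k) (u j) * (\<phi> (u j) - \<phi> (u k))) \<partial>cube D)"
proof -
  have "(\<Sum>k<D. pass k u * \<phi> (u k))
      = (\<Sum>k<D. \<Sum>j\<in>{..<D} - {k}. q k u * s (u k) (u j) * \<phi> (u j) - q k u * s (u k) (u j) * \<phi> (u k))" for u
  proof -
    have "(\<Sum>k<D. pass k u * \<phi> (u k)) = (\<Sum>k<D. \<Sum>j<D. q j u * s (u j) (u k) * \<phi> (u k))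
        - (\<Sum>k<D. \<Sum>j<D. q k u * s (u k) (u j) * \<phi> (u k))"
      by (simp add: pass_def sum_distrib_right left_diff_distrib sum_subtractf)
    also have "(\<Sum>k<D. \<Sum>j<D. q j u * s (u j) (u k) * \<phi> (u k)) = (\<Sum>k<D. \<Sum>j<D. q k u * s (u k) (u j) * \<phi> (u j))"
      by (rule sum.swap)
    also have "\<dots> - (\<Sum>k<D. \<Sum>j<D. q k u * s (u k) (u j) * \<phi> (u k))
        = (\<Sum>k<D. \<Sum>j<D. q k u * s (u k) (u j) * \<phi> (u j) - q k u * s (u k) (u j) * \<phi> (u k))"
      by (simp add: sum_subtractf)
    also have "\<dots> = (\<Sum>k<D. \<Sum>j\<in>{..<D} - {k}. q k u * s (u k) (u j) * \<phi> (u j) - q k u * s (u k) (u j) * \<phi> (u k))"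
    proof (rule sum.cong[OF refl])
      fix k assume "k \<in> {..<D}"
      then show "(\<Sum>j<D. q k u * s (u k) (u j) * \<phi> (u j) - q k u * s (u k) (u j) * \<phi> (u k))
          = (\<Sum>j\<in>{..<D} - {k}. q k u * s (u k) (u j) * \<phi> (u j) - q k u * s (u k) (u j) * \<phi> (u k))"
        by (subst sum.remove[of _ k]) auto
    qed
    finally show ?thesis .
  qed
  then have "win_mean D pass \<phi> = (\<integral>u. (\<Sum>k<D. \<Sum>j\<in>{..<D} - {k}.
      q k u * s (u k) (u j) * \<phi> (u j) - q k u * s (u k) (u j) * \<phi> (u k)) \<partial>cube D)"
    by (simp add: win_mean_def)
  also have "\<dots> = (\<Sum>k<D. \<integral>u. (\<Sum>j\<in>{..<D} - {k}.
      q k u * s (u k) (u j) * \<phi> (u j) - q k u * s (u k) (u j) * \<phi> (u k)) \<partial>cube D)"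
    by (intro Bochner_Integration.integral_sum Bochner_Integration.integrable_sum Bochner_Integration.integrable_diff
        integrable_pass_term[OF \<phi>]) auto
  also have "\<dots> = (\<Sum>k<D. \<Sum>j\<in>{..<D} - {k}. \<integral>u.
      q k u * s (u k) (u j) * \<phi> (u j) - q k u * s (u k) (u j) * \<phi> (u k) \<partial>cube D)"
    by (intro sum.cong refl Bochner_Integration.integral_sum Bochner_Integration.integrable_diff
        integrable_pass_term[OF \<phi>]) auto
  finally show ?thesis
    by (simp add: algebra_simps)
qed

lemma win_mean_perturbed:
  assumes \<phi>: "\<phi> \<in> borel_measurable unif01" "\<And>x. x \<in> space unif01 \<Longrightarrow> \<bar>\<phi> x\<bar> \<le> C"
  shows "win_mean D perturbed \<phi> = win_mean D q \<phi> + (win_mean D mix \<phi> + win_mean D pass \<phi>) / (4 * real D)"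
proof -
  have abs_le: "\<bar>x\<bar> \<le> real D" if "- (real D * c) \<le> x" "x \<le> real D" "0 \<le> c" "c \<le> 1" for x c
    using that mult_left_mono[OF that(4), of "real D"] by (auto simp: abs_le_iff)
  have mix: "integrable (cube D) (\<lambda>u. \<Sum>k<D. mix k u * \<phi> (u k))"
  proof (intro Bochner_Integration.integrable_sum bounded_times_integrable[OF \<phi>, where B="real D"])
    fix k u assume k: "k \<in> {..<D}" and u: "u \<in> space (cube D)"
    have "mix k u \<le> real D * (1 - q k u)"
      using mix_bounds(2)[OF u] k by simp
    also have "\<dots> \<le> real D * 1"
      using strategy_nonneg[OF q _ u] k by (intro mult_left_mono) auto
    finally show "\<bar>mix k u\<bar> \<le> real D"
      using mix_bounds(1)[OF u, of k] k strategy_nonneg[OF q _ u, of k] strategy_le_1[OF q _ u, of k]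
      by (intro abs_le[of "q k u"]) auto
  qed (auto intro: mix_measurable)
  have pass: "integrable (cube D) (\<lambda>u. \<Sum>k<D. pass k u * \<phi> (u k))"
  proof (intro Bochner_Integration.integrable_sum bounded_times_integrable[OF \<phi>, where B="real D"])
    fix k u assume k: "k \<in> {..<D}" and u: "u \<in> space (cube D)"
    show "\<bar>pass k u\<bar> \<le> real D"
      using pass_bounds[OF u, of k] k strategy_nonneg[OF q _ u, of k] strategy_le_1[OF q _ u, of k]
      by (intro abs_le[of "q k u"]) auto
  qed (auto intro: pass_measurable)
  have "(\<Sum>k<D. perturbed k u * \<phi> (u k)) = (\<Sum>k<D. q k u * \<phi> (u k))
      + ((\<Sum>k<D. mix k u * \<phi> (u k)) + (\<Sum>k<D. pass k u * \<phi> (u k))) / (4 * real D)" for u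
    by (simp add: perturbed_def distrib_right add_divide_distrib sum.distrib sum_divide_distrib)
  then show ?thesis
    unfolding win_mean_def using integrable_win[OF q \<phi>] mix pass by simp
qed

end

section \<open>The winner maximises the density\<close>

text \<open>Here \<open>r\<close> is the intensity of pairs (winning value, losing value), the sum
  of the fibre densities over ordered pairs of distinct labels. It turns the effect of handing over
  into a double integral over the unit square, where it can be compared with that of
  resampling.\<close>

lemma pair_density:
  assumes q: "strategy D q"
  shows "\<exists>r. r \<in> borel_measurable (unif01 \<Otimes>\<^sub>M unif01) \<and> (\<forall>z. 0 \<le> r z) \<and>
    (\<forall>\<psi> C. \<psi> \<in> borel_measurable (unif01 \<Otimes>\<^sub>M unif01) \<longrightarrow> (\<forall>z. \<bar>\<psi> z\<bar> \<le> C) \<longrightarrow>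
      (\<Sum>k<D. \<Sum>j\<in>{..<D} - {k}. \<integral>u. q k u * \<psi> (u k, u j) \<partial>cube D)
        = (\<integral>z. r z * \<psi> z \<partial>(unif01 \<Otimes>\<^sub>M unif01)))"
proof -
  let ?M = "unif01 \<Otimes>\<^sub>M unif01"
  let ?P = "\<lambda>(k, j) r. r \<in> borel_measurable ?M \<and> (\<forall>z. 0 \<le> r z \<and> r z \<le> 1) \<and>
     (\<forall>\<psi>\<in>borel_measurable ?M. (\<integral>u. q k u * \<psi> (u k, u j) \<partial>cube D) = (\<integral>z. r z * \<psi> z \<partial>?M))"
  let ?I = "SIGMA k:{..<D}. {..<D} - {k}"
  have "\<exists>r. ?P (k, j) r" if k: "k < D" and j: "j < D" "k \<noteq> j" for k j
  proof -
    have X: "(\<lambda>u. (u k, u j)) \<in> measurable (cube D) ?M" and w: "q k \<in> borel_measurable (cube D)"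
      and b: "\<And>u. u \<in> space (cube D) \<Longrightarrow> 0 \<le> q k u \<and> q k u \<le> 1"
      using k j strategy_measurable[OF q] cube_component_measurable
      by (auto simp: strategy_nonneg[OF q k] strategy_le_1[OF q k])
    show ?thesis
      by (rule fibre_density[OF cube.prob_space_axioms X distr_cube_pair[OF k j] w b]) (simp, blast)
  qed
  then have "\<forall>i. \<exists>r. i \<in> ?I \<longrightarrow> ?P i r"
    by auto
  from choice[OF this] obtain r where P: "\<forall>i. i \<in> ?I \<longrightarrow> ?P i (r i)" ..
  have r: "r i \<in> borel_measurable ?M" "0 \<le> r i z" "r i z \<le> 1"
      "\<psi> \<in> borel_measurable ?M \<Longrightarrow>
        (\<integral>u. q (fst i) u * \<psi> (u (fst i), u (snd i)) \<partial>cube D) = (\<integral>z. r i z * \<psi> z \<partial>?M)"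
    if "i \<in> ?I" for i z \<psi>
    using P[rule_format, OF that] unfolding case_prod_beta by blast+
  let ?r = "\<lambda>z. \<Sum>i\<in>?I. r i z"
  have "?r \<in> borel_measurable ?M"
    using r(1) by (rule borel_measurable_sum)
  moreover have "0 \<le> ?r z" for z
    using r(2) by (rule sum_nonneg)
  moreover have "(\<Sum>k<D. \<Sum>j\<in>{..<D} - {k}. \<integral>u. q k u * \<psi> (u k, u j) \<partial>cube D) = (\<integral>z. ?r z * \<psi> z \<partial>?M)"
    if \<psi>: "\<psi> \<in> borel_measurable ?M" "\<forall>z. \<bar>\<psi> z\<bar> \<le> C" for \<psi> C
  proof -
    have "integrable ?M (\<lambda>z. r i z * \<psi> z)" if "i \<in> ?I" for i
    proof (rule unif01_pair.P.integrable_const_bound)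
      have "\<bar>r i z\<bar> * \<bar>\<psi> z\<bar> \<le> 1 * C" for z
        using r(2,3)[OF that, of z] spec[OF \<psi>(2), of z] by (intro mult_mono) auto
      then show "AE z in ?M. norm (r i z * \<psi> z) \<le> C"
        by (intro AE_I2) (simp add: abs_mult)
      show "(\<lambda>z. r i z * \<psi> z) \<in> borel_measurable ?M"
        using r(1)[OF that] \<psi>(1) by simp
    qed
    then have "(\<integral>z. ?r z * \<psi> z \<partial>?M) = (\<Sum>i\<in>?I. \<integral>z. r i z * \<psi> z \<partial>?M)"
      unfolding sum_distrib_right by (rule Bochner_Integration.integral_sum)
    also have "\<dots> = (\<Sum>(k, j)\<in>?I. \<integral>u. q k u * \<psi> (u k, u j) \<partial>cube D)"
      unfolding case_prod_beta by (rule sum.cong[OF refl r(4)[OF _ \<psi>(1), symmetric]])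
    also have "\<dots> = (\<Sum>k<D. \<Sum>j\<in>{..<D} - {k}. \<integral>u. q k u * \<psi> (u k, u j) \<partial>cube D)"
      by (rule sum.Sigma[symmetric]) auto
    finally show ?thesis ..
  qed
  ultimately show ?thesis
    by (intro exI[of _ ?r]) blast
qed

text \<open>Wherever a value beats one of higher density with positive intensity, a balanced
  perturbation keeps the law and makes the outcome random. As this is forbidden, the intensity of
  such pairs vanishes.\<close>

lemma winner_dominates:
  assumes D: "0 < D" and p: "strategy D p"
    and det: "\<And>q. strategy D q \<Longrightarrow> strategy_law D q = strategy_law D p \<Longrightarrow> deterministic D q"
    and f_meas: "f \<in> borel_measurable unif01" and f: "\<And>x. 0 \<le> f x" "\<And>x. f x \<le> real D"
    and win_f: "\<And>\<phi> C. \<phi> \<in> borel_measurable unif01 \<Longrightarrow> (\<And>x. x \<in> space unif01 \<Longrightarrow> \<bar>\<phi> x\<bar> \<le> C) \<Longrightarrow>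
      win_mean D p \<phi> = (\<integral>x. f x * \<phi> x \<partial>unif01)"
  shows "AE u in cube D. \<forall>k<D. \<forall>j<D. f (u k) < f (u j) \<longrightarrow> p k u = 0"
proof -
  let ?M = "unif01 \<Otimes>\<^sub>M unif01"
  obtain r where r_meas: "r \<in> borel_measurable ?M" and r: "\<And>z. 0 \<le> r z"
    and win_r: "\<And>\<psi> C. \<psi> \<in> borel_measurable ?M \<Longrightarrow> (\<And>z. \<bar>\<psi> z\<bar> \<le> C) \<Longrightarrow>
      (\<Sum>k<D. \<Sum>j\<in>{..<D} - {k}. \<integral>u. p k u * \<psi> (u k, u j) \<partial>cube D) = (\<integral>z. r z * \<psi> z \<partial>?M)"
    using pair_density[OF p] by blast
  \<comment> \<open>\<open>h x y\<close> is the mass to be handed from \<open>x\<close> to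
    \<open>y\<close>, limited by the available intensity \<open>r (x, y)\<close> and by the gap
    \<open>f y - f x\<close>; these limits give \<open>s \<le> 1\<close> and
    \<open>\<kappa> \<le> 1\<close>. Where a denominator below is 0, so is \<open>h\<close>, in
    accordance with division by zero giving 0.\<close>
  define h where "h x y = min (r (x, y)) (max 0 (f y - f x))" for x y
  define \<kappa> where "\<kappa> x y = (h x y + h y x) / \<bar>f x - f y\<bar>" for x y
  define s where "s x y = h x y / r (x, y)" for x y
  have f_pair: "(\<lambda>z. f (fst z)) \<in> borel_measurable ?M" "(\<lambda>z. f (snd z)) \<in> borel_measurable ?M"
    using measurable_compose[OF measurable_fst f_meas] measurable_compose[OF measurable_snd f_meas] by auto
  have r_swap: "(\<lambda>z. r (snd z, fst z)) \<in> borel_measurable ?M"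
    using measurable_compose[OF measurable_Pair[OF measurable_snd measurable_fst] r_meas] .
  have h_meas: "(\<lambda>z. h (fst z) (snd z)) \<in> borel_measurable ?M"
    unfolding h_def using r_meas f_pair by simp
  have h_swap_meas: "(\<lambda>z. h (snd z) (fst z)) \<in> borel_measurable ?M"
    unfolding h_def using r_swap f_pair by simp
  have h: "0 \<le> h x y" "h x y \<le> real D" "f y \<le> f x \<Longrightarrow> h x y = 0" "f x \<le> f y \<Longrightarrow> h x y \<le> f y - f x" for x y
    using r[of "(x, y)"] f(1)[of x] f(2)[of y] by (auto simp: h_def)
  interpret perturbation D p \<kappa> s
  proof
    show "(\<lambda>z. \<kappa> (fst z) (snd z)) \<in> borel_measurable ?M"
      unfolding \<kappa>_def using h_meas h_swap_meas f_pair by simp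
    show "(\<lambda>z. s (fst z) (snd z)) \<in> borel_measurable ?M"
      unfolding s_def using h_meas r_meas by simp
    fix x y
    show "0 \<le> \<kappa> x y" "0 \<le> s x y" "\<kappa> x y = \<kappa> y x"
      using h(1) r by (simp_all add: \<kappa>_def s_def abs_minus_commute add.commute)
    show "\<kappa> x y \<le> 1"
      using h(3,4)[of x y] h(3,4)[of y x] by (cases "f x" "f y" rule: linorder_cases) (simp_all add: \<kappa>_def)
    show "s x y \<le> 1"
      using r[of "(x, y)"] unfolding s_def h_def by (intro divide_le_eq_1[THEN iffD2]) auto
  qed (use D p in auto)
  have rs: "r (x, y) * s x y = h x y" for x y
    using r[of "(x, y)"] by (auto simp: s_def h_def)
  \<comment> \<open>The left side is the net flow from \<open>x\<close> to \<open>y\<close> caused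
    by resampling, the right side the opposite of the net flow caused by handing over.\<close>
  have f\<kappa>: "(f x - f y) * \<kappa> x y = h y x - h x y" for x y
    using h(3)[of x y] h(3)[of y x] by (cases "f x" "f y" rule: linorder_cases) (auto simp: \<kappa>_def abs_if field_simps)
  have "win_mean D mix \<phi> + win_mean D pass \<phi> = 0"
    if \<phi>: "\<phi> \<in> borel_measurable unif01" "\<And>x. \<bar>\<phi> x\<bar> \<le> 1" for \<phi>
  proof -
    have \<phi>_pair: "(\<lambda>z. \<phi> (fst z)) \<in> borel_measurable ?M" "(\<lambda>z. \<phi> (snd z)) \<in> borel_measurable ?M"
      using measurable_compose[OF measurable_fst \<phi>(1)] measurable_compose[OF measurable_snd \<phi>(1)] by auto
    have \<phi>_diff: "\<bar>\<phi> y - \<phi> x\<bar> \<le> 2" for x y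
      using \<phi>(2)[of x] \<phi>(2)[of y] by linarith
    have \<kappa>\<phi>: "\<bar>\<kappa> x y * (\<phi> y - \<phi> x)\<bar> \<le> 2" for x y
      using mult_mono[of "\<bar>\<kappa> x y\<bar>" 1 "\<bar>\<phi> y - \<phi> x\<bar>" 2] \<kappa>[of x y] \<phi>_diff[of y x] by (simp add: abs_mult)
    define g where "g z = f (fst z) * (\<kappa> (fst z) (snd z) * (\<phi> (snd z) - \<phi> (fst z)))" for z
    define h' where "h' z = h (fst z) (snd z) * (\<phi> (snd z) - \<phi> (fst z))" for z
    have g_meas: "g \<in> borel_measurable ?M"
      unfolding g_def using f_pair \<phi>_pair \<kappa>_measurable by simp
    have g_int: "integrable ?M g"
    proof (rule unif01_pair.P.integrable_const_bound[OF _ g_meas])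
      show "AE z in ?M. norm (g z) \<le> real D * 2"
        unfolding g_def using f \<kappa>\<phi> by (intro AE_I2) (auto simp: abs_mult[of "f _"] intro!: mult_mono)
    qed
    have h'_meas: "h' \<in> borel_measurable ?M"
      unfolding h'_def using h_meas \<phi>_pair by simp
    have h'_int: "integrable ?M h'"
    proof (rule unif01_pair.P.integrable_const_bound[OF _ h'_meas])
      show "AE z in ?M. norm (h' z) \<le> real D * 2"
        unfolding h'_def using h \<phi>_diff by (intro AE_I2) (auto simp: abs_mult intro!: mult_mono)
    qed
    have swap: "integrable ?M (\<lambda>z. k (snd z, fst z))"
        "(\<integral>z. k (snd z, fst z) \<partial>?M) = (\<integral>z. k z \<partial>?M)" if "integrable ?M k" for k :: "_ \<Rightarrow> real"
      using unif01_pair.integrable_product_swap[OF that] 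
        unif01_pair.integral_product_swap[OF borel_measurable_integrable[OF that]]
      by (simp_all add: split_beta')
    have "win_mean D mix \<phi> = win_mean D p (\<lambda>x. \<integral>y. \<kappa> x y * (\<phi> y - \<phi> x) \<partial>unif01)"
      by (rule win_mean_mix[OF \<phi>])
    also have "\<dots> = (\<integral>x. f x * (\<integral>y. \<kappa> x y * (\<phi> y - \<phi> x) \<partial>unif01) \<partial>unif01)"
    proof (rule win_f)
      show "(\<lambda>x. \<integral>y. \<kappa> x y * (\<phi> y - \<phi> x) \<partial>unif01) \<in> borel_measurable unif01"
        by (intro unif01.borel_measurable_lebesgue_integral) (use \<kappa>_measurable \<phi>_pair in \<open>simp add: split_beta'\<close>)
      show "\<bar>\<integral>y. \<kappa> x y * (\<phi> y - \<phi> x) \<partial>unif01\<bar> \<le> 2" if x: "x \<in> space unif01" for x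
      proof -
        have "integrable unif01 (\<lambda>y. \<kappa> x y * (\<phi> y - \<phi> x))"
        proof (rule unif01.integrable_const_bound)
          show "AE y in unif01. norm (\<kappa> x y * (\<phi> y - \<phi> x)) \<le> 2"
            using \<kappa>\<phi> by (intro AE_I2) simp
          show "(\<lambda>y. \<kappa> x y * (\<phi> y - \<phi> x)) \<in> borel_measurable unif01"
            using \<kappa>_pair_measurable[OF measurable_const[OF x] measurable_ident_sets[OF refl]] \<phi>(1)
            by (intro borel_measurable_times borel_measurable_diff borel_measurable_const)
        qed
        moreover have "- 2 \<le> \<kappa> x y * (\<phi> y - \<phi> x) \<and> \<kappa> x y * (\<phi> y - \<phi> x) \<le> 2" for y
          using \<kappa>\<phi>[of x y] by linarith
        ultimately have "- 2 \<le> (\<integral>y. \<kappa> x y * (\<phi> y - \<phi> x) \<partial>unif01)" "(\<integral>y. \<kappa> x y * (\<phi> y - \<phi> x) \<partial>unif01) \<le> 2"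
          by (auto intro!: unif01.integral_le_const unif01.integral_ge_const)
        then show ?thesis
          by linarith
      qed
    qed
    also have "\<dots> = (\<integral>z. g z \<partial>?M)"
      using unif01_pair.integral_fst'[OF g_int] by (simp add: g_def [abs_def])
    finally have mix_eq: "win_mean D mix \<phi> = (\<integral>z. g z \<partial>?M)" .
    have "win_mean D pass \<phi> = (\<Sum>k<D. \<Sum>j\<in>{..<D} - {k}. \<integral>u. p k u * (s (u k) (u j) * (\<phi> (u j) - \<phi> (u k))) \<partial>cube D)"
      by (rule win_mean_pass[OF \<phi>])
    also have "\<dots> = (\<integral>z. r z * (s (fst z) (snd z) * (\<phi> (snd z) - \<phi> (fst z))) \<partial>?M)"
    proof -
      have "\<bar>s (fst z) (snd z) * (\<phi> (snd z) - \<phi> (fst z))\<bar> \<le> 2" for z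
        using mult_mono[of "\<bar>s (fst z) (snd z)\<bar>" 1 "\<bar>\<phi> (snd z) - \<phi> (fst z)\<bar>" 2] s[of "fst z" "snd z"] \<phi>_diff
        by (simp add: abs_mult)
      then show ?thesis
        using win_r[of "\<lambda>z. s (fst z) (snd z) * (\<phi> (snd z) - \<phi> (fst z))" 2] s_measurable \<phi>_pair by simp
    qed
    also have "\<dots> = (\<integral>z. h' z \<partial>?M)"
      by (intro Bochner_Integration.integral_cong refl) (simp add: h'_def mult.assoc[symmetric] flip: rs)
    finally have pass_eq: "win_mean D pass \<phi> = (\<integral>z. h' z \<partial>?M)" .
    \<comment> \<open>The effects do not cancel at a single ordered pair, only after adding the
      swapped pair. Invariance of the product measure under the swap then cancels the
      integrals.\<close>
    have "g z + g (snd z, fst z) = - (h' z + h' (snd z, fst z))" for z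
    proof -
      have "g z + g (snd z, fst z)
          = (f (fst z) - f (snd z)) * \<kappa> (fst z) (snd z) * (\<phi> (snd z) - \<phi> (fst z))"
        using \<kappa>_sym[of "fst z" "snd z"] by (simp add: g_def algebra_simps)
      also have "\<dots> = (h (snd z) (fst z) - h (fst z) (snd z)) * (\<phi> (snd z) - \<phi> (fst z))"
        by (simp only: f\<kappa>)
      finally show ?thesis
        by (simp add: h'_def algebra_simps)
    qed
    then have "(\<integral>z. g z + g (snd z, fst z) \<partial>?M) = - (\<integral>z. h' z + h' (snd z, fst z) \<partial>?M)"
      by (simp only: Bochner_Integration.integral_minus)
    then show ?thesis
      using swap[OF g_int] swap[OF h'_int] g_int h'_int by (simp add: mix_eq pass_eq)
  qed
  then have "strategy_law D perturbed = strategy_law D p"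
    using win_mean_perturbed[of "indicator _" 1]
    by (intro strategy_law_eqI strategy_perturbed p) (simp add: indicator_def)
  then have "deterministic D perturbed" "deterministic D p"
    using det strategy_perturbed p by blast+
  \<comment> \<open>Where \<open>p k u = 1\<close>, the perturbed weight is at least 1/2 and hence
    1, which leaves no room for a positive \<open>s (u k) (u j)\<close>.\<close>
  have zero: "AE u in cube D. p k u * s (u k) (u j) = 0" if kj: "k < D" "j < D" "j \<noteq> k" for k j
  proof -
    have "AE u in cube D. perturbed k u \<in> {0, 1}" "AE u in cube D. p k u \<in> {0, 1}"
      using \<open>deterministic D perturbed\<close> \<open>deterministic D p\<close> kj by (simp_all add: deterministic_def)
    then show ?thesis
      using AE_space
    proof eventually_elim
      case (elim u)
      show ?case
      proof (cases "p k u = 1")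
        case True
        then have "perturbed k u = 1"
          using perturbed_ge[OF elim(3) kj(1)] elim(1) by auto
        then have "s (u k) (u j) / (4 * real D) \<le> 0"
          using perturbed_le[OF elim(3) kj True] by simp
        then have "s (u k) (u j) = 0"
          using s[of "u k" "u j"] D by (simp add: divide_le_0_iff)
        then show ?thesis
          by simp
      qed (use elim in auto)
    qed
  qed
  have "(\<Sum>k<D. \<Sum>j\<in>{..<D} - {k}. \<integral>u. p k u * s (u k) (u j) \<partial>cube D) = (\<integral>z. h (fst z) (snd z) \<partial>?M)"
    using win_r[of "\<lambda>z. s (fst z) (snd z)" 1] s_measurable s by (simp flip: rs)
  moreover have "(\<integral>u. p k u * s (u k) (u j) \<partial>cube D) = 0" if "k < D" "j < D" "j \<noteq> k" for k j
    using integral_eq_zero_AE[OF zero[OF that]] .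
  ultimately have "(\<integral>z. h (fst z) (snd z) \<partial>?M) = 0"
    by simp
  moreover have "integrable ?M (\<lambda>z. h (fst z) (snd z))"
    using h by (intro unif01_pair.P.integrable_const_bound[OF _ h_meas, of "real D"]) auto
  ultimately have "AE z in ?M. h (fst z) (snd z) = 0"
    using h by (subst (asm) integral_nonneg_eq_0_iff_AE) auto
  \<comment> \<open>A minimum of \<open>r\<close> and a positive gap is 0 only if \<open>r\<close>
    is.\<close>
  then have "AE z in ?M. r z * of_bool (f (fst z) < f (snd z)) = 0"
    by eventually_elim (auto simp: h_def min_def split: if_splits)
  then have "(\<integral>z. r z * of_bool (f (fst z) < f (snd z)) \<partial>?M) = 0"
    by (rule integral_eq_zero_AE)
  moreover have less_meas: "(\<lambda>z. of_bool (f (fst z) < f (snd z)) :: real) \<in> borel_measurable ?M"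
    using f_pair by measurable
  ultimately have sum0: "(\<Sum>k<D. \<Sum>j\<in>{..<D} - {k}. \<integral>u. p k u * of_bool (f (u k) < f (u j)) \<partial>cube D) = 0"
    using win_r[of "\<lambda>z. of_bool (f (fst z) < f (snd z))" 1] by simp
  have "AE u in cube D. f (u k) < f (u j) \<longrightarrow> p k u = 0" if kj: "k < D" "j < D" for k j
  proof (cases "k = j")
    case False
    have nonneg: "0 \<le> (\<integral>u. p l u * of_bool (f (u l) < f (u i)) \<partial>cube D)" if "l < D" for l i
      using strategy_nonneg[OF p that] by (intro Bochner_Integration.integral_nonneg) auto
    have "(\<Sum>j\<in>{..<D} - {k}. \<integral>u. p k u * of_bool (f (u k) < f (u j)) \<partial>cube D) = 0"
      using sum0 kj nonneg by (subst (asm) sum_nonneg_eq_0_iff) (auto intro!: sum_nonneg)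
    then have "(\<integral>u. p k u * of_bool (f (u k) < f (u j)) \<partial>cube D) = 0"
      using kj False nonneg by (subst (asm) sum_nonneg_eq_0_iff) auto
    moreover have "integrable (cube D) (\<lambda>u. p k u * of_bool (f (u k) < f (u j)))"
    proof (rule cube.integrable_const_bound[where B=1])
      show "AE u in cube D. norm (p k u * of_bool (f (u k) < f (u j))) \<le> 1"
        using strategy_nonneg[OF p kj(1)] strategy_le_1[OF p kj(1)] by (intro AE_I2) auto
      show "(\<lambda>u. p k u * of_bool (f (u k) < f (u j))) \<in> borel_measurable (cube D)"
        using strategy_measurable[OF p kj(1)] less_meas
          measurable_compose[OF measurable_Pair[OF cube_component_measurable[OF kj(1)] cube_component_measurable[OF kj(2)]] less_meas]
        by simp
    qed
    ultimately have "AE u in cube D. p k u * of_bool (f (u k) < f (u j)) = 0"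
      using strategy_nonneg[OF p kj(1)]
      by (subst (asm) integral_nonneg_eq_0_iff_AE) (auto intro!: AE_I2)
    then show ?thesis
      by eventually_elim auto
  qed simp
  then have "AE u in cube D. \<forall>k\<in>{..<D}. \<forall>j\<in>{..<D}. f (u k) < f (u j) \<longrightarrow> p k u = 0"
    by (intro AE_finite_allI) auto
  then show ?thesis
    by auto
qed

section \<open>Absence of ties\<close>

lemma integral_cube_unif01_mult:
  fixes a :: "(nat \<Rightarrow> real) \<Rightarrow> real" and b :: "real \<Rightarrow> real"
  assumes a: "a \<in> borel_measurable (cube D)" "\<And>u. u \<in> space (cube D) \<Longrightarrow> \<bar>a u\<bar> \<le> A"
    and b: "b \<in> borel_measurable unif01" "\<And>y. y \<in> space unif01 \<Longrightarrow> \<bar>b y\<bar> \<le> B"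
  shows "(\<integral>z. a (fst z) * b (snd z) \<partial>(cube D \<Otimes>\<^sub>M unif01)) = (\<integral>u. a u \<partial>cube D) * (\<integral>y. b y \<partial>unif01)"
proof -
  have "integrable (cube D \<Otimes>\<^sub>M unif01) (\<lambda>z. a (fst z) * b (snd z))"
  proof (rule cube_pair.P.integrable_const_bound)
    show "AE z in cube D \<Otimes>\<^sub>M unif01. norm (a (fst z) * b (snd z)) \<le> A * B"
      using a(2) b(2) by (intro AE_I2) (auto simp: abs_mult space_pair_measure
        intro!: mult_mono order_trans[OF abs_ge_zero])
    show "(\<lambda>z. a (fst z) * b (snd z)) \<in> borel_measurable (cube D \<Otimes>\<^sub>M unif01)"
      by (intro borel_measurable_times measurable_compose[OF measurable_fst a(1)]
          measurable_compose[OF measurable_snd b(1)])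
  qed
  from cube_pair.integral_fst'[OF this] show ?thesis
    by simp
qed

text \<open>
  Were \<open>E = {f = c}\<close> not null, the winner \<open>w\<close> with uniform tie breaking at \<open>c\<close> would also have a constant
  density on \<open>E\<close>, since its probability of winning depends on the winning value only through membership in \<open>E\<close>.
\<close>

lemma winner_density_atomless:
  assumes D: "2 \<le> D" and p: "strategy D p"
    and det: "\<And>q. strategy D q \<Longrightarrow> strategy_law D q = strategy_law D p \<Longrightarrow> deterministic D q"
    and f_meas: "f \<in> borel_measurable unif01" and f: "\<And>x. 0 \<le> f x" "\<And>x. f x \<le> real D"
    and win_f: "\<And>\<phi> C. \<phi> \<in> borel_measurable unif01 \<Longrightarrow> (\<And>x. x \<in> space unif01 \<Longrightarrow> \<bar>\<phi> x\<bar> \<le> C) \<Longrightarrow>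
      win_mean D p \<phi> = (\<integral>x. f x * \<phi> x \<partial>unif01)"
  shows "emeasure unif01 {x \<in> space unif01. f x = c} = 0"
proof (rule ccontr)
  define E where "E = {x \<in> space unif01. f x = c}"
  assume "emeasure unif01 {x \<in> space unif01. f x = c} \<noteq> 0"
  then have E_pos: "emeasure unif01 E \<noteq> 0"
    by (simp add: E_def)
  then have m_pos: "0 < measure unif01 E"
    by (simp add: unif01.emeasure_eq_measure zero_less_measure_iff)
  have E_meas: "E \<in> sets unif01"
    unfolding E_def using f_meas by measurable
  have E_iff: "u i \<in> E \<longleftrightarrow> f (u i) = c" if "u \<in> space (cube D)" "i < D" for u i
    using cube_component_in_space[OF that] by (simp add: E_def)
  \<comment> \<open>\<open>T u\<close> says that the largest \<open>f\<close>-value among the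
    coordinates is \<open>c\<close>, and \<open>ties u\<close> counts the coordinates attaining it.
    On \<open>T\<close> the win is shared equally among these; elsewhere \<open>w\<close> copies
    \<open>p\<close>.\<close>
  define ties where "ties u = (\<Sum>i<D. indicator E (u i) :: real)" for u
  define T where "T u \<longleftrightarrow> (\<forall>i<D. f (u i) \<le> c) \<and> 0 < ties u" for u
  define g where "g k u = of_bool (T u) * (indicator E (u k) / ties u)" for k u
  define w where "w k u = g k u + of_bool (\<not> T u) * p k u" for k u
  have f_coord: "(\<lambda>u. f (u i)) \<in> borel_measurable (cube D)" if "i < D" for i
    using measurable_compose[OF cube_component_measurable[OF that] f_meas] .
  have E_coord: "(\<lambda>u. indicator E (u i) :: real) \<in> borel_measurable (cube D)" if "i < D" for i
    using measurable_compose[OF cube_component_measurable[OF that] borel_measurable_indicator[OF E_meas]] .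
  have ties_meas: "ties \<in> borel_measurable (cube D)"
    unfolding ties_def [abs_def] using E_coord by (intro borel_measurable_sum) auto
  have T_meas: "Measurable.pred (cube D) T"
  proof -
    have "Measurable.pred (cube D) (\<lambda>u. f (u i) \<le> c)" if "i < D" for i
      using f_coord[OF that] by measurable
    then have "Measurable.pred (cube D) (\<lambda>u. \<forall>i\<in>{..<D}. f (u i) \<le> c)"
      by (intro pred_intros_finite) auto
    moreover have "Measurable.pred (cube D) (\<lambda>u. 0 < ties u)"
      using ties_meas by measurable
    moreover have "T = (\<lambda>u. (\<forall>i\<in>{..<D}. f (u i) \<le> c) \<and> 0 < ties u)"
      by (auto simp: T_def fun_eq_iff)
    ultimately show ?thesis
      by (simp only: pred_intros_logic)
  qed
  have g_meas: "g k \<in> borel_measurable (cube D)" if "k < D" for k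
    unfolding g_def [abs_def] using T_meas ties_meas E_coord[OF that] by measurable
  have sum_g: "(\<Sum>k<D. g k u) = of_bool (T u)" for u
    unfolding g_def by (auto simp: T_def ties_def simp flip: sum_divide_distrib sum_distrib_left)
  have g_bounds: "0 \<le> g k u" "g k u \<le> 1" if "k < D" for k u
  proof -
    show g0: "0 \<le> g k u" for k
      unfolding g_def ties_def by (intro mult_nonneg_nonneg divide_nonneg_nonneg sum_nonneg) auto
    show "g k u \<le> 1"
      using member_le_sum[of k "{..<D}" "\<lambda>k. g k u"] g0 that sum_g[of u] by (cases "T u") auto
  qed
  have w: "strategy D w"
  proof (rule strategyI)
    show "w k \<in> borel_measurable (cube D)" if "k < D" for k
      unfolding w_def [abs_def] using g_meas[OF that] T_meas strategy_measurable[OF p that] by measurable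
    show "0 \<le> w k u" if "k < D" "u \<in> space (cube D)" for k u
      unfolding w_def using g_bounds that strategy_nonneg[OF p that] by simp
    show "(\<Sum>k<D. w k u) = 1" if "u \<in> space (cube D)" for u
      unfolding w_def sum.distrib sum_g using strategy_sum[OF p that] by (simp flip: sum_distrib_left)
  qed
  have dom: "AE u in cube D. \<forall>k<D. \<forall>j<D. f (u k) < f (u j) \<longrightarrow> p k u = 0"
    using D by (intro winner_dominates[OF _ p det f_meas f win_f]) auto
  \<comment> \<open>As the winner under \<open>p\<close> maximises \<open>f\<close>, it lies in
    \<open>E\<close> exactly when \<open>T\<close> holds. So \<open>w\<close> replaces precisely the
    part of the law of \<open>p\<close> carried by \<open>E\<close>.\<close>
  have tie_won: "AE u in cube D. \<forall>k<D. of_bool (T u) * p k u = p k u * indicator E (u k)"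
    using dom AE_space
  proof eventually_elim
    case (elim u)
    show ?case
    proof (intro allI impI)
      fix k assume k: "k < D"
      have ties_pos: "0 < ties u \<longleftrightarrow> (\<exists>i<D. u i \<in> E)"
        using sum_nonneg_eq_0_iff[of "{..<D}" "\<lambda>i. indicator E (u i) :: real"]
          sum_nonneg[of "{..<D}" "\<lambda>i. indicator E (u i) :: real"]
        by (auto simp: ties_def indicator_eq_0_iff less_le)
      show "of_bool (T u) * p k u = p k u * indicator E (u k)"
      proof (cases "p k u = 0")
        case False
        then have "f (u j) \<le> f (u k)" if "j < D" for j
          using elim(1) k that by (meson not_le)
        then have "T u \<longleftrightarrow> u k \<in> E"
          unfolding T_def ties_pos using k E_iff[OF elim(2)] by (metis order_antisym order_refl)
        then show ?thesis
          by simp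
      qed simp
    qed
  qed
  define G where "G = (\<Sum>k<D. \<integral>u. g k u \<partial>cube D)"
  \<comment> \<open>On \<open>E\<close> the removed part has density \<open>c\<close> and the
    inserted part the constant density \<open>G / measure unif01 E\<close>, so the laws can differ
    only by a multiple of the uniform measure on \<open>E\<close>.\<close>
  have win_w: "win_mean D w \<phi> - win_mean D p \<phi> = (G / measure unif01 E - c) * (\<integral>x. indicator E x * \<phi> x \<partial>unif01)"
    if \<phi>: "\<phi> \<in> borel_measurable unif01" "\<And>x. x \<in> space unif01 \<Longrightarrow> \<bar>\<phi> x\<bar> \<le> 1" for \<phi>
  proof -
    have E\<phi>: "(\<lambda>x. indicator E x * \<phi> x) \<in> borel_measurable unif01"
        "\<And>x. x \<in> space unif01 \<Longrightarrow> \<bar>indicator E x * \<phi> x\<bar> \<le> 1"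
      using \<phi> E_meas by (auto split: split_indicator)
    have \<phi>_coord: "(\<lambda>u. \<phi> (u k)) \<in> borel_measurable (cube D)" if "k < D" for k
      using measurable_compose[OF cube_component_measurable[OF that] \<phi>(1)] .
    have g\<phi>_bound: "\<bar>g k u * \<phi> (u k)\<bar> \<le> 1" if "k < D" "u \<in> space (cube D)" for k u
      using g_bounds[OF that(1), of u] \<phi>(2)[OF cube_component_in_space[OF that(2,1)]]
      by (simp add: abs_mult mult_le_one)
    have g\<phi>_meas: "(\<lambda>u. g k u * \<phi> (u k)) \<in> borel_measurable (cube D)" if "k < D" for k
      using g_meas[OF that] \<phi>_coord[OF that] by simp
    have g\<phi>_int: "integrable (cube D) (\<lambda>u. g k u * \<phi> (u k))" if "k < D" for k
      using g\<phi>_bound[OF that] by (intro cube.integrable_const_bound[OF _ g\<phi>_meas[OF that], of 1] AE_I2) auto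
    \<comment> \<open>A spare uniform conditioned to lie in \<open>E\<close> is exchanged with the
      winning coordinate: the winning value on \<open>T\<close> is uniform on \<open>E\<close> and
      independent of the weight.\<close>
    have g\<phi>: "measure unif01 E * (\<integral>u. g k u * \<phi> (u k) \<partial>cube D)
        = (\<integral>u. g k u \<partial>cube D) * (\<integral>x. indicator E x * \<phi> x \<partial>unif01)" if k: "k < D" for k
    proof -
      have "(\<integral>u. g k u * \<phi> (u k) \<partial>cube D) * (\<integral>y. indicator E y \<partial>unif01)
          = (\<integral>z. (g k (fst z) * \<phi> (fst z k)) * indicator E (snd z) \<partial>(cube D \<Otimes>\<^sub>M unif01))"
        by (rule integral_cube_unif01_mult[symmetric, OF g\<phi>_meas[OF k] g\<phi>_bound[OF k], where B=1])
          (use E_meas in \<open>auto split: split_indicator\<close>)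
      also have "\<dots> = (\<integral>z. (g k ((fst z)(k := snd z)) * \<phi> (snd z)) * indicator E (fst z k) \<partial>(cube D \<Otimes>\<^sub>M unif01))"
      proof (subst integral_resample[OF k, symmetric])
        show "(\<lambda>z. g k (fst z) * \<phi> (fst z k) * indicator E (snd z)) \<in> borel_measurable (cube D \<Otimes>\<^sub>M unif01)"
          by (intro borel_measurable_times[OF measurable_compose[OF measurable_fst g\<phi>_meas[OF k]]]
              measurable_compose[OF measurable_snd borel_measurable_indicator[OF E_meas]])
      qed (simp add: resample_def)
      also have "\<dots> = (\<integral>z. g k (fst z) * (indicator E (snd z) * \<phi> (snd z)) \<partial>(cube D \<Otimes>\<^sub>M unif01))"
      proof (intro Bochner_Integration.integral_cong refl)
        fix z assume "z \<in> space (cube D \<Otimes>\<^sub>M unif01)"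
        \<comment> \<open>Exchanging one element of \<open>E\<close> for another changes neither
          \<open>T\<close> nor the number of ties. If either value lies outside \<open>E\<close>,
          both sides are 0.\<close>
        have "g k ((fst z)(k := snd z)) * indicator E (fst z k) = g k (fst z) * indicator E (snd z)"
        proof (cases "fst z k \<in> E \<and> snd z \<in> E")
          case True
          then have "indicator E (((fst z)(k := snd z)) i) = (indicator E (fst z i) :: real)"
              "f (((fst z)(k := snd z)) i) \<le> c \<longleftrightarrow> f (fst z i) \<le> c" for i
            by (auto simp: E_def)
          then have "ties ((fst z)(k := snd z)) = ties (fst z)" "T ((fst z)(k := snd z)) = T (fst z)"
            unfolding T_def ties_def by presburger+
          with True show ?thesis
            by (simp add: g_def)
        qed (auto simp: g_def)
        then show "g k ((fst z)(k := snd z)) * \<phi> (snd z) * indicator E (fst z k)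
            = g k (fst z) * (indicator E (snd z) * \<phi> (snd z))"
          by (metis mult.assoc mult.commute)
      qed
      also have "\<dots> = (\<integral>u. g k u \<partial>cube D) * (\<integral>x. indicator E x * \<phi> x \<partial>unif01)"
        using g_bounds[OF k] by (intro integral_cube_unif01_mult[OF g_meas[OF k] _ E\<phi>, where A=1]) auto
      finally show ?thesis
        using E_meas by (simp add: mult.commute)
    qed
    have "win_mean D w \<phi> - win_mean D p \<phi>
        = (\<integral>u. (\<Sum>k<D. w k u * \<phi> (u k)) - (\<Sum>k<D. p k u * \<phi> (u k)) \<partial>cube D)"
      unfolding win_mean_def using integrable_win[OF w \<phi>] integrable_win[OF p \<phi>] by simp
    also have "\<dots> = (\<integral>u. (\<Sum>k<D. g k u * \<phi> (u k)) - (\<Sum>k<D. p k u * (indicator E (u k) * \<phi> (u k))) \<partial>cube D)"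
    proof (rule integral_cong_AE)
      show "AE u in cube D. (\<Sum>k<D. w k u * \<phi> (u k)) - (\<Sum>k<D. p k u * \<phi> (u k))
          = (\<Sum>k<D. g k u * \<phi> (u k)) - (\<Sum>k<D. p k u * (indicator E (u k) * \<phi> (u k)))"
        using tie_won
      proof eventually_elim
        case (elim u)
        have "w k u * \<phi> (u k) - p k u * \<phi> (u k) = g k u * \<phi> (u k) - p k u * (indicator E (u k) * \<phi> (u k))"
          if "k < D" for k
        proof -
          have "w k u - p k u = g k u - of_bool (T u) * p k u"
            by (simp add: w_def)
          also have "\<dots> = g k u - p k u * indicator E (u k)"
            using elim that by simp
          finally have "(w k u - p k u) * \<phi> (u k) = (g k u - p k u * indicator E (u k)) * \<phi> (u k)"
            by simp
          then show ?thesis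
            by (simp only: left_diff_distrib mult.assoc)
        qed
        then show ?case
          by (simp flip: sum_subtractf)
      qed
      show "(\<lambda>u. (\<Sum>k<D. w k u * \<phi> (u k)) - (\<Sum>k<D. p k u * \<phi> (u k))) \<in> borel_measurable (cube D)"
        using integrable_win[OF w \<phi>] integrable_win[OF p \<phi>] by simp
      show "(\<lambda>u. (\<Sum>k<D. g k u * \<phi> (u k)) - (\<Sum>k<D. p k u * (indicator E (u k) * \<phi> (u k)))) \<in> borel_measurable (cube D)"
        by (intro borel_measurable_diff[OF _ borel_measurable_integrable[OF integrable_win[OF p E\<phi>]]]
            borel_measurable_sum g\<phi>_meas) simp
    qed
    also have "\<dots> = (\<Sum>k<D. \<integral>u. g k u * \<phi> (u k) \<partial>cube D) - win_mean D p (\<lambda>x. indicator E x * \<phi> x)"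
    proof -
      have "integrable (cube D) (\<lambda>u. \<Sum>k<D. g k u * \<phi> (u k))"
        by (intro Bochner_Integration.integrable_sum g\<phi>_int) simp
      moreover have "(\<integral>u. (\<Sum>k<D. g k u * \<phi> (u k)) \<partial>cube D) = (\<Sum>k<D. \<integral>u. g k u * \<phi> (u k) \<partial>cube D)"
        by (intro Bochner_Integration.integral_sum g\<phi>_int) simp
      ultimately show ?thesis
        using Bochner_Integration.integral_diff[OF _ integrable_win[OF p E\<phi>]] by (simp add: win_mean_def)
    qed
    also have "win_mean D p (\<lambda>x. indicator E x * \<phi> x) = (\<integral>x. f x * (indicator E x * \<phi> x) \<partial>unif01)"
      by (rule win_f[OF E\<phi>])
    also have "\<dots> = (\<integral>x. c * (indicator E x * \<phi> x) \<partial>unif01)"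
      by (intro Bochner_Integration.integral_cong refl) (auto simp: E_def split: split_indicator)
    also have "(\<Sum>k<D. \<integral>u. g k u * \<phi> (u k) \<partial>cube D)
        = (\<Sum>k<D. (\<integral>u. g k u \<partial>cube D) * (\<integral>x. indicator E x * \<phi> x \<partial>unif01) / measure unif01 E)"
      using g\<phi> m_pos by (intro sum.cong refl) (simp add: field_simps)
    finally show ?thesis
      by (simp add: G_def left_diff_distrib sum_distrib_right sum_divide_distrib)
  qed
  \<comment> \<open>Both laws have total mass 1, which fixes the remaining constant.\<close>
  have "win_mean D w (\<lambda>_. 1) = win_mean D p (\<lambda>_. 1)"
    unfolding win_mean_def using strategy_sum[OF w] strategy_sum[OF p]
    by (intro Bochner_Integration.integral_cong refl) simp
  then have "G / measure unif01 E = c"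
    using win_w[of "\<lambda>_. 1"] m_pos E_meas by simp
  then have "strategy_law D w = strategy_law D p"
    using win_w[of "indicator _"] by (intro strategy_law_eqI w p) (auto split: split_indicator)
  then have "deterministic D w"
    using det w by blast
  then have "AE u in cube D. w 0 u \<in> {0, 1}"
    using D by (simp add: deterministic_def)
  \<comment> \<open>If all coordinates lie in \<open>E\<close>, the weight of label 0 is
    \<open>1 / D\<close>, which is neither 0 nor 1 as \<open>D \<ge> 2\<close>. Yet this event has
    probability \<open>measure unif01 E ^ D > 0\<close>.\<close>
  then have "AE u in cube D. \<not> (\<forall>i\<in>{..<D}. u i \<in> E)"
  proof eventually_elim
    case (elim u)
    show ?case
    proof
      assume all: "\<forall>i\<in>{..<D}. u i \<in> E"
      then have "ties u = real D" "T u"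
        using D by (auto simp: T_def ties_def E_def)
      then have "w 0 u = 1 / real D"
        using all D by (simp add: w_def g_def)
      then show False
        using elim D by auto
    qed
  qed
  then have "emeasure (cube D) {u \<in> space (cube D). \<forall>i\<in>{..<D}. u i \<in> E} = 0"
    by (subst (asm) AE_iff_measurable[OF _ refl])
      (use E_meas cube_component_measurable in \<open>auto intro!: sets.sets_Collect_finite_All simp: measurable_sets_Collect\<close>)
  moreover have "emeasure (cube D) {u \<in> space (cube D). \<forall>i\<in>{..<D}. u i \<in> E} = (\<Prod>i<D. emeasure unif01 E)"
    unfolding cube_def by (rule unif01_seq.emeasure_PiM_Collect) (use E_meas in auto)
  ultimately show False
    using E_pos by simp
qed

text \<open>Domination leaves weight only on maximisers of \<open>f\<close>; without ties there is
  just one, which then carries weight 1. Thus \<open>p\<close> itself is greedy for its own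
  density.\<close>

lemma deterministic_imp_greedy:
  assumes D: "2 \<le> D" and p: "strategy D p"
    and det: "\<And>q. strategy D q \<Longrightarrow> strategy_law D q = strategy_law D p \<Longrightarrow> deterministic D q"
  shows "\<exists>f. has_density (strategy_law D p) f \<and>
    (\<forall>c. emeasure unif01 {x \<in> space unif01. f x = c} = 0) \<and>
    (\<forall>k<D. AE u in cube D. p k u = of_bool (\<forall>i<D. f (u k) \<ge> f (u i)))"
proof -
  obtain f where f_meas: "f \<in> borel_measurable unif01" and f: "\<And>x. 0 \<le> f x" "\<And>x. f x \<le> real D"
    and law: "strategy_law D p = density unif01 f"
    and win_f: "\<And>\<phi> C. \<phi> \<in> borel_measurable unif01 \<Longrightarrow> (\<And>x. x \<in> space unif01 \<Longrightarrow> \<bar>\<phi> x\<bar> \<le> C) \<Longrightarrow>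
      win_mean D p \<phi> = (\<integral>x. f x * \<phi> x \<partial>unif01)"
    using strategy_density[OF p] by blast
  have atomless: "emeasure unif01 {x \<in> space unif01. f x = c} = 0" for c
    by (rule winner_density_atomless[OF D p det f_meas f win_f])
  have dom: "AE u in cube D. \<forall>k<D. \<forall>j<D. f (u k) < f (u j) \<longrightarrow> p k u = 0"
    using D by (intro winner_dominates[OF _ p det f_meas f win_f]) auto
  have "AE u in cube D. \<forall>k<D. p k u = of_bool (\<forall>i<D. f (u k) \<ge> f (u i))"
    using dom AE_cube_distinct[OF f_meas atomless] AE_space
  proof eventually_elim
    case (elim u)
    show ?case
    proof (intro allI impI)
      fix k assume k: "k < D"
      show "p k u = of_bool (\<forall>i<D. f (u k) \<ge> f (u i))"
      proof (cases "\<forall>i<D. f (u k) \<ge> f (u i)")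
        case True
        have "p j u = 0" if "j < D" "j \<noteq> k" for j
        proof -
          have "f (u j) < f (u k)"
            using True elim(2)[rule_format, of j k] that k by (simp add: order.strict_iff_order)
          then show ?thesis
            using elim(1) that k by blast
        qed
        then have "(\<Sum>j<D. p j u) = p k u"
          using k by (subst sum.remove[of _ k]) auto
        then show ?thesis
          using strategy_sum[OF p elim(3)] True by simp
      next
        case False
        then show ?thesis
          using elim(1) k by (auto simp: not_le)
      qed
    qed
  qed
  then have "\<forall>k<D. AE u in cube D. p k u = of_bool (\<forall>i<D. f (u k) \<ge> f (u i))"
    by (auto elim!: eventually_mono)
  with f_meas f law atomless show ?thesis
    unfolding has_density_def by blast
qed

section \<open>Greedy strategies\<close>

definition unif01_cdf :: "(real \<Rightarrow> real) \<Rightarrow> real \<Rightarrow> real" where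
  "unif01_cdf f t = measure unif01 {x \<in> space unif01. f x \<le> t}"

lemma borel_measurable_mono_compose:
  fixes F f :: "real \<Rightarrow> real"
  assumes "mono F" "f \<in> borel_measurable M"
  shows "(\<lambda>x. F (f x)) \<in> borel_measurable M"
  using measurable_compose[OF assms(2) borel_measurable_mono[OF assms(1)]] .

lemma unif01_cdf_mono:
  assumes [measurable]: "f \<in> borel_measurable unif01"
  shows "mono (unif01_cdf f)"
proof (rule monoI)
  fix s t :: real assume "s \<le> t"
  have "{x \<in> space unif01. f x \<le> t} \<in> sets unif01"
    by measurable
  with \<open>s \<le> t\<close> show "unif01_cdf f s \<le> unif01_cdf f t"
    unfolding unif01_cdf_def by (intro unif01.finite_measure_mono) auto
qed

text \<open>Given \<open>u k = x\<close>, the other \<open>D - 1\<close> coordinates are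
  independent, and each stays below the level \<open>f x\<close> with probability
  \<open>unif01_cdf f (f x)\<close>.\<close>

lemma nn_integral_greedy_component:
  assumes k: "k < D" and f [measurable]: "f \<in> borel_measurable unif01" and A [measurable]: "A \<in> sets unif01"
  shows "(\<integral>\<^sup>+u. indicator {u. \<forall>i<D. f (u i) \<le> f (u k)} u * indicator A (u k) \<partial>cube D)
    = (\<integral>\<^sup>+x. ennreal (unif01_cdf f (f x) ^ (D - 1)) * indicator A x \<partial>unif01)"
proof -
  let ?J = "{..<D} - {k}"
  let ?R = "\<Pi>\<^sub>M j\<in>?J. unif01"
  have f_coord [measurable]: "(\<lambda>u. f (u i)) \<in> borel_measurable (cube D)" if "i < D" for i
    using measurable_compose[OF cube_component_measurable[OF that] f] .
  have "{u \<in> space (cube D). \<forall>i\<in>{..<D}. f (u i) \<le> f (u k)} \<in> sets (cube D)"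
    using f_coord[OF k] f_coord by (intro sets.sets_Collect_finite_All) (auto intro!: borel_measurable_le)
  moreover have "(\<lambda>u. indicator A (u k) :: ennreal) \<in> borel_measurable (cube D)"
    using measurable_compose[OF cube_component_measurable[OF k] borel_measurable_indicator[OF A]] .
  ultimately have meas: "(\<lambda>u. indicator {u \<in> space (cube D). \<forall>i\<in>{..<D}. f (u i) \<le> f (u k)} u * indicator A (u k) :: ennreal)
      \<in> borel_measurable (cube D)"
    by measurable
  have "(\<integral>\<^sup>+u. indicator {u. \<forall>i<D. f (u i) \<le> f (u k)} u * indicator A (u k) \<partial>cube D)
      = (\<integral>\<^sup>+u. indicator {u \<in> space (cube D). \<forall>i\<in>{..<D}. f (u i) \<le> f (u k)} u * indicator A (u k) \<partial>cube D)"
    by (intro nn_integral_cong) (auto split: split_indicator)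
  also have "\<dots> = (\<integral>\<^sup>+x. \<integral>\<^sup>+v. indicator {u \<in> space (cube D). \<forall>i\<in>{..<D}. f (u i) \<le> f (u k)} (v(k := x))
      * indicator A ((v(k := x)) k) \<partial>?R \<partial>unif01)"
    by (rule nn_integral_cube_split[OF k meas])
  also have "\<dots> = (\<integral>\<^sup>+x. ennreal (unif01_cdf f (f x) ^ (D - 1)) * indicator A x \<partial>unif01)"
  proof (rule nn_integral_cong)
    fix x assume x: "x \<in> space unif01"
    let ?B = "{y \<in> space unif01. f y \<le> f x}"
    let ?S = "{v \<in> space ?R. \<forall>i\<in>?J. v i \<in> ?B}"
    have B: "?B \<in> sets unif01"
      by measurable
    have "v(k := x) \<in> {u \<in> space (cube D). \<forall>i\<in>{..<D}. f (u i) \<le> f (u k)} \<longleftrightarrow> v \<in> ?S" if v: "v \<in> space ?R" for v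
    proof -
      have "v(k := x) \<in> space (cube D)"
        using v x k by (auto simp: cube_def space_PiM PiE_iff extensional_def)
      moreover have "v i \<in> space unif01" if "i \<in> ?J" for i
        using v that by (auto simp: space_PiM)
      ultimately show ?thesis
        using v k by auto
    qed
    then have "(\<integral>\<^sup>+v. indicator {u \<in> space (cube D). \<forall>i\<in>{..<D}. f (u i) \<le> f (u k)} (v(k := x))
        * indicator A ((v(k := x)) k) \<partial>?R) = (\<integral>\<^sup>+v. indicator ?S v * indicator A x \<partial>?R)"
      by (intro nn_integral_cong) (simp add: indicator_def)
    also have "\<dots> = emeasure ?R ?S * indicator A x"
    proof -
      have "?S \<in> sets ?R"
        using B by (intro sets.sets_Collect_finite_All) (auto intro!: measurable_sets_Collect[OF measurable_component_singleton])
      then show ?thesis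
        by (subst nn_integral_multc) simp_all
    qed
    also have "emeasure ?R ?S = (\<Prod>i\<in>?J. emeasure unif01 ?B)"
      by (rule unif01_seq.emeasure_PiM_Collect) (use B in auto)
    also have "\<dots> = ennreal (unif01_cdf f (f x) ^ (D - 1))"
      using k by (simp add: unif01_cdf_def unif01.emeasure_eq_measure ennreal_power)
    finally show "(\<integral>\<^sup>+v. indicator {u \<in> space (cube D). \<forall>i\<in>{..<D}. f (u i) \<le> f (u k)} (v(k := x))
        * indicator A ((v(k := x)) k) \<partial>?R) = ennreal (unif01_cdf f (f x) ^ (D - 1)) * indicator A x" .
  qed
  finally show ?thesis .
qed

lemma greedy_law:
  assumes q: "strategy D q" and f: "f \<in> borel_measurable unif01"
    and greedy: "\<And>k. k < D \<Longrightarrow> AE u in cube D. q k u = of_bool (\<forall>i<D. f (u k) \<ge> f (u i))"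
  shows "strategy_law D q = density unif01 (\<lambda>x. ennreal (real D * unif01_cdf f (f x) ^ (D - 1)))"
proof (rule measure_eqI)
  fix A assume "A \<in> sets (strategy_law D q)"
  then have A: "A \<in> sets unif01"
    by simp
  have F: "(\<lambda>x. unif01_cdf f (f x) ^ (D - 1)) \<in> borel_measurable unif01"
    by (rule borel_measurable_power[OF borel_measurable_mono_compose[OF unif01_cdf_mono[OF f] f]])
  have "emeasure (strategy_law D q) A = (\<Sum>k<D. \<integral>\<^sup>+u. ennreal (q k u) * indicator A (u k) \<partial>cube D)"
    by (rule emeasure_strategy_law[OF q A])
  also have "\<dots> = (\<Sum>k<D. \<integral>\<^sup>+u. indicator {u. \<forall>i<D. f (u i) \<le> f (u k)} u * indicator A (u k) \<partial>cube D)"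
  proof (intro sum.cong refl nn_integral_cong_AE)
    fix k assume "k \<in> {..<D}"
    then have "AE u in cube D. q k u = of_bool (\<forall>i<D. f (u k) \<ge> f (u i))"
      using greedy by simp
    then show "AE u in cube D. ennreal (q k u) * indicator A (u k)
        = indicator {u. \<forall>i<D. f (u i) \<le> f (u k)} u * indicator A (u k)"
      by eventually_elim (auto simp: indicator_def)
  qed
  also have "\<dots> = of_nat D * (\<integral>\<^sup>+x. ennreal (unif01_cdf f (f x) ^ (D - 1)) * indicator A x \<partial>unif01)"
    by (simp add: nn_integral_greedy_component f A)
  also have "\<dots> = (\<integral>\<^sup>+x. of_nat D * (ennreal (unif01_cdf f (f x) ^ (D - 1)) * indicator A x) \<partial>unif01)"
    by (intro nn_integral_cmult[symmetric] borel_measurable_times_ennreal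
        measurable_compose[OF F measurable_ennreal] borel_measurable_indicator A)
  also have "\<dots> = (\<integral>\<^sup>+x. ennreal (real D * unif01_cdf f (f x) ^ (D - 1)) * indicator A x \<partial>unif01)"
    by (intro nn_integral_cong) (simp add: ennreal_mult' ennreal_of_nat_eq_real_of_nat mult.assoc unif01_cdf_def)
  also have "\<dots> = emeasure (density unif01 (\<lambda>x. ennreal (real D * unif01_cdf f (f x) ^ (D - 1)))) A"
    by (rule emeasure_density[symmetric])
      (intro measurable_compose[OF borel_measurable_times[OF borel_measurable_const F] measurable_ennreal], fact A)
  finally show "emeasure (strategy_law D q) A = emeasure (density unif01 (\<lambda>x. ennreal (real D * unif01_cdf f (f x) ^ (D - 1)))) A" .
qed simp

text \<open>Ties go to the smallest index, because a strategy must have total weight 1 at every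
  point and not only almost everywhere.\<close>

definition greedy :: "nat \<Rightarrow> (real \<Rightarrow> real) \<Rightarrow> nat \<Rightarrow> (nat \<Rightarrow> real) \<Rightarrow> real" where
  "greedy D f k u = of_bool ((\<forall>i<D. f (u i) \<le> f (u k)) \<and> (\<forall>i<k. f (u i) < f (u k)))"

lemma strategy_greedy:
  assumes D: "0 < D" and f: "f \<in> borel_measurable unif01"
  shows "strategy D (greedy D f)"
proof (rule strategyI)
  have f_coord: "(\<lambda>u. f (u i)) \<in> borel_measurable (cube D)" if "i < D" for i
    using measurable_compose[OF cube_component_measurable[OF that] f] .
  show "greedy D f k \<in> borel_measurable (cube D)" if k: "k < D" for k
  proof -
    have "{u \<in> space (cube D). \<forall>i\<in>{..<D}. f (u i) \<le> f (u k)} \<in> sets (cube D)"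
      using f_coord[OF k] f_coord by (intro sets.sets_Collect_finite_All) (auto intro!: borel_measurable_le)
    moreover have "{u \<in> space (cube D). \<forall>i\<in>{..<k}. f (u i) < f (u k)} \<in> sets (cube D)"
      using f_coord[OF k] f_coord k by (intro sets.sets_Collect_finite_All) (auto intro!: borel_measurable_less)
    ultimately have "{u \<in> space (cube D). \<forall>i\<in>{..<D}. f (u i) \<le> f (u k)}
        \<inter> {u \<in> space (cube D). \<forall>i\<in>{..<k}. f (u i) < f (u k)} \<in> sets (cube D)" (is "?S \<in> _")
      by simp
    then have "(indicator ?S :: _ \<Rightarrow> real) \<in> borel_measurable (cube D)"
      by (rule borel_measurable_indicator)
    moreover have "greedy D f k u = indicator ?S u" if "u \<in> space (cube D)" for u
      using that by (auto simp: greedy_def indicator_def)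
    ultimately show ?thesis
      by (simp cong: measurable_cong)
  qed
  show "0 \<le> greedy D f k u" for k u
    by (simp add: greedy_def)
  show "(\<Sum>k<D. greedy D f k u) = 1" for u
  proof -
    let ?M = "Max ((\<lambda>i. f (u i)) ` {..<D})"
    have le: "f (u i) \<le> ?M" if "i < D" for i
      using that by (intro Max_ge) auto
    have "?M \<in> (\<lambda>i. f (u i)) ` {..<D}"
      using D by (intro Max_in) auto
    then have ex: "\<exists>k. k < D \<and> f (u k) = ?M"
      by auto
    define k where "k = (LEAST k. k < D \<and> f (u k) = ?M)"
    have k: "k < D" "f (u k) = ?M"
      using LeastI_ex[OF ex] by (auto simp: k_def)
    have least: "f (u i) < f (u k)" if "i < k" for i
    proof -
      have "i < D"
        using that k(1) by simp
      moreover have "\<not> (i < D \<and> f (u i) = ?M)"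
        using that unfolding k_def by (rule not_less_Least)
      ultimately have "f (u i) \<noteq> ?M" "f (u i) \<le> ?M"
        using le by blast+
      then show ?thesis
        unfolding k(2) by (rule order.not_eq_order_implies_strict)
    qed
    have le_k: "f (u i) \<le> f (u k)" if "i < D" for i
      unfolding k(2) by (rule le[OF that])
    have "greedy D f j u = 0" if "j < D" "j \<noteq> k" for j
    proof (cases "j < k")
      case True
      then show ?thesis
        using least[of j] k(1) by (auto simp: greedy_def not_le)
    next
      case False
      then show ?thesis
        using le_k[OF that(1)] that(2) by (auto simp: greedy_def not_less intro!: exI[of _ k])
    qed
    then have "(\<Sum>j<D. greedy D f j u) = greedy D f k u"
      using k(1) by (subst sum.remove[of _ k]) auto
    also have "\<dots> = 1"
      using le_k least by (simp add: greedy_def)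
    finally show ?thesis .
  qed
qed

lemma AE_greedy:
  assumes f: "f \<in> borel_measurable unif01"
    and atomless: "\<And>c. emeasure unif01 {x \<in> space unif01. f x = c} = 0" and k: "k < D"
  shows "AE u in cube D. greedy D f k u = of_bool (\<forall>i<D. f (u k) \<ge> f (u i))"
  using AE_cube_distinct[OF f atomless]
proof eventually_elim
  case (elim u)
  then have "f (u i) < f (u k)" if "\<forall>i<D. f (u i) \<le> f (u k)" "i < k" for i
    using that k by (metis less_trans nat_neq_iff order_le_imp_less_or_eq)
  then show ?case
    by (auto simp: greedy_def)
qed

text \<open>
  Testing against a bounded increasing function of \<open>f\<close> shows that any other strategy
  with the same law as the greedy one also picks the largest \<open>f\<close>-value almost surely.
\<close>

lemma greedy_law_imp_deterministic:
  fixes f :: "real \<Rightarrow> real"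
  assumes q: "strategy D q" and q0: "strategy D q0" and law: "strategy_law D q0 = strategy_law D q"
    and f: "f \<in> borel_measurable unif01"
    and greedy: "\<And>k. k < D \<Longrightarrow> AE u in cube D. q0 k u = of_bool (\<forall>i<D. f (u k) \<ge> f (u i))"
  shows "deterministic D q"
proof -
  \<comment> \<open>\<open>arctan\<close> is strictly increasing, so it keeps the maximisers of
    \<open>f\<close>, and bounded, so that \<open>g\<close> is admissible as a test function. The
    bound 2 exceeds \<open>pi / 2\<close>.\<close>
  define g where "g x = arctan (f x)" for x
  have g: "g \<in> borel_measurable unif01"
    unfolding g_def [abs_def] using f borel_measurable_arctan by simp
  have g_bound: "\<bar>g x\<bar> \<le> 2" for x
    using arctan_bounded[of "f x"] pi_less_4 by (auto simp: g_def abs_le_iff)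
  have int: "integrable (cube D) (\<lambda>u. \<Sum>k<D. q k u * g (u k))" "integrable (cube D) (\<lambda>u. \<Sum>k<D. q0 k u * g (u k))"
    using integrable_win[OF q g g_bound] integrable_win[OF q0 g g_bound] .
  have "win_mean D q0 g = win_mean D q g"
    by (rule win_mean_cong_law[OF q0 q law g g_bound])
  then have eq: "(\<integral>u. (\<Sum>k<D. q0 k u * g (u k)) - (\<Sum>k<D. q k u * g (u k)) \<partial>cube D) = 0"
    using int by (simp add: win_mean_def)
  have "AE u in cube D. \<forall>k\<in>{..<D}. q0 k u = of_bool (\<forall>i<D. f (u k) \<ge> f (u i))"
    using greedy by (intro AE_finite_allI) auto
  then have best: "AE u in cube D. \<exists>k<D. (\<forall>i<D. g (u i) \<le> g (u k)) \<and> (\<forall>i<D. i \<noteq> k \<longrightarrow> g (u i) < g (u k))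
      \<and> (\<Sum>j<D. q0 j u * g (u j)) = g (u k)"
    using AE_space
  proof eventually_elim
    case (elim u)
    let ?W = "{k\<in>{..<D}. \<forall>i<D. f (u k) \<ge> f (u i)}"
    \<comment> \<open>Almost everywhere the total weight of \<open>q0\<close> counts the maximisers
      of \<open>f\<close>; as it is 1, the maximiser is unique.\<close>
    have "(\<Sum>k<D. q0 k u) = real (card ?W)"
      using elim(1) by (simp add: sum.If_cases Int_def of_bool_def)
    then have "card ?W = 1"
      using strategy_sum[OF q0 elim(2)] by simp
    then obtain k where W: "?W = {k}"
      by (rule card_1_singletonE)
    then have k: "k < D" "\<forall>i<D. f (u k) \<ge> f (u i)"
      by auto
    have lt: "f (u i) < f (u k)" if i: "i < D" "i \<noteq> k" for i
    proof (rule ccontr)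
      assume "\<not> f (u i) < f (u k)"
      with k i have "i \<in> ?W"
        by (force intro: order_trans)
      with W i show False
        by auto
    qed
    have "q0 j u = 0" if "j < D" "j \<noteq> k" for j
      using elim(1) lt[OF that] k(1) that by (auto simp: not_le)
    then have "(\<Sum>j<D. q0 j u * g (u j)) = q0 k u * g (u k)"
      using k(1) by (subst sum.remove[of _ k]) auto
    then show ?case
      using elim(1) k lt by (intro exI[of _ k]) (auto simp: g_def arctan_le_iff arctan_less_iff)
  qed
  have diff_nonneg: "AE u in cube D. 0 \<le> (\<Sum>k<D. q0 k u * g (u k)) - (\<Sum>k<D. q k u * g (u k))"
    using best AE_space
  proof eventually_elim
    case (elim u)
    then obtain k where k: "\<forall>i<D. g (u i) \<le> g (u k)" "(\<Sum>j<D. q0 j u * g (u j)) = g (u k)"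
      by blast
    have "(\<Sum>j<D. q j u * g (u j)) \<le> (\<Sum>j<D. q j u * g (u k))"
      using k(1) strategy_nonneg[OF q _ elim(2)] by (intro sum_mono mult_left_mono) auto
    then show ?case
      using k(2) strategy_sum[OF q elim(2)] by (simp flip: sum_distrib_right)
  qed
  then have "AE u in cube D. (\<Sum>k<D. q0 k u * g (u k)) - (\<Sum>k<D. q k u * g (u k)) = 0"
    using eq int by (subst (asm) integral_nonneg_eq_0_iff_AE) auto
  then have "AE u in cube D. \<forall>k<D. q k u \<in> {0, 1}"
    using best AE_space
  proof eventually_elim
    case (elim u)
    then obtain k where k: "k < D" "\<forall>i<D. i \<noteq> k \<longrightarrow> g (u i) < g (u k)" "(\<Sum>j<D. q0 j u * g (u j)) = g (u k)"
      by blast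
    have "(\<Sum>j<D. q j u * (g (u k) - g (u j))) = g (u k) - (\<Sum>j<D. q j u * g (u j))"
      using strategy_sum[OF q elim(3)] by (simp add: right_diff_distrib sum_subtractf flip: sum_distrib_right)
    also have "\<dots> = 0"
      using elim(1) k(3) by simp
    \<comment> \<open>The shortfalls \<open>g (u k) - g (u j)\<close> are positive for
      \<open>j \<noteq> k\<close>, so a vanishing weighted sum leaves no weight off
      \<open>k\<close>.\<close>
    finally have sum0: "(\<Sum>j<D. q j u * (g (u k) - g (u j))) = 0" .
    have nn: "0 \<le> q j u * (g (u k) - g (u j))" if "j < D" for j
    proof -
      have "g (u j) \<le> g (u k)"
        using k(2) that by (cases "j = k") (auto intro: less_imp_le)
      then show ?thesis
        using strategy_nonneg[OF q that elim(3)] by simp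
    qed
    have zero: "q j u = 0" if "j < D" "j \<noteq> k" for j
    proof -
      have "q j u * (g (u k) - g (u j)) = 0"
        using sum0 nn that by (subst (asm) sum_nonneg_eq_0_iff) auto
      then show ?thesis
        using k(2)[rule_format, of j] that by auto
    qed
    then have "(\<Sum>j<D. q j u) = q k u"
      using k(1) by (subst sum.remove[of _ k]) auto
    then have "q k u = 1"
      using strategy_sum[OF q elim(3)] by simp
    with zero show ?case
      by auto
  qed
  then show ?thesis
    unfolding deterministic_def by (auto elim!: eventually_mono)
qed

section \<open>The beta law\<close>

text \<open>The probability integral transform: a continuous distribution function makes its own
  variable uniform. It may be flat, so no inverse is used; the sublevel set is instead a half-line
  ending at its supremum, where continuity gives the value \<open>s\<close>.\<close>

lemma (in real_distribution) prob_cdf_le: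
  assumes atomless: "\<And>x. measure M {x} = 0" and s: "0 < s" "s < 1"
  shows "measure M {x. cdf M x \<le> s} = s"
proof -
  let ?S = "{x. cdf M x \<le> s}"
  have cont: "isCont (cdf M) x" for x
    using atomless by (simp add: isCont_cdf)
  have "\<forall>\<^sub>F x in at_top. s < cdf M x"
    using order_tendstoD(1)[OF cdf_lim_at_top_prob s(2)] .
  then obtain b where b: "\<And>x. b \<le> x \<Longrightarrow> s < cdf M x"
    by (auto simp: eventually_at_top_linorder)
  have "\<forall>\<^sub>F x in at_bot. cdf M x < s"
    using order_tendstoD(2)[OF cdf_lim_at_bot s(1)] .
  then obtain a where a: "\<And>x. x \<le> a \<Longrightarrow> cdf M x < s"
    by (auto simp: eventually_at_bot_linorder)
  have "a \<le> b"
    using a[of b] b[of b] by (meson less_asym linear)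
  then obtain t where t: "cdf M t = s"
    using IVT[of "cdf M" a s b] a[of a] b[of b] cont by auto
  have bdd: "bdd_above ?S"
    using b by (intro bdd_aboveI[of _ b]) (meson linear mem_Collect_eq not_le)
  have "closed ?S"
    using cont by (intro closed_Collect_le continuous_at_imp_continuous_on continuous_on_const) auto
  then have "Sup ?S \<in> ?S"
    using bdd t by (intro closed_contains_Sup) auto
  moreover have "s \<le> cdf M (Sup ?S)"
    using cdf_nondecreasing[OF cSup_upper[OF _ bdd], of t] t by simp
  ultimately have "cdf M (Sup ?S) = s"
    by simp
  moreover have "?S = {..Sup ?S}"
  proof (intro set_eqI iffI)
    fix x assume "x \<in> {..Sup ?S}"
    then show "x \<in> ?S"
      using cdf_nondecreasing[of x "Sup ?S"] \<open>cdf M (Sup ?S) = s\<close> by simp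
  qed (use cSup_upper[OF _ bdd] in auto)
  ultimately show ?thesis
    by (simp add: cdf_def2)
qed

context
  fixes a :: real
  assumes a: "0 < a"
begin

text \<open>\<open>Beta a 1 = Gamma a * Gamma 1 / Gamma (a + 1) = 1 / a\<close>, and the factor with
  exponent \<open>1 - 1\<close> is 1 on the open interval.\<close>

lemma beta_density_right_1: "beta_density a 1 x = indicator {0<..<1} x * (a * x powr (a - 1))"
proof -
  have "a \<notin> \<int>\<^sub>\<le>\<^sub>0"
    using a nonpos_Ints_nonpos[of a] by auto
  then have "Gamma (a + 1) = a * Gamma a" "Gamma a \<noteq> 0"
    by (simp_all add: Gamma_plus1 Gamma_eq_zero_iff)
  then have "Beta a 1 = 1 / a"
    by (simp add: Beta_def)
  then show ?thesis
    by (simp add: beta_density_def indicator_def)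
qed

lemma beta_density_right_1_measurable: "(\<lambda>x. ennreal (beta_density a 1 x)) \<in> borel_measurable lborel"
  unfolding beta_density_right_1 by measurable

lemma emeasure_beta_right_1_Iic:
  assumes t: "0 \<le> t" "t \<le> 1"
  shows "emeasure (density lborel (\<lambda>x. ennreal (beta_density a 1 x))) {..t} = ennreal (t powr a)"
proof -
  have "((\<lambda>x. a * x powr (a - 1)) has_integral (t powr a - 0 powr a)) {0..t}"
  proof (rule fundamental_theorem_of_calculus_interior)
    \<comment> \<open>For \<open>a < 1\<close> the density is unbounded at 0. The antiderivative
      \<open>x powr a\<close> is still continuous there, and differentiability in the interior
      suffices.\<close>
    show "continuous_on {0..t} (\<lambda>x. x powr a)"
      using a by (intro continuous_on_powr' continuous_intros) auto
    show "((\<lambda>x. x powr a) has_vector_derivative a * x powr (a - 1)) (at x)" if "x \<in> {0<..<t}" for x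
      using that by (auto intro!: derivative_eq_intros simp flip: has_real_derivative_iff_has_vector_derivative)
  qed (use t in auto)
  then have "(\<integral>\<^sup>+x. ennreal (indicator {0..t} x * (a * x powr (a - 1))) \<partial>lborel) = ennreal (t powr a - 0 powr a)"
    using a by (intro nn_integral_has_integral_lebesgue) auto
  moreover have "(\<integral>\<^sup>+x. ennreal (indicator {0..t} x * (a * x powr (a - 1))) \<partial>lborel)
      = (\<integral>\<^sup>+x. ennreal (beta_density a 1 x) * indicator {..t} x \<partial>lborel)"
  proof (rule nn_integral_cong_AE)
    have "AE x in lborel. x \<noteq> (0::real)" "AE x in lborel. x \<noteq> (1::real)"
      by (rule AE_lborel_singleton)+
    then show "AE x in lborel. ennreal (indicator {0..t} x * (a * x powr (a - 1)))
        = ennreal (beta_density a 1 x) * indicator {..t} x"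
      by eventually_elim (use t in \<open>auto simp: beta_density_right_1 indicator_def\<close>)
  qed
  ultimately show ?thesis
    using beta_density_right_1_measurable by (simp add: emeasure_density)
qed

lemma emeasure_beta_right_1_compl: "emeasure (density lborel (\<lambda>x. ennreal (beta_density a 1 x))) (- {0<..<1}) = 0"
proof -
  have "emeasure (density lborel (\<lambda>x. ennreal (beta_density a 1 x))) (- {0<..<1})
      = (\<integral>\<^sup>+x. ennreal (beta_density a 1 x) * indicator (- {0<..<1}) x \<partial>lborel)"
    by (rule emeasure_density[OF beta_density_right_1_measurable]) simp
  also have "\<dots> = (\<integral>\<^sup>+(x::real). 0 \<partial>lborel)"
    by (intro nn_integral_cong) (simp add: beta_density_right_1 indicator_def)
  finally show ?thesis
    by simp
qed

lemma emeasure_beta_right_1_singleton: "emeasure (density lborel (\<lambda>x. ennreal (beta_density a 1 x))) {c} = 0"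
proof -
  have "emeasure (density lborel (\<lambda>x. ennreal (beta_density a 1 x))) {c}
      = (\<integral>\<^sup>+x. ennreal (beta_density a 1 x) * indicator {c} x \<partial>lborel)"
    by (rule emeasure_density[OF beta_density_right_1_measurable]) simp
  then show ?thesis
    by (simp add: nn_integral_indicator_singleton)
qed

lemma real_distribution_beta_right_1: "real_distribution (density lborel (\<lambda>x. ennreal (beta_density a 1 x)))" (is "real_distribution ?B")
proof -
  have "emeasure ?B {1<..} \<le> emeasure ?B (- {0<..<1})"
    by (rule emeasure_mono) auto
  then have "emeasure ?B {1<..} = 0"
    using emeasure_beta_right_1_compl by simp
  then have "emeasure ?B ({..1} \<union> {1<..}) = 1"
    using emeasure_beta_right_1_Iic[of 1] by (subst plus_emeasure[symmetric]) auto
  moreover have "{..1} \<union> {1<..} = (UNIV :: real set)"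
    by auto
  ultimately have "prob_space ?B"
    by (intro prob_spaceI) simp
  then show ?thesis
    by (simp add: real_distribution_def real_distribution_axioms_def)
qed

lemma cdf_beta_right_1:
  "cdf (density lborel (\<lambda>x. ennreal (beta_density a 1 x))) t = (if t < 0 then 0 else if t \<le> 1 then t powr a else 1)"
    (is "cdf ?B t = _")
proof -
  interpret B: real_distribution ?B
    by (rule real_distribution_beta_right_1)
  consider "t < 0" | "0 \<le> t" "t \<le> 1" | "1 < t"
    by linarith
  then show ?thesis
  proof cases
    case 1
    then have "emeasure ?B {..t} \<le> emeasure ?B (- {0<..<1})"
      by (intro emeasure_mono) auto
    then have "emeasure ?B {..t} = 0"
      using emeasure_beta_right_1_compl by simp
    then show ?thesis
      using 1 by (simp add: cdf_def2 measure_def)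
  next
    case 2
    then show ?thesis
      using emeasure_beta_right_1_Iic[of t] by (simp add: cdf_def2 measure_def)
  next
    case 3
    have "cdf ?B 1 = 1"
      using emeasure_beta_right_1_Iic[of 1] by (simp add: cdf_def2 measure_def)
    then show ?thesis
      using 3 B.cdf_nondecreasing[of 1 t] B.cdf_bounded_prob[of t] by simp
  qed
qed

end

text \<open>The exponent takes a root of order \<open>D - 1\<close>. Base 0 is treated apart, since
  passing from \<open>powr\<close> to a natural power requires a positive base; there
  \<open>D - 1 > 0\<close> is used.\<close>

lemma powr_inverse_pred_power:
  assumes "2 \<le> D" "0 \<le> x"
  shows "(x powr (1 / (real D - 1))) ^ (D - 1) = x"
proof (cases "x = 0")
  case False
  then have "(x powr (1 / (real D - 1))) ^ (D - 1) = (x powr (1 / (real D - 1))) powr real (D - 1)"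
    by (intro powr_realpow[symmetric]) simp
  also have "\<dots> = x"
    using assms False by (simp add: powr_powr of_nat_diff)
  finally show ?thesis .
qed (use assms in \<open>simp add: zero_power\<close>)

section \<open>The fixed point equation and the beta law\<close>

text \<open>With \<open>Y = f / D\<close> and \<open>F\<close> its own distribution function, the
  equation reads \<open>Y = F(Y) ^ (D - 1)\<close>. As \<open>F(Y)\<close> is uniform, this
  prescribes the distribution function of \<open>Y\<close>, which determines the law.\<close>

lemma greedy_density_imp_beta:
  assumes D: "2 \<le> D" and f: "f \<in> borel_measurable unif01" 
    and atomless: "\<And>c. emeasure unif01 {x \<in> space unif01. f x = c} = 0"
    and fix_eq: "AE x in unif01. f x = real D * unif01_cdf f (f x) ^ (D - 1)"
  shows "distributed unif01 lborel (\<lambda>x. f x / real D) (\<lambda>x. ennreal (beta_density (1 / (real D - 1)) 1 x))"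
proof -
  define a where "a = 1 / (real D - 1)"
  have a: "0 < a"
    using D by (simp add: a_def)
  let ?Y = "\<lambda>x. f x / real D"
  have Y: "?Y \<in> borel_measurable unif01"
    using f by simp
  define M where "M = distr unif01 borel ?Y"
  interpret M: real_distribution M
    unfolding M_def by (rule unif01.real_distribution_distr[OF Y])
  have measure_M: "measure M A = measure unif01 {x \<in> space unif01. ?Y x \<in> A}" if "A \<in> sets borel" for A
    unfolding M_def using measure_distr[OF Y that] by (simp add: vimage_def Int_def conj_commute)
  have cdf_M: "cdf M t = unif01_cdf f (real D * t)" for t
    using D by (simp add: cdf_def2 measure_M unif01_cdf_def divide_le_eq mult.commute)
  have M_atomless: "measure M {c} = 0" for c
  proof -
    have "{x \<in> space unif01. ?Y x \<in> {c}} = {x \<in> space unif01. f x = real D * c}"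
      using D by (auto simp: field_simps)
    moreover have "measure M {c} = measure unif01 {x \<in> space unif01. ?Y x \<in> {c}}"
      by (rule measure_M) simp
    ultimately have "measure M {c} = measure unif01 {x \<in> space unif01. f x = real D * c}"
      by (simp only:)
    also have "\<dots> = 0"
      using atomless[of "real D * c"] by (simp add: measure_def)
    finally show ?thesis .
  qed
  have fix_eq': "AE x in unif01. ?Y x = cdf M (?Y x) ^ (D - 1)"
    using fix_eq by eventually_elim (use D in \<open>simp add: cdf_M field_simps\<close>)
  have pow_le: "y ^ (D - 1) \<le> t \<longleftrightarrow> y \<le> t powr a" if "0 \<le> y" "0 \<le> t" for y t :: real
  proof -
    have "y \<le> t powr a \<longleftrightarrow> y ^ (D - 1) \<le> (t powr a) ^ (D - 1)"
      using that D by (subst power_mono_iff) auto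
    then show ?thesis
      using powr_inverse_pred_power[OF D that(2)] by (simp add: a_def)
  qed
  have cdf_measurable: "cdf M \<in> borel_measurable borel"
    by (intro borel_measurable_mono monoI M.cdf_nondecreasing)
  \<comment> \<open>By the equation, \<open>Y \<le> t\<close> means that \<open>F(Y)\<close> is at
    most \<open>t powr a\<close>, an event of probability \<open>t powr a\<close>. The transform
    requires this level to lie strictly between 0 and 1, so the ends are handled separately.\<close>
  have interior: "cdf M t = t powr a" if t: "0 < t" "t < 1" for t
  proof -
    have ta: "0 < t powr a" "t powr a < 1"
      using t a powr_less_mono2[of a t 1] by auto
    have "cdf M t = measure unif01 {x \<in> space unif01. ?Y x \<le> t}"
      by (simp add: cdf_def2 measure_M)
    also have "\<dots> = measure unif01 {x \<in> space unif01. cdf M (?Y x) \<le> t powr a}"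
    proof (rule unif01.finite_measure_eq_AE)
      show "AE x in unif01. x \<in> {x \<in> space unif01. ?Y x \<le> t} \<longleftrightarrow> x \<in> {x \<in> space unif01. cdf M (?Y x) \<le> t powr a}"
        using fix_eq'
      proof eventually_elim
        case (elim x)
        have "?Y x \<le> t \<longleftrightarrow> cdf M (?Y x) ^ (D - 1) \<le> t"
          using elim by (rule arg_cong)
        also have "\<dots> \<longleftrightarrow> cdf M (?Y x) \<le> t powr a"
          using M.cdf_nonneg t by (intro pow_le) auto
        finally show ?case
          by simp
      qed
      show "{x \<in> space unif01. ?Y x \<le> t} \<in> sets unif01"
        using Y by measurable
      show "{x \<in> space unif01. cdf M (?Y x) \<le> t powr a} \<in> sets unif01"
        using measurable_compose[OF Y cdf_measurable] by measurable
    qed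
    also have "\<dots> = measure M {y. cdf M y \<le> t powr a}"
    proof -
      have "{y. cdf M y \<le> t powr a} \<in> sets borel"
        using borel_measurable_le[OF cdf_measurable borel_measurable_const, of "t powr a"]
        by (simp only: space_borel UNIV_I simp_thms)
      from measure_M[OF this] show ?thesis
        by (simp only: mem_Collect_eq)
    qed
    also have "\<dots> = t powr a"
      by (rule M.prob_cdf_le[OF M_atomless ta])
    finally show ?thesis .
  qed
  \<comment> \<open>Being a power of a probability, \<open>Y\<close> lies in \<open>[0,1]\<close>.
    This settles the distribution function outside the open interval.\<close>
  have AE_01: "AE x in unif01. 0 \<le> ?Y x \<and> ?Y x \<le> 1"
    using fix_eq'
  proof eventually_elim
    case (elim x)
    have "0 \<le> cdf M (?Y x) ^ (D - 1)" "cdf M (?Y x) ^ (D - 1) \<le> 1"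
      using M.cdf_nonneg M.cdf_bounded_prob by (auto intro: power_le_one)
    with elim show ?case
      by metis
  qed
  have "cdf M t = (if t < 0 then 0 else if t \<le> 1 then t powr a else 1)" for t
  proof -
    consider "t \<le> 0" | "0 < t" "t < 1" | "1 \<le> t"
      by linarith
    then show ?thesis
    proof cases
      case 1
      have "measure M {..t} \<le> measure M {..0}"
        using 1 by (intro M.finite_measure_mono) auto
      \<comment> \<open>Nonnegativity of \<open>Y\<close> only excludes negative values; the point 0
        is excluded by the absence of atoms.\<close>
      also have "measure M {..0} = measure M {..<0} + measure M {0}"
        by (subst M.finite_measure_Union[symmetric]) (auto intro!: arg_cong[where f="measure M"])
      also have "measure M {..<0} = 0"
      proof -
        have "measure unif01 {x \<in> space unif01. ?Y x \<in> {..<0}} = measure unif01 {}"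
          using AE_01 Y by (intro unif01.finite_measure_eq_AE) (auto elim!: eventually_mono)
        then show ?thesis
          by (simp add: measure_M)
      qed
      finally have "cdf M t = 0"
        using M_atomless[of 0] measure_nonneg[of M "{..t}"] by (simp add: cdf_def2)
      then show ?thesis
        using 1 by auto
    next
      case 2
      then show ?thesis
        using interior by simp
    next
      case 3
      have "measure unif01 {x \<in> space unif01. ?Y x \<in> {..1}} = measure unif01 (space unif01)"
        using AE_01 Y by (intro unif01.finite_measure_eq_AE) (auto elim!: eventually_mono)
      then have "cdf M 1 = 1"
        by (simp add: cdf_def2 measure_M unif01.prob_space)
      then have "cdf M t = 1"
        using M.cdf_nondecreasing[OF 3] M.cdf_bounded_prob[of t] by simp
      then show ?thesis
        using 3 by auto
    qed
  qed
  then have "cdf M = cdf (density lborel (\<lambda>x. ennreal (beta_density a 1 x)))"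
    by (intro ext) (simp add: cdf_beta_right_1[OF a])
  then have "M = density lborel (\<lambda>x. ennreal (beta_density a 1 x))"
    by (rule cdf_unique[OF M.real_distribution_axioms real_distribution_beta_right_1[OF a]])
  moreover have "distr unif01 lborel ?Y = M"
    unfolding M_def by (rule distr_cong) auto
  ultimately show ?thesis
    unfolding distributed_def a_def[symmetric]
    using Y beta_density_right_1_measurable[OF a] by simp
qed

text \<open>The beta law has no atoms, and its distribution function at \<open>y\<close> is the root
  of order \<open>D - 1\<close> of \<open>y\<close>. At \<open>y = f x / D\<close>, raising to the
  power \<open>D - 1\<close> and multiplying by \<open>D\<close> returns \<open>f x\<close>.\<close>

lemma beta_imp_greedy_density:
  assumes D: "2 \<le> D" and f: "f \<in> borel_measurable unif01"
    and beta: "distributed unif01 lborel (\<lambda>x. f x / real D) (\<lambda>x. ennreal (beta_density (1 / (real D - 1)) 1 x))"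
  shows "emeasure unif01 {x \<in> space unif01. f x = c} = 0"
    and "AE x in unif01. f x = real D * unif01_cdf f (f x) ^ (D - 1)"
proof -
  define a where "a = 1 / (real D - 1)"
  have a: "0 < a"
    using D by (simp add: a_def)
  let ?Y = "\<lambda>x. f x / real D"
  let ?B = "density lborel (\<lambda>x. ennreal (beta_density a 1 x))"
  have Y: "?Y \<in> measurable unif01 lborel"
    using f by simp
  have distr: "distr unif01 lborel ?Y = ?B"
    using beta by (simp add: distributed_def a_def)
  have emeasure_B: "emeasure unif01 {x \<in> space unif01. ?Y x \<in> A} = emeasure ?B A" if "A \<in> sets borel" for A
    using emeasure_distr[OF Y, of A] that by (simp flip: distr add: vimage_def Int_def conj_commute)
  have "{x \<in> space unif01. f x = c} = {x \<in> space unif01. ?Y x \<in> {c / real D}}"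
    using D by (auto simp: field_simps)
  moreover have "emeasure unif01 {x \<in> space unif01. ?Y x \<in> {c / real D}} = emeasure ?B {c / real D}"
    by (rule emeasure_B) simp
  ultimately have "emeasure unif01 {x \<in> space unif01. f x = c} = emeasure ?B {c / real D}"
    by (simp only:)
  then show "emeasure unif01 {x \<in> space unif01. f x = c} = 0"
    by (simp only: emeasure_beta_right_1_singleton[OF a])
  have "AE x in unif01. ?Y x \<in> {0<..<1}"
  proof (rule AE_I)
    show "{x \<in> space unif01. ?Y x \<notin> {0<..<1}} \<subseteq> {x \<in> space unif01. ?Y x \<in> - {0<..<1}}"
      by auto
    show "emeasure unif01 {x \<in> space unif01. ?Y x \<in> - {0<..<1}} = 0"
      using emeasure_beta_right_1_compl[OF a] by (simp only: emeasure_B borel_comp borel_open open_greaterThanLessThan)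
    show "{x \<in> space unif01. ?Y x \<in> - {0<..<1}} \<in> sets unif01"
      using f by measurable
  qed
  then show "AE x in unif01. f x = real D * unif01_cdf f (f x) ^ (D - 1)"
  proof eventually_elim
    case (elim x)
    have "{z \<in> space unif01. f z \<le> f x} = {z \<in> space unif01. ?Y z \<in> {..?Y x}}"
      using D by (auto simp: divide_le_cancel)
    moreover have "emeasure unif01 {z \<in> space unif01. ?Y z \<in> {..?Y x}} = emeasure ?B {..?Y x}"
      by (rule emeasure_B) simp
    ultimately have "unif01_cdf f (f x) = enn2real (emeasure ?B {..?Y x})"
      by (simp only: unif01_cdf_def measure_def)
    also have "\<dots> = ?Y x powr a"
      using elim by (subst emeasure_beta_right_1_Iic[OF a]) auto
    finally show ?case
      using powr_inverse_pred_power[OF D, of "?Y x"] elim D by (simp add: a_def)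
  qed
qed

section \<open>Assembling the equivalences\<close>

text \<open>Level sets are the largest sets on which \<open>f\<close> is constant, and they are
  measurable.\<close>

lemma atomless_iff_not_constant_on:
  assumes f: "f \<in> borel_measurable unif01"
  shows "(\<forall>A\<in>sets unif01. emeasure unif01 A > 0 \<longrightarrow> \<not> f constant_on A)
    \<longleftrightarrow> (\<forall>c::real. emeasure unif01 {x \<in> space unif01. f x = c} = 0)"
proof (intro iffI allI ballI impI notI)
  fix c assume *: "\<forall>A\<in>sets unif01. emeasure unif01 A > 0 \<longrightarrow> \<not> f constant_on A"
  have "{x \<in> space unif01. f x = c} \<in> sets unif01"
    using f by measurable
  moreover have "f constant_on {x \<in> space unif01. f x = c}"
    by (auto simp: constant_on_def)
  ultimately show "emeasure unif01 {x \<in> space unif01. f x = c} = 0"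
    using * by (meson not_gr_zero)
next
  fix A assume null: "\<forall>c. emeasure unif01 {x \<in> space unif01. f x = c} = 0"
    and A: "A \<in> sets unif01" "emeasure unif01 A > 0" and "f constant_on A"
  then obtain c where "\<forall>x\<in>A. f x = c"
    by (auto simp: constant_on_def)
  then have "A \<subseteq> {x \<in> space unif01. f x = c}"
    using sets.sets_into_space[OF A(1)] by auto
  moreover have "{x \<in> space unif01. f x = c} \<in> sets unif01"
    using f by measurable
  ultimately have "emeasure unif01 A \<le> emeasure unif01 {x \<in> space unif01. f x = c}"
    by (rule emeasure_mono)
  then show False
    using A(2) null by simp
qed

text \<open>Densities are unique almost everywhere, and nonnegativity of both sides lets the
  coercion \<open>ennreal\<close> be removed.\<close>

lemma greedy_fixed_point_iff:
  assumes f: "f \<in> borel_measurable unif01" "\<forall>x\<in>space unif01. 0 \<le> f x"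
  shows "density unif01 (\<lambda>x. ennreal (f x)) = density unif01 (\<lambda>x. ennreal (real D * unif01_cdf f (f x) ^ (D - 1)))
    \<longleftrightarrow> (AE x in unif01. f x = real D * unif01_cdf f (f x) ^ (D - 1))"
proof -
  have "(\<lambda>x. real D * unif01_cdf f (f x) ^ (D - 1)) \<in> borel_measurable unif01"
    by (rule borel_measurable_times[OF borel_measurable_const
          borel_measurable_power[OF borel_measurable_mono_compose[OF unif01_cdf_mono[OF f(1)] f(1)]]])
  then have "density unif01 (\<lambda>x. ennreal (f x)) = density unif01 (\<lambda>x. ennreal (real D * unif01_cdf f (f x) ^ (D - 1)))
      \<longleftrightarrow> (AE x in unif01. ennreal (f x) = ennreal (real D * unif01_cdf f (f x) ^ (D - 1)))"
    using f(1) by (intro unif01.density_unique_iff measurable_compose[OF _ measurable_ennreal])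
  also have "\<dots> \<longleftrightarrow> (AE x in unif01. f x = real D * unif01_cdf f (f x) ^ (D - 1))"
    using f(2) by (intro AE_cong) (simp add: unif01_cdf_def)
  finally show ?thesis .
qed

text \<open>For one and the same version \<open>f\<close> of the density, both sides amount to
  \<open>f\<close> having no atoms and solving \<open>f x = D * F (f x) ^ (D - 1)\<close> almost
  everywhere, with \<open>F\<close> its distribution function.\<close>

lemma greedy_iff_beta:
  assumes D: "2 \<le> D" and f: "has_density (strategy_law D p) f"
  shows "(\<forall>A\<in>sets unif01. emeasure unif01 A > 0 \<longrightarrow> \<not> f constant_on A) \<and>
      (\<exists>q. strategy D q \<and> strategy_law D q = strategy_law D p \<and>
        (\<forall>k<D. AE u in cube D. q k u = of_bool (\<forall>i<D. f (u k) \<ge> f (u i))))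
    \<longleftrightarrow> distributed unif01 lborel (\<lambda>x. f x / real D) (\<lambda>x. ennreal (beta_density (1 / (real D - 1)) 1 x))"
    (is "?atomless \<and> ?greedy \<longleftrightarrow> ?beta")
proof -
  have f_meas: "f \<in> borel_measurable unif01" and f_nonneg: "\<forall>x\<in>space unif01. 0 \<le> f x"
    and law: "strategy_law D p = density unif01 (\<lambda>x. ennreal (f x))"
    using f by (auto simp: has_density_def)
  note atomless_iff = atomless_iff_not_constant_on[OF f_meas]
  note fixed_point_iff = greedy_fixed_point_iff[OF f_meas f_nonneg, of D]
  show ?thesis
  proof
    assume "?atomless \<and> ?greedy"
    then obtain q where atomless: "\<And>c. emeasure unif01 {x \<in> space unif01. f x = c} = 0"
      and q: "strategy D q" "strategy_law D q = strategy_law D p"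
      and greedy: "\<And>k. k < D \<Longrightarrow> AE u in cube D. q k u = of_bool (\<forall>i<D. f (u k) \<ge> f (u i))"
      unfolding atomless_iff by blast
    have "density unif01 (\<lambda>x. ennreal (f x)) = density unif01 (\<lambda>x. ennreal (real D * unif01_cdf f (f x) ^ (D - 1)))"
      using greedy_law[OF q(1) f_meas greedy] q(2) law by simp
    then have "AE x in unif01. f x = real D * unif01_cdf f (f x) ^ (D - 1)"
      by (rule fixed_point_iff[THEN iffD1])
    then show ?beta
      by (rule greedy_density_imp_beta[OF D f_meas atomless])
  next
    assume beta: ?beta
    note atomless = beta_imp_greedy_density(1)[OF D f_meas beta]
    have g: "strategy D (greedy D f)"
      using D by (intro strategy_greedy f_meas) simp
    have AE: "AE u in cube D. greedy D f k u = of_bool (\<forall>i<D. f (u k) \<ge> f (u i))" if "k < D" for k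
      by (rule AE_greedy[OF f_meas atomless that])
    have "strategy_law D (greedy D f) = strategy_law D p"
      using greedy_law[OF g f_meas AE] fixed_point_iff[THEN iffD2, OF beta_imp_greedy_density(2)[OF D f_meas beta]] law
      by simp
    then show "?atomless \<and> ?greedy"
      unfolding atomless_iff using atomless g AE by blast
  qed
qed

theorem theoremB:
  fixes D :: nat and p :: "nat \<Rightarrow> (nat \<Rightarrow> real) \<Rightarrow> real"
  assumes "D \<ge> 2" and "strategy D p"
  shows "(extreme_measure (strategy_law D p) {strategy_law D q | q. strategy D q} \<longleftrightarrow>
            (\<forall>q. strategy D q \<and> consistent D q \<and> strategy_law D q = strategy_law D p \<longrightarrow> deterministic D q)) \<and>
         (extreme_measure (strategy_law D p) {strategy_law D q | q. strategy D q} \<longleftrightarrow>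
            (\<exists>f. has_density (strategy_law D p) f \<and>
               (\<forall>A\<in>sets unif01. emeasure unif01 A > 0 \<longrightarrow> \<not> f constant_on A) \<and>
               (\<exists>q. strategy D q \<and> strategy_law D q = strategy_law D p \<and>
                  (\<forall>k<D. AE u in cube D. q k u = of_bool (\<forall>i<D. f (u k) \<ge> f (u i)))))) \<and>
         (extreme_measure (strategy_law D p) {strategy_law D q | q. strategy D q} \<longleftrightarrow>
            (\<exists>f. has_density (strategy_law D p) f \<and>
               distributed unif01 lborel (\<lambda>x. f x / real D)
                 (\<lambda>x. ennreal (beta_density (1 / (real D - 1)) 1 x))))"
    (is "(?extreme \<longleftrightarrow> ?consistent) \<and> (?extreme \<longleftrightarrow> ?greedy) \<and> (?extreme \<longleftrightarrow> ?beta)")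
proof -
  have det: "deterministic D q" if ?extreme "strategy D q" "strategy_law D q = strategy_law D p" for q
    using extreme_imp_deterministic[of D q] that by simp
  \<comment> \<open>The implications run from extremal to greedy to consistent and back to extremal;
    the beta condition is tied to the greedy one.\<close>
  have 1: ?extreme if ?consistent
    by (rule consistent_deterministic_imp_extreme[OF assms(2)]) (use that in blast)
  have 2: ?greedy if ext: ?extreme
  proof -
    obtain f where f: "has_density (strategy_law D p) f" "\<forall>c. emeasure unif01 {x \<in> space unif01. f x = c} = 0"
        "\<forall>k<D. AE u in cube D. p k u = of_bool (\<forall>i<D. f (u k) \<ge> f (u i))"
      using deterministic_imp_greedy[OF assms det[OF ext]] by blast
    then have "\<forall>A\<in>sets unif01. emeasure unif01 A > 0 \<longrightarrow> \<not> f constant_on A"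
      by (subst atomless_iff_not_constant_on) (auto simp: has_density_def)
    \<comment> \<open>The witness for the greedy strategy is \<open>p\<close> itself.\<close>
    with f assms(2) show ?thesis
      by blast
  qed
  have 3: ?consistent if gr: ?greedy
  proof (intro allI impI)
    obtain f q0 where f: "has_density (strategy_law D p) f" and q0: "strategy D q0" "strategy_law D q0 = strategy_law D p"
      and greedy: "\<forall>k<D. AE u in cube D. q0 k u = of_bool (\<forall>i<D. f (u k) \<ge> f (u i))"
      using gr by blast
    fix q assume q: "strategy D q \<and> consistent D q \<and> strategy_law D q = strategy_law D p"
    show "deterministic D q"
      by (rule greedy_law_imp_deterministic[OF _ q0(1), of _ f]) (use q q0 f greedy in \<open>auto simp: has_density_def\<close>)
  qed
  have 4: "?greedy \<longleftrightarrow> ?beta"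
    using greedy_iff_beta[OF assms(1)] by blast
  show ?thesis
    using 1 2 3 4 by blast
qed

end
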